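(* For every $s\in\mathbb{R}$, let $\rho_s:\Gamma\to \mathrm{PU}(2,1)$ be the complex hyperbolic ideal triangle group representation with parameter $s$, and let $g_s$ be the product of the images under $\rho_s$ of the three standard generators of $\Gamma$. Then $\rho_s$ is a discrete embedding (i.e. $\rho_s$ is injective with discrete image) if and only if $g_s$ is not elliptic. Moreover, if $g_s$ is elliptic then $\rho_s$ is indiscrete, i.e. $\rho_s(\Gamma)$ is not a discrete subgroup of $\mathrm{PU}(2,1)$.
   Context: Let $\mathbb{C}^{2,1}$ be $\mathbb{C}^3$ with the Hermitian form $\langle u,v\rangle=u_1\bar v_1+u_2\bar v_2-u_3\bar v_3$. Let $\Theta(v_1,v_2,v_3)=(v_1/v_3,v_2/v_3)$. The complex hyperbolic plane $\mathbb{C}\mathbf{H}^2$ is identified, via $\Theta$, with the open unit ball of $\mathbb{C}^2$ (the image of the vectors with $\langle v,v\rangle<0$), and its ideal boundary with $S^3$ (the image of the nonzero vectors with $\langle v,v\rangle=0$). $\mathrm{SU}(2,1)$ is the group of determinant one complex linear maps preserving $\langle\,,\rangle$; $\mathrm{PU}(2,1)$ is its projectivization, acting on $\mathbb{C}\mathbf{H}^2\cup S^3$. An element of $\mathrm{PU}(2,1)$ is elliptic if it has a fixed point in $\mathbb{C}\mathbf{H}^2$. A $\mathbb{C}$-circle is the intersection of a complex line in $\mathbb{C}^2$ with $S^3$, when this intersection is more than one point; two distinct points of $S^3$ lie in a unique $\mathbb{C}$-circle. For each $\mathbb{C}$-circle $C$ there is a unique nontrivial involution in $\mathrm{PU}(2,1)$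 fixing $C$ pointwise, called the complex reflection fixing $C$: if $C^*$ is a vector with $\langle C^*,C^*\rangle>0$ orthogonal to all lifts of points of $C$, it is induced by $u\mapsto -u+\frac{2\langle u,C^*\rangle}{\langle C^*,C^*\rangle}C^*$. $\Gamma=\mathbb{Z}/2*\mathbb{Z}/2*\mathbb{Z}/2$. For $s\in\mathbb{R}$ put $\beta_s=\frac{s+i}{\sqrt{2+2s^2}}$ and consider the three points $(\beta_s,\beta_s)$, $(\beta_s,\bar\beta_s)$, $(\bar\beta_s,\bar\beta_s)$ of $S^3$; their Cartan angular invariant is $\pm\arctan s$. The representation $\rho_s$ sends the three standard generators of $\Gamma$ to the three complex reflections fixing the three $\mathbb{C}$-circles that contain pairs of these points. (Up to conjugation these are all the representations of $\Gamma$ sending the standard generators to distinct order-two complex reflections such that the product of any two distinct ones is parabolic.) The product $g_s$ is taken in any order; whether it is elliptic does not depend on the order. *)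

theory Defs
  imports "HOL-Analysis.Analysis" "HOL-Algebra.Coset"
begin

section \<open>The groups SU(2,1) and PU(2,1)\<close>

definition herm :: "complex^3 \<Rightarrow> complex^3 \<Rightarrow> complex" where
  "herm u v = u$1 * cnj (v$1) + u$2 * cnj (v$2) - u$3 * cnj (v$3)"

definition SU21 :: "(complex^3^3) monoid" where
  "SU21 = \<lparr>carrier = {A. det A = 1 \<and> (\<forall>u v. herm (A *v u) (A *v v) = herm u v)},
           mult = (**), one = mat 1\<rparr>"

definition SU21_scalars :: "(complex^3^3) set" where
  "SU21_scalars = {A \<in> carrier SU21. \<exists>c. A = mat c}"

definition PU21 :: "(complex^3^3) set monoid" where
  "PU21 = SU21 Mod SU21_scalars"

definition PU21_class :: "complex^3^3 \<Rightarrow> (complex^3^3) set" where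
  "PU21_class A = SU21_scalars #>\<^bsub>SU21\<^esub> A"

text \<open>The quotient topology; the lemma \<open>quotient_map_PU21_class\<close> below confirms this.\<close>

definition PU21_topology :: "(complex^3^3) set topology" where
  "PU21_topology = topology (\<lambda>U. U \<subseteq> carrier PU21 \<and>
     openin (top_of_set (carrier SU21)) {A \<in> carrier SU21. PU21_class A \<in> U})"

definition discrete_in_PU21 :: "(complex^3^3) set set \<Rightarrow> bool" where
  "discrete_in_PU21 H \<longleftrightarrow> subtopology PU21_topology H = discrete_topology H"


section \<open>The complex hyperbolic plane and its ideal boundary\<close>

abbreviation CH2 :: "(complex^2) set" where "CH2 \<equiv> ball 0 1"

abbreviation S3 :: "(complex^2) set" where "S3 \<equiv> sphere 0 1"

definition Theta :: "complex^3 \<Rightarrow> complex^2" where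
  "Theta v = vector [v$1 / v$3, v$2 / v$3]"

definition lift :: "complex^2 \<Rightarrow> complex^3" where
  "lift z = vector [z$1, z$2, 1]"

text \<open>The image of a point does not depend on the representative matrix, so the set
  below is a singleton (see \<open>PU21_act_class\<close>).\<close>

definition PU21_act :: "(complex^3^3) set \<Rightarrow> complex^2 \<Rightarrow> complex^2" where
  "PU21_act g z = the_elem ((\<lambda>A. Theta (A *v lift z)) ` g)"

definition elliptic :: "(complex^3^3) set \<Rightarrow> bool" where
  "elliptic g \<longleftrightarrow> (\<exists>z\<in>CH2. PU21_act g z = z)"


section \<open>\<open>\<complex>\<close>-circles and complex reflections\<close>

definition complex_line :: "(complex^2) set \<Rightarrow> bool" where
  "complex_line L \<longleftrightarrow> (\<exists>a b. b \<noteq> 0 \<and> L = range (\<lambda>t. a + t *s b))"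

definition C_circle :: "(complex^2) set \<Rightarrow> bool" where
  "C_circle C \<longleftrightarrow> (\<exists>L. complex_line L \<and> C = L \<inter> S3) \<and> (\<exists>p\<in>C. \<exists>q\<in>C. p \<noteq> q)"

definition C_circle_through :: "complex^2 \<Rightarrow> complex^2 \<Rightarrow> (complex^2) set" where
  "C_circle_through p q = (THE C. C_circle C \<and> p \<in> C \<and> q \<in> C)"

definition complex_reflection :: "(complex^2) set \<Rightarrow> (complex^3^3) set" where
  "complex_reflection C = (THE g. g \<in> carrier PU21 \<and> g \<noteq> \<one>\<^bsub>PU21\<^esub> \<and>
     g \<otimes>\<^bsub>PU21\<^esub> g = \<one>\<^bsub>PU21\<^esub> \<and> (\<forall>z\<in>C. PU21_act g z = z))"


section \<open>The group \<open>\<int>/2 * \<int>/2 * \<int>/2\<close>\<close>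

text \<open>The free product is realised on reduced words, that is, words in the three generators
  without equal adjacent letters. The letters are the elements \<open>1\<close>, \<open>2\<close>, \<open>3\<close> of the
  three-element type \<open>3\<close>, in which \<open>3 = 0\<close>.\<close>

fun reduced_Cons :: "3 \<Rightarrow> 3 list \<Rightarrow> 3 list" where
  "reduced_Cons x [] = [x]"
| "reduced_Cons x (y # w) = (if x = y then w else x # y # w)"

definition Gamma_Z2 :: "3 list monoid" where
  "Gamma_Z2 = \<lparr>carrier = {w. distinct_adj w}, mult = foldr reduced_Cons, one = []\<rparr>"

definition Gamma_Z2_gen :: "3 \<Rightarrow> 3 list" where
  "Gamma_Z2_gen k = [k]"


section \<open>The ideal triangle group representations\<close>

definition beta :: "real \<Rightarrow> complex" where
  "beta s = (of_real s + \<i>) / of_real (sqrt (2 + 2 * s\<^sup>2))"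

definition ideal_vertex :: "real \<Rightarrow> 3 \<Rightarrow> complex^2" where
  "ideal_vertex s k =
     (if k = 1 then vector [beta s, beta s]
      else if k = 2 then vector [beta s, cnj (beta s)]
      else vector [cnj (beta s), cnj (beta s)])"

text \<open>Addition in the type \<open>3\<close> is modulo 3, so the \<open>k\<close>-th circle contains the vertices
  \<open>k\<close> and \<open>k + 1\<close>, cyclically.\<close>

definition triangle_reflection :: "real \<Rightarrow> 3 \<Rightarrow> (complex^3^3) set" where
  "triangle_reflection s k =
     complex_reflection (C_circle_through (ideal_vertex s k) (ideal_vertex s (k + 1)))"

text \<open>The homomorphism \<open>Gamma_Z2 \<rightarrow> PU21\<close> extending \<open>triangle_reflection s\<close>
  (see \<open>rho_hom\<close> and \<open>rho_gen\<close>).\<close>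

definition rho :: "real \<Rightarrow> 3 list \<Rightarrow> (complex^3^3) set" where
  "rho s w = foldr (\<lambda>k g. triangle_reflection s k \<otimes>\<^bsub>PU21\<^esub> g) w \<one>\<^bsub>PU21\<^esub>"


section \<open>Well-posedness of the definitions\<close>

subsection \<open>The free product\<close>

lemma distinct_adj_reduced_Cons: "distinct_adj w \<Longrightarrow> distinct_adj (reduced_Cons x w)"
  by (cases w) (auto simp: distinct_adj_Cons)

lemma distinct_adj_foldr: "distinct_adj w \<Longrightarrow> distinct_adj (foldr reduced_Cons v w)"
  by (induction v) (auto intro: distinct_adj_reduced_Cons)

lemma reduced_Cons_cancel: "distinct_adj w \<Longrightarrow> reduced_Cons x (reduced_Cons x w) = w"
  by (cases w rule: remdups_adj.cases) auto

lemma foldr_reduced_Cons_action: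
  assumes inv: "\<And>x a. a \<in> S \<Longrightarrow> f x (f x a) = a" and cl: "\<And>x a. a \<in> S \<Longrightarrow> f x a \<in> S"
    and a: "a \<in> S"
  shows "foldr f (foldr reduced_Cons v w) a = foldr f v (foldr f w a)"
proof (induction v)
  case (Cons x v)
  have cl': "foldr f u a \<in> S" for u
    by (induction u) (auto intro: cl a)
  have "foldr f (reduced_Cons x u) a = f x (foldr f u a)" for u
    by (cases u) (auto simp: inv cl')
  with Cons show ?case by simp
qed simp

lemma foldr_reduced_Cons_Nil: "distinct_adj w \<Longrightarrow> foldr reduced_Cons w [] = w"
proof (induction w)
  case (Cons x w)
  then show ?case by (cases w) auto
qed simp

lemma group_Gamma_Z2: "group Gamma_Z2"
proof (rule groupI)
  fix u v w assume "u \<in> carrier Gamma_Z2" "v \<in> carrier Gamma_Z2" "w \<in> carrier Gamma_Z2"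
  then show "u \<otimes>\<^bsub>Gamma_Z2\<^esub> v \<otimes>\<^bsub>Gamma_Z2\<^esub> w = u \<otimes>\<^bsub>Gamma_Z2\<^esub> (v \<otimes>\<^bsub>Gamma_Z2\<^esub> w)"
    unfolding Gamma_Z2_def
    by (simp, intro foldr_reduced_Cons_action[of "{w. distinct_adj w}"])
       (auto intro: reduced_Cons_cancel distinct_adj_reduced_Cons)
next
  fix w assume w: "w \<in> carrier Gamma_Z2"
  have "foldr reduced_Cons (rev v) (foldr reduced_Cons v []) = []" for v
  proof (induction v)
    case (Cons x v)
    have "reduced_Cons x (reduced_Cons x (foldr reduced_Cons v [])) = foldr reduced_Cons v []"
      by (intro reduced_Cons_cancel distinct_adj_foldr) simp
    with Cons show ?case by simp
  qed simp
  from this[of w] w have "rev w \<otimes>\<^bsub>Gamma_Z2\<^esub> w = \<one>\<^bsub>Gamma_Z2\<^esub>" "rev w \<in> carrier Gamma_Z2"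
    by (simp_all add: Gamma_Z2_def foldr_reduced_Cons_Nil)
  then show "\<exists>v\<in>carrier Gamma_Z2. v \<otimes>\<^bsub>Gamma_Z2\<^esub> w = \<one>\<^bsub>Gamma_Z2\<^esub>" by blast
qed (auto simp: Gamma_Z2_def distinct_adj_foldr)


subsection \<open>The groups SU(2,1) and PU(2,1)\<close>

lemma herm_simps:
  "herm (u + v) w = herm u w + herm v w" "herm w (u + v) = herm w u + herm w v"
  "herm (u - v) w = herm u w - herm v w" "herm w (u - v) = herm w u - herm w v"
  "herm (- u) w = - herm u w" "herm w (- u) = - herm w u"
  "herm (c *s u) w = c * herm u w" "herm w (c *s u) = cnj c * herm w u"
  by (simp_all add: herm_def algebra_simps)

lemma cnj_herm: "cnj (herm u v) = herm v u"
  by (simp add: herm_def)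

lemma group_SU21: "group SU21"
proof (rule groupI)
  fix A assume A: "A \<in> carrier SU21"
  then have "invertible A" by (simp add: SU21_def invertible_det_nz)
  then obtain B where B: "A ** B = mat 1" "B ** A = mat 1" by (auto simp: invertible_def)
  have "det A * det B = 1" using B(1) by (metis det_I det_mul)
  moreover have "herm (B *v u) (B *v v) = herm u v" for u v
  proof -
    have "herm (B *v u) (B *v v) = herm (A *v (B *v u)) (A *v (B *v v))"
      using A by (simp add: SU21_def)
    then show ?thesis by (simp add: matrix_vector_mul_assoc B)
  qed
  ultimately have "B \<in> carrier SU21" using A by (simp add: SU21_def)
  then show "\<exists>B\<in>carrier SU21. B \<otimes>\<^bsub>SU21\<^esub> A = \<one>\<^bsub>SU21\<^esub>" using B by (auto simp: SU21_def)
qed (auto simp: SU21_def det_mul matrix_mul_assoc simp flip: matrix_vector_mul_assoc)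

lemma mat_mult_vec: "(mat c :: complex^'n^'n) *v u = c *s u"
  by (auto simp: matrix_vector_mult_def mat_def vec_eq_iff if_distrib[of "\<lambda>x. x * _"] cong: if_cong)

lemma matrix_vector_scalar: "A *v (c *s u) = c *s (A *v (u :: complex^'n))"
  by (simp add: vector_scalar_commute)

lemma mat_commute: "(mat c :: complex^'n^'n) ** A = A ** mat c"
  by (simp add: matrix_eq mat_mult_vec matrix_vector_scalar flip: matrix_vector_mul_assoc)

lemma mat_mult_mat: "(mat c :: complex^'n^'n) ** mat d = mat (c * d)"
  by (simp add: matrix_eq mat_mult_vec flip: matrix_vector_mul_assoc)

interpretation SU21: group SU21 by (rule group_SU21)

lemma normal_SU21_scalars: "SU21_scalars \<lhd> SU21"
proof -
  have "subgroup SU21_scalars SU21"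
  proof (rule SU21.subgroupI)
    have "mat 1 \<in> SU21_scalars"
      using SU21.one_closed unfolding SU21_scalars_def by (auto simp: SU21_def)
    then show "SU21_scalars \<noteq> {}" by blast
  next
    fix A assume A: "A \<in> SU21_scalars"
    then obtain c where c: "A = mat c" and Ac: "A \<in> carrier SU21"
      by (auto simp: SU21_scalars_def)
    have "det A \<noteq> 0" using Ac by (simp add: SU21_def)
    then have "c \<noteq> 0" using c by (auto simp: det_3 mat_def)
    then have "mat (inverse c) ** A = mat 1" by (simp add: c mat_mult_mat)
    moreover have "A ** (inv\<^bsub>SU21\<^esub> A) = mat 1"
      using SU21.r_inv[OF Ac] by (simp add: SU21_def)
    ultimately have "inv\<^bsub>SU21\<^esub> A = mat (inverse c)"
      by (metis matrix_mul_assoc matrix_mul_lid matrix_mul_rid)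
    then show "inv\<^bsub>SU21\<^esub> A \<in> SU21_scalars" using SU21.inv_closed[OF Ac] by (auto simp: SU21_scalars_def)
  next
    fix A B assume "A \<in> SU21_scalars" "B \<in> SU21_scalars"
    then show "A \<otimes>\<^bsub>SU21\<^esub> B \<in> SU21_scalars"
      using SU21.m_closed[of A B] by (auto simp: SU21_scalars_def SU21_def mat_mult_mat)
  qed (auto simp: SU21_scalars_def)
  moreover have "A \<otimes>\<^bsub>SU21\<^esub> S \<otimes>\<^bsub>SU21\<^esub> inv\<^bsub>SU21\<^esub> A \<in> SU21_scalars"
    if A: "A \<in> carrier SU21" and S: "S \<in> SU21_scalars" for A S
  proof -
    obtain c where "S = mat c" using S by (auto simp: SU21_scalars_def)
    then have "A \<otimes>\<^bsub>SU21\<^esub> S = S \<otimes>\<^bsub>SU21\<^esub> A" by (simp add: SU21_def mat_commute[of c A])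
    moreover have Sc: "S \<in> carrier SU21" using S by (simp add: SU21_scalars_def)
    ultimately have "A \<otimes>\<^bsub>SU21\<^esub> S \<otimes>\<^bsub>SU21\<^esub> inv\<^bsub>SU21\<^esub> A = S"
      using A by (simp add: SU21.m_assoc)
    then show ?thesis using S by simp
  qed
  ultimately show ?thesis using SU21.normal_inv_iff by blast
qed

lemma group_PU21: "group PU21"
  unfolding PU21_def by (rule normal.factorgroup_is_group[OF normal_SU21_scalars])

interpretation PU21: group PU21 by (rule group_PU21)

lemma PU21_class_hom: "PU21_class \<in> hom SU21 PU21"
  unfolding PU21_class_def PU21_def by (rule normal.r_coset_hom_Mod[OF normal_SU21_scalars])

lemma carrier_PU21: "carrier PU21 = PU21_class ` carrier SU21"
  by (auto simp: PU21_def FactGroup_def RCOSETS_def PU21_class_def)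

lemma PU21_classD:
  assumes "A \<in> carrier SU21" "B \<in> PU21_class A"
  obtains c where "c \<noteq> 0" "B = mat c ** A"
proof -
  from assms obtain c where c: "mat c \<in> carrier SU21" "B = mat c ** A"
    by (auto simp: PU21_class_def r_coset_def SU21_scalars_def SU21_def)
  then have "c \<noteq> 0" by (auto simp: SU21_def det_3 mat_def)
  with c that show thesis by blast
qed

lemma class_in_PU21: "A \<in> carrier SU21 \<Longrightarrow> A \<in> PU21_class A"
  unfolding PU21_class_def
  by (rule SU21.rcos_self) (auto intro: normal_imp_subgroup normal_SU21_scalars)

lemma PU21_class_eq_iff:
  assumes "A \<in> carrier SU21" "B \<in> carrier SU21"
  shows "PU21_class A = PU21_class B \<longleftrightarrow> (\<exists>c. A = mat c ** B)"
proof
  assume "PU21_class A = PU21_class B"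
  then have "A \<in> PU21_class B" using class_in_PU21[OF assms(1)] by simp
  then show "\<exists>c. A = mat c ** B" using PU21_classD[OF assms(2)] by blast
next
  assume "\<exists>c. A = mat c ** B"
  then obtain c where c: "A = mat c ** B" ..
  have iB: "inv\<^bsub>SU21\<^esub> B \<in> carrier SU21" using assms by simp
  have "A \<otimes>\<^bsub>SU21\<^esub> inv\<^bsub>SU21\<^esub> B = mat c ** (B ** inv\<^bsub>SU21\<^esub> B)"
    by (simp add: c SU21_def matrix_mul_assoc)
  also have "B ** inv\<^bsub>SU21\<^esub> B = mat 1" using SU21.r_inv[OF assms(2)] by (simp add: SU21_def)
  finally have "A \<otimes>\<^bsub>SU21\<^esub> inv\<^bsub>SU21\<^esub> B = mat c" by simp
  then have "mat c \<in> SU21_scalars"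
    using SU21.m_closed[OF assms(1) iB] by (auto simp: SU21_scalars_def)
  then have "A \<in> PU21_class B"
    using c by (auto simp: PU21_class_def r_coset_def SU21_def)
  then show "PU21_class A = PU21_class B"
    unfolding PU21_class_def
    by (metis SU21.repr_independence assms(2) normal_SU21_scalars normal_imp_subgroup)
qed

lemma PU21_act_class:
  assumes "A \<in> carrier SU21"
  shows "PU21_act (PU21_class A) z = Theta (A *v lift z)"
proof -
  have "Theta (B *v lift z) = Theta (A *v lift z)" if B: "B \<in> PU21_class A" for B
  proof -
    obtain c where "c \<noteq> 0" "B = mat c ** A" using PU21_classD[OF assms B] .
    then show ?thesis by (simp add: Theta_def mat_mult_vec flip: matrix_vector_mul_assoc)
  qed
  moreover have "A \<in> PU21_class A" using assms by (rule class_in_PU21)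
  ultimately have "(\<lambda>B. Theta (B *v lift z)) ` PU21_class A = {Theta (A *v lift z)}" by blast
  then show ?thesis by (simp add: PU21_act_def)
qed

lemma openin_PU21_topology:
  "openin PU21_topology U \<longleftrightarrow> U \<subseteq> carrier PU21 \<and>
     openin (top_of_set (carrier SU21)) {A \<in> carrier SU21. PU21_class A \<in> U}"
proof -
  have "istopology (\<lambda>U. U \<subseteq> carrier PU21 \<and>
          openin (top_of_set (carrier SU21)) {A \<in> carrier SU21. PU21_class A \<in> U})"
    unfolding istopology_def
  proof (intro conjI allI impI)
    fix S T assume S: "S \<subseteq> carrier PU21 \<and>
          openin (top_of_set (carrier SU21)) {A \<in> carrier SU21. PU21_class A \<in> S}" 
      and T: "T \<subseteq> carrier PU21 \<and>
          openin (top_of_set (carrier SU21)) {A \<in> carrier SU21. PU21_class A \<in> T}" 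
    have "{A \<in> carrier SU21. PU21_class A \<in> S \<inter> T} =
      {A \<in> carrier SU21. PU21_class A \<in> S} \<inter> {A \<in> carrier SU21. PU21_class A \<in> T}" by auto
    then show "openin (top_of_set (carrier SU21)) {A \<in> carrier SU21. PU21_class A \<in> S \<inter> T}"
      using S T by auto
    show "S \<inter> T \<subseteq> carrier PU21" using S by auto
  next
    fix K assume K: "\<forall>S\<in>K. S \<subseteq> carrier PU21 \<and>
          openin (top_of_set (carrier SU21)) {A \<in> carrier SU21. PU21_class A \<in> S}"
    have "{A \<in> carrier SU21. PU21_class A \<in> \<Union> K} =
      \<Union> ((\<lambda>S. {A \<in> carrier SU21. PU21_class A \<in> S}) ` K)" by auto
    also have "openin (top_of_set (carrier SU21)) \<dots>" using K by auto
    finally show "openin (top_of_set (carrier SU21)) {A \<in> carrier SU21. PU21_class A \<in> \<Union> K}" .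
    show "\<Union> K \<subseteq> carrier PU21" using K by auto
  qed
  then show ?thesis unfolding PU21_topology_def by (simp add: topology_inverse')
qed

lemma topspace_PU21_topology: "topspace PU21_topology = carrier PU21"
proof (rule antisym)
  show "topspace PU21_topology \<subseteq> carrier PU21"
    by (auto simp: topspace_def openin_PU21_topology)
  have "{A \<in> carrier SU21. PU21_class A \<in> carrier PU21} = carrier SU21"
    by (auto simp: carrier_PU21)
  then have "openin PU21_topology (carrier PU21)"
    using openin_PU21_topology by auto
  then show "carrier PU21 \<subseteq> topspace PU21_topology" by (rule openin_subset)
qed

lemma quotient_map_PU21_class:
  "quotient_map (top_of_set (carrier SU21)) PU21_topology PU21_class"
  by (auto simp: quotient_map_def topspace_PU21_topology carrier_PU21 openin_PU21_topology)


subsection \<open>\<open>\<complex>\<close>-circles and complex reflections\<close>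

lemma lift_nth [simp]: "lift z $ 1 = z $ 1" "lift z $ 2 = z $ 2" "lift z $ 3 = 1"
  by (simp_all add: lift_def)

lemma herm_lift: "herm (lift z) (lift z) = of_real ((norm z)\<^sup>2 - 1)"
  by (simp add: herm_def norm_vec_def L2_set_def sum_2 sum_nonneg flip: complex_norm_square)

lemma S3_iff_herm: "z \<in> S3 \<longleftrightarrow> herm (lift z) (lift z) = 0"
proof -
  have "z \<in> S3 \<longleftrightarrow> (norm z)\<^sup>2 - 1 = 0" by (simp add: abs_square_eq_1)
  then show ?thesis unfolding herm_lift of_real_eq_0_iff .
qed

lemmas herm_S3 = S3_iff_herm[THEN iffD1]

lemma CH2_iff_herm: "z \<in> CH2 \<longleftrightarrow> Re (herm (lift z) (lift z)) < 0"
proof -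
  have "z \<in> CH2 \<longleftrightarrow> (norm z)\<^sup>2 - 1 < 0" by (simp add: abs_square_less_1)
  then show ?thesis unfolding herm_lift by simp
qed

lemma Theta_eq_S3_iff:
  assumes "z \<in> S3"
  shows "Theta v = z \<longleftrightarrow> (\<exists>c. c \<noteq> 0 \<and> v = c *s lift z)"
proof
  assume v: "Theta v = z"
  have "v $ 3 \<noteq> 0"
  proof
    assume "v $ 3 = 0"
    then have "z = 0" using v by (simp add: Theta_def vec_eq_iff forall_2)
    then show False using assms by simp
  qed
  moreover from this v have "v = (v $ 3) *s lift z"
    by (auto simp: Theta_def vec_eq_iff forall_2 forall_3 divide_eq_eq)
  ultimately show "\<exists>c. c \<noteq> 0 \<and> v = c *s lift z" by blast
qed (auto simp: Theta_def vec_eq_iff forall_2)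

lemma herm_lift_S3:
  assumes "p \<in> S3" "q \<in> S3" "p \<noteq> q"
  shows "herm (lift p) (lift q) \<noteq> 0"
proof
  assume h: "herm (lift p) (lift q) = 0"
  then have h': "herm (lift q) (lift p) = 0" using cnj_herm[of "lift p" "lift q"] by simp
  have "herm (lift p - lift q) (lift p - lift q) = 0"
    using herm_S3[OF assms(1)] herm_S3[OF assms(2)] by (simp add: herm_simps h h')
  moreover have "herm (lift p - lift q) (lift p - lift q) =
      of_real ((cmod (p$1 - q$1))\<^sup>2 + (cmod (p$2 - q$2))\<^sup>2)"
    using complex_norm_square[of "p$1 - q$1"] complex_norm_square[of "p$2 - q$2"]
    by (simp add: herm_def)
  ultimately have "(cmod (p$1 - q$1))\<^sup>2 + (cmod (p$2 - q$2))\<^sup>2 = 0"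
    by (simp only: of_real_eq_0_iff)
  then have "p$1 = q$1 \<and> p$2 = q$2" by (simp add: sum_power2_eq_zero_iff)
  then show False using assms(3) by (simp add: vec_eq_iff forall_2)
qed

lemma lift_line: "lift (p + t *s (q - p)) = lift p + t *s (lift q - lift p)"
  by (simp add: vec_eq_iff forall_3)

lemma C_circle_eq:
  assumes "C_circle C" "p \<in> C" "q \<in> C" "p \<noteq> q"
  shows "C = range (\<lambda>t. p + t *s (q - p)) \<inter> S3"
proof -
  obtain a b where ab: "b \<noteq> 0" "C = range (\<lambda>t. a + t *s b) \<inter> S3"
    using assms(1) by (auto simp: C_circle_def complex_line_def)
  obtain x y where x: "p = a + x *s b" and y: "q = a + y *s b" using assms ab by auto
  then have "x \<noteq> y" using assms by auto
  have qp: "q - p = (y - x) *s b" by (simp add: x y vec_eq_iff algebra_simps)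
  have 2: "p + t *s (q - p) = a + (x + t * (y - x)) *s b" for t
    unfolding qp by (simp add: x vec_eq_iff algebra_simps)
  have 1: "a + t *s b = p + ((t - x) / (y - x)) *s (q - p)" for t
    unfolding 2 using \<open>x \<noteq> y\<close> by simp
  have "range (\<lambda>t. a + t *s b) = range (\<lambda>t. p + t *s (q - p))"
  proof (intro equalityI image_subsetI)
    show "a + t *s b \<in> range (\<lambda>t. p + t *s (q - p))" for t unfolding 1 by (rule rangeI)
    show "p + t *s (q - p) \<in> range (\<lambda>t. a + t *s b)" for t unfolding 2 by (rule rangeI)
  qed
  then show ?thesis using ab by simp
qed

lemma C_circle_through:
  assumes "p \<in> S3" "q \<in> S3" "p \<noteq> q"
  shows "C_circle_through p q = range (\<lambda>t. p + t *s (q - p)) \<inter> S3"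
    and "C_circle (C_circle_through p q)" "p \<in> C_circle_through p q" "q \<in> C_circle_through p q"
proof -
  let ?C = "range (\<lambda>t. p + t *s (q - p)) \<inter> S3"
  have p: "p \<in> ?C" using assms by (auto intro!: image_eqI[of _ _ 0])
  have q: "q \<in> ?C" using assms by (auto intro!: image_eqI[of _ _ 1])
  have "complex_line (range (\<lambda>t. p + t *s (q - p)))"
    unfolding complex_line_def using assms(3) by (intro exI[of _ p] exI[of _ "q - p"]) auto
  then have C: "C_circle ?C" unfolding C_circle_def using p q assms(3) by blast
  show *: "C_circle_through p q = ?C"
    unfolding C_circle_through_def
  proof (rule the_equality)
    show "C_circle ?C \<and> p \<in> ?C \<and> q \<in> ?C" using C p q by blast
    show "C = ?C" if "C_circle C \<and> p \<in> C \<and> q \<in> C" for C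
      using that C_circle_eq[of C p q] assms(3) by blast
  qed
  show "C_circle (C_circle_through p q)" "p \<in> C_circle_through p q" "q \<in> C_circle_through p q"
    using C p q unfolding * by auto
qed

lemma C_circle_third_point:
  assumes "p \<in> S3" "q \<in> S3" "p \<noteq> q"
  obtains t where "t \<noteq> 0" "t \<noteq> 1" "p + t *s (q - p) \<in> S3"
proof -
  define h where "h = herm (lift p) (lift q)"
  have h: "h \<noteq> 0" using herm_lift_S3[OF assms] by (simp add: h_def)
  obtain e where e: "e = \<i> * cnj h \<or> e = - \<i> * cnj h" and e1: "1 + e \<noteq> 0"
  proof (cases "1 + \<i> * cnj h = 0")
    case True
    then have "1 + - \<i> * cnj h \<noteq> 0" by (simp add: add_eq_0_iff)
    then show ?thesis using that by blast
  next
    case False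
    then show ?thesis using that by blast
  qed
  have e0: "e \<noteq> 0" using e h by auto
  have eh: "e * h + cnj e * cnj h = 0" using e by auto
  define t where "t = 1 / (1 + e)"
  have t: "t \<noteq> 0" "t \<noteq> 1" "1 - t = e * t" using e0 e1 by (auto simp: t_def field_simps)
  have "lift (p + t *s (q - p)) = t *s (e *s lift p + lift q)"
  proof -
    have "lift (p + t *s (q - p)) = (1 - t) *s lift p + t *s lift q"
      by (simp add: lift_line vec_eq_iff forall_3 algebra_simps)
    then show ?thesis unfolding t(3) by (simp add: vec_eq_iff forall_3 algebra_simps)
  qed
  moreover have "herm (e *s lift p + lift q) (e *s lift p + lift q) = 0"
    using herm_S3[OF assms(1)] herm_S3[OF assms(2)] eh cnj_herm[of "lift p" "lift q"]
    by (simp add: herm_simps h_def algebra_simps)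
  ultimately have "p + t *s (q - p) \<in> S3"
    unfolding S3_iff_herm by (simp only: herm_simps(7,8) mult_zero_right)
  then show thesis using that t by blast
qed

text \<open>Every \<open>\<complex>\<close>-circle has a polar vector.\<close>

lemma polar_vector:
  assumes "C_circle C"
  obtains n where "Re (herm n n) > 0" "\<forall>z\<in>C. herm (lift z) n = 0"
proof -
  obtain p q where pq: "p \<in> C" "q \<in> C" "p \<noteq> q" using assms by (auto simp: C_circle_def)
  then have S: "p \<in> S3" "q \<in> S3" using assms by (auto simp: C_circle_def)
  define n :: "complex^3" where
    "n = vector [cnj (p$2 - q$2), cnj (q$1 - p$1), cnj (p$2 * q$1 - p$1 * q$2)]"
  have np: "herm (lift p) n = 0" and nq: "herm (lift q) n = 0"
    by (simp_all add: herm_def n_def algebra_simps)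
  have "herm n n = herm (lift p) (lift q) * herm (lift q) (lift p)
      - herm (lift p) (lift p) * herm (lift q) (lift q)"
    by (simp add: herm_def n_def algebra_simps)
  also have "\<dots> = herm (lift p) (lift q) * cnj (herm (lift p) (lift q))"
    using herm_S3[OF S(1)] by (simp add: cnj_herm)
  also have "\<dots> = of_real ((cmod (herm (lift p) (lift q)))\<^sup>2)"
    using complex_norm_square by simp
  finally have "Re (herm n n) > 0" using herm_lift_S3[OF S pq(3)] by simp
  moreover have "herm (lift z) n = 0" if "z \<in> C" for z
  proof -
    have "z \<in> range (\<lambda>t. p + t *s (q - p))" using that C_circle_eq[OF assms pq] by blast
    then obtain t where "z = p + t *s (q - p)" by blast
    then show ?thesis by (simp only: lift_line herm_simps np nq) simp
  qed
  ultimately show thesis using that by blast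
qed

lemma lift_lift_polar_span:
  assumes "p \<noteq> q" "herm (lift p) n = 0" "herm (lift q) n = 0" "herm n n \<noteq> 0"
  obtains a b c where "v = a *s lift p + b *s lift q + c *s n"
proof -
  define c where "c = herm v n / herm n n"
  define w where "w = v - c *s n - (v$3 - c * n$3) *s lift p"
  define x y where "x = w$1" and "y = w$2"
  have w3: "w$3 = 0" by (simp add: w_def)
  have "herm w n = 0" using assms by (simp add: w_def herm_simps c_def)
  then have 1: "x * cnj (n$1) + y * cnj (n$2) = 0" by (simp add: herm_def w3 x_def y_def)
  have 2: "(q$1 - p$1) * cnj (n$1) + (q$2 - p$2) * cnj (n$2) = 0"
    using assms(2,3) by (simp add: herm_def algebra_simps) 
  have "n$1 \<noteq> 0 \<or> n$2 \<noteq> 0"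
    using assms(2,4) by (auto simp: herm_def)
  then have 3: "x * (q$2 - p$2) = y * (q$1 - p$1)"
  proof
    assume n: "n$1 \<noteq> 0"
    have "(x * (q$2 - p$2) - y * (q$1 - p$1)) * cnj (n$1) = 
      (q$2 - p$2) * (x * cnj (n$1) + y * cnj (n$2)) - y * ((q$1 - p$1) * cnj (n$1) + (q$2 - p$2) * cnj (n$2))"
      by (simp add: algebra_simps)
    then show ?thesis using n 1 2 by simp
  next
    assume n: "n$2 \<noteq> 0"
    have "(x * (q$2 - p$2) - y * (q$1 - p$1)) * cnj (n$2) = 
      x * ((q$1 - p$1) * cnj (n$1) + (q$2 - p$2) * cnj (n$2)) - (q$1 - p$1) * (x * cnj (n$1) + y * cnj (n$2))"
      by (simp add: algebra_simps)
    then show ?thesis using n 1 2 by simp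
  qed
  obtain b where b: "x = b * (q$1 - p$1)" "y = b * (q$2 - p$2)"
  proof (cases "q$1 - p$1 = 0")
    case True
    then have "q$2 - p$2 \<noteq> 0" using assms(1) by (auto simp: vec_eq_iff forall_2)
    then show ?thesis using 3 True by (intro that[of "y / (q$2 - p$2)"]) auto
  next
    case False
    then show ?thesis using 3 by (intro that[of "x / (q$1 - p$1)"]) (auto simp: field_simps)
  qed
  have "w = b *s (lift q - lift p)"
    using b w3 by (simp add: vec_eq_iff forall_3 x_def y_def right_diff_distrib)
  then have "v = (v$3 - c * n$3 - b) *s lift p + b *s lift q + c *s n"
    unfolding w_def by (simp add: vec_eq_iff algebra_simps)
  then show thesis using that by blast
qed

definition reflection_matrix :: "complex^3 \<Rightarrow> complex^3^3" where
  "reflection_matrix n = (\<chi> i j. (if i = j then - 1 else 0)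
     + 2 / herm n n * n$i * (if j = 3 then - cnj (n$j) else cnj (n$j)))"

lemma reflection_matrix_mult:
  "reflection_matrix n *v u = - u + (2 * herm u n / herm n n) *s n"
proof -
  define k where "k = 2 / herm n n"
  have "reflection_matrix n *v u = - u + (k * herm u n) *s n"
    unfolding reflection_matrix_def k_def[symmetric]
    by (simp add: vec_eq_iff forall_3 matrix_vector_mult_def sum_3 herm_def algebra_simps)
  then show ?thesis by (simp add: k_def)
qed

lemma reflection_matrix_SU21:
  assumes "herm n n \<noteq> 0"
  shows "reflection_matrix n \<in> carrier SU21"
proof -
  define k where "k = 2 / herm n n"
  have "det (reflection_matrix n) = - 1 + k * herm n n"
    unfolding det_3 reflection_matrix_def k_def[symmetric]
    by (simp add: herm_def algebra_simps)
  then have "det (reflection_matrix n) = 1" using assms by (simp add: k_def)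
  moreover have "herm (reflection_matrix n *v u) (reflection_matrix n *v v) = herm u v" for u v
  proof -
    have k: "cnj k = k" "k * herm n n = 2" using assms cnj_herm[of n n] by (simp_all add: k_def)
    have R: "reflection_matrix n *v u = - u + (k * herm u n) *s n" for u
      by (simp add: reflection_matrix_mult k_def)
    have "herm (reflection_matrix n *v u) (reflection_matrix n *v v) =
        herm u v + k * herm u n * herm n v * (k * herm n n - 2)"
      unfolding R herm_simps by (simp add: cnj_herm k(1) algebra_simps)
    then show ?thesis by (simp add: k(2))
  qed
  ultimately show ?thesis by (simp add: SU21_def)
qed


lemma PU21_class_mult:
  assumes "A \<in> carrier SU21" "B \<in> carrier SU21"
  shows "PU21_class A \<otimes>\<^bsub>PU21\<^esub> PU21_class B = PU21_class (A ** B)"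
  using hom_mult[OF PU21_class_hom assms] by (simp add: SU21_def)

lemma SU21_mat_1: "mat 1 \<in> carrier SU21"
  using SU21.one_closed by (auto simp: SU21_def)

lemma PU21_one: "\<one>\<^bsub>PU21\<^esub> = PU21_class (mat 1)"
proof -
  have "\<one>\<^bsub>SU21\<^esub> = mat 1" by (simp add: SU21_def)
  then show ?thesis using hom_one[OF PU21_class_hom group_SU21 group_PU21] by simp
qed

lemma PU21_act_fixes_iff:
  assumes "A \<in> carrier SU21" "z \<in> S3"
  shows "PU21_act (PU21_class A) z = z \<longleftrightarrow> (\<exists>c. c \<noteq> 0 \<and> A *v lift z = c *s lift z)"
  unfolding PU21_act_class[OF assms(1)] by (rule Theta_eq_S3_iff[OF assms(2)])

lemma complex_reflection_unique:
  assumes C: "C_circle C" and n: "Re (herm n n) > 0" "\<forall>z\<in>C. herm (lift z) n = 0"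
    and A: "A \<in> carrier SU21" and A1: "PU21_class A \<noteq> \<one>\<^bsub>PU21\<^esub>"
    and AA: "PU21_class A \<otimes>\<^bsub>PU21\<^esub> PU21_class A = \<one>\<^bsub>PU21\<^esub>"
    and fixC: "\<forall>z\<in>C. PU21_act (PU21_class A) z = z"
  shows "PU21_class A = PU21_class (reflection_matrix n)"
proof -
  have nn: "herm n n \<noteq> 0" using n(1) by auto
  obtain p q where pq: "p \<in> C" "q \<in> C" "p \<noteq> q" using C by (auto simp: C_circle_def)
  then have S: "p \<in> S3" "q \<in> S3" using C by (auto simp: C_circle_def)
  obtain t where t: "t \<noteq> 0" "t \<noteq> 1" "p + t *s (q - p) \<in> S3"
    using C_circle_third_point[OF S pq(3)] .
  define r where "r = p + t *s (q - p)"
  have r: "r \<in> C" "r \<in> S3" using t C_circle_eq[OF C pq] by (auto simp: r_def)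
  obtain a where a: "a \<noteq> 0" "A *v lift p = a *s lift p"
    using fixC pq PU21_act_fixes_iff[OF A S(1)] by blast
  obtain b where b: "A *v lift q = b *s lift q"
    using fixC pq PU21_act_fixes_iff[OF A S(2)] by blast
  obtain c where c: "A *v lift r = c *s lift r"
    using fixC r PU21_act_fixes_iff[OF A r(2)] by blast
  have "A *v lift r = a *s lift p + t *s (b *s lift q - a *s lift p)"
    unfolding r_def lift_line
    by (simp only: matrix_vector_right_distrib matrix_vector_mult_diff_distrib
        matrix_vector_scalar a(2) b)
  then have E: "c *s lift r = a *s lift p + t *s (b *s lift q - a *s lift p)" using c by simp
  have "c * (r$1) = a * p$1 + t * (b * q$1 - a * p$1)"
    "c * (r$2) = a * p$2 + t * (b * q$2 - a * p$2)" "c = a + t * (b - a)"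
    using arg_cong[OF E, of "\<lambda>v. v$1"] arg_cong[OF E, of "\<lambda>v. v$2"] arg_cong[OF E, of "\<lambda>v. v$3"]
    by (simp_all add: algebra_simps)
  then have "(t * (1 - t) * (b - a)) * (p$1 - q$1) = 0" "(t * (1 - t) * (b - a)) * (p$2 - q$2) = 0"
    by (simp_all add: r_def algebra_simps)
  moreover have "p$1 \<noteq> q$1 \<or> p$2 \<noteq> q$2" using pq(3) by (auto simp: vec_eq_iff forall_2)
  ultimately have ba: "b = a" using t by auto
  have np: "herm (lift p) n = 0" and nq: "herm (lift q) n = 0" using n pq by auto
  then have np': "herm n (lift p) = 0" and nq': "herm n (lift q) = 0"
    by (metis cnj_herm complex_cnj_zero)+
  have pres: "herm (A *v u) (A *v v) = herm u v" for u v using A by (simp add: SU21_def)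
  have Anp: "herm (A *v n) (lift p) = 0"
    using pres[of n "lift p"] a by (simp add: herm_simps np')
  have Anq: "herm (A *v n) (lift q) = 0"
    using pres[of n "lift q"] a(1) by (simp add: herm_simps nq' b ba)
  obtain x y z where xyz: "A *v n = x *s lift p + y *s lift q + z *s n"
    using lift_lift_polar_span[OF pq(3) np nq nn] .
  have "y = 0" using Anp herm_lift_S3[OF S(2,1)] pq(3) herm_S3[OF S(1)]
    by (simp add: xyz herm_simps np')
  moreover have "x = 0" using Anq herm_lift_S3[OF S] pq(3) herm_S3[OF S(2)]
    by (simp add: xyz herm_simps nq')
  ultimately have An: "A *v n = z *s n" using xyz by simp
  have AAc: "A ** A \<in> carrier SU21" using SU21.m_closed[OF A A] by (simp add: SU21_def)
  have "PU21_class (A ** A) = PU21_class (mat 1)"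
    using AA by (simp add: PU21_class_mult A PU21_one)
  then obtain d where d: "A ** A = mat d"
    using PU21_class_eq_iff[OF AAc SU21_mat_1] by auto
  have "A *v (A *v n) = d *s n" "A *v (A *v lift p) = d *s lift p"
    by (simp_all add: matrix_vector_mul_assoc d mat_mult_vec)
  then have "(z * z) *s n = d *s n" "(a * a) *s lift p = d *s lift p"
    by (simp_all add: An a matrix_vector_scalar)
  moreover have "n \<noteq> 0" using nn by (auto simp: herm_def)
  moreover have "lift p \<noteq> 0" by (auto simp: vec_eq_iff forall_3)
  ultimately have "z * z = a * a" by simp
  then have "z = a \<or> z = - a" by (simp add: square_eq_iff)
  moreover have "z \<noteq> a"
  proof
    assume za: "z = a"
    have "A *v v = mat a *v v" for v
    proof -
      obtain x y w where v: "v = x *s lift p + y *s lift q + w *s n"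
        using lift_lift_polar_span[OF pq(3) np nq nn] .
      show ?thesis
        unfolding v matrix_vector_right_distrib matrix_vector_scalar mat_mult_vec An a(2) b ba za
        by (simp add: vec_eq_iff algebra_simps)
    qed
    then have "A = mat a ** mat 1" by (simp add: matrix_eq)
    then have "PU21_class A = PU21_class (mat 1)"
      using PU21_class_eq_iff[OF A SU21_mat_1] by blast
    then show False using A1 by (simp add: PU21_one)
  qed
  ultimately have z: "z = - a" by simp
  have "A *v v = (mat (- a) ** reflection_matrix n) *v v" for v
  proof -
    obtain x y w where v: "v = x *s lift p + y *s lift q + w *s n"
      using lift_lift_polar_span[OF pq(3) np nq nn] .
    have R: "reflection_matrix n *v v = - v + (2 * w) *s n"
      using nn by (simp add: reflection_matrix_mult v herm_simps np nq)
    have "A *v v = a *s (x *s lift p + y *s lift q - w *s n)"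
      unfolding v matrix_vector_right_distrib matrix_vector_scalar An a(2) b ba z
      by (simp add: vec_eq_iff algebra_simps)
    also have "\<dots> = mat (- a) *v (reflection_matrix n *v v)"
      unfolding R mat_mult_vec unfolding v by (simp add: vec_eq_iff algebra_simps)
    finally show ?thesis by (simp add: matrix_vector_mul_assoc)
  qed
  then have "A = mat (- a) ** reflection_matrix n" by (simp add: matrix_eq)
  then show ?thesis
    using PU21_class_eq_iff[OF A reflection_matrix_SU21[OF nn]] by blast
qed

text \<open>The complex reflection fixing \<open>C\<close> is induced by
  \<open>u \<mapsto> - u + (2 \<langle>u, n\<rangle> / \<langle>n, n\<rangle>) n\<close> for any polar vector \<open>n\<close> of \<open>C\<close>.\<close>

lemma complex_reflection_properties:
  assumes C: "C_circle C" and n: "Re (herm n n) > 0" "\<forall>z\<in>C. herm (lift z) n = 0"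
  shows "complex_reflection C = PU21_class (reflection_matrix n)"
    and "complex_reflection C \<in> carrier PU21" "complex_reflection C \<noteq> \<one>\<^bsub>PU21\<^esub>"
    and "complex_reflection C \<otimes>\<^bsub>PU21\<^esub> complex_reflection C = \<one>\<^bsub>PU21\<^esub>"
    and "\<forall>z\<in>C. PU21_act (complex_reflection C) z = z"
proof -
  let ?R = "reflection_matrix n" and ?g = "PU21_class (reflection_matrix n)"
  have nn: "herm n n \<noteq> 0" using n(1) by auto
  have R: "?R \<in> carrier SU21" by (rule reflection_matrix_SU21[OF nn])
  have Rp: "?R *v lift z = (- 1) *s lift z" if "z \<in> C" for z
    using n(2) that by (simp add: reflection_matrix_mult vec_eq_iff)
  have Rn: "?R *v n = n"
    using nn by (simp add: reflection_matrix_mult vec_eq_iff)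
  have g: "?g \<in> carrier PU21" using R by (auto simp: carrier_PU21)
  have "?R *v (?R *v u) = u" for u
    using nn by (simp add: reflection_matrix_mult herm_simps vec_eq_iff field_simps)
  then have "?R ** ?R = mat 1" by (simp add: matrix_eq flip: matrix_vector_mul_assoc)
  then have gg: "?g \<otimes>\<^bsub>PU21\<^esub> ?g = \<one>\<^bsub>PU21\<^esub>" by (simp add: PU21_class_mult R PU21_one)
  have "\<exists>c. c \<noteq> 0 \<and> ?R *v lift z = c *s lift z" if "z \<in> C" for z
    using Rp[OF that] by (intro exI[of _ "- 1"]) simp
  then have fixC: "\<forall>z\<in>C. PU21_act ?g z = z"
    using PU21_act_fixes_iff[OF R] C by (auto simp: C_circle_def)
  have g1: "?g \<noteq> \<one>\<^bsub>PU21\<^esub>"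
  proof
    assume "?g = \<one>\<^bsub>PU21\<^esub>"
    then obtain c where c: "?R = mat c"
      using PU21_class_eq_iff[OF R SU21_mat_1] by (auto simp: PU21_one)
    obtain p where p: "p \<in> C" using C by (auto simp: C_circle_def)
    have "c *s n = n" using Rn by (simp add: c mat_mult_vec)
    moreover have "n \<noteq> 0" using nn by (auto simp: herm_def)
    ultimately have "c = 1" by (metis vec.scale_cancel_right vector_smult_lid)
    moreover have "c *s lift p = (- 1) *s lift p" using Rp[OF p] by (simp only: c mat_mult_vec)
    then have "c = - 1" by (simp add: vec_eq_iff forall_3)
    ultimately show False by simp
  qed
  show *: "complex_reflection C = ?g"
    unfolding complex_reflection_def
  proof (rule the_equality)
    show "?g \<in> carrier PU21 \<and> ?g \<noteq> \<one>\<^bsub>PU21\<^esub> \<and> ?g \<otimes>\<^bsub>PU21\<^esub> ?g = \<one>\<^bsub>PU21\<^esub> \<and> (\<forall>z\<in>C. PU21_act ?g z = z)"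
      using g gg g1 fixC by blast
  next
    fix h assume h: "h \<in> carrier PU21 \<and> h \<noteq> \<one>\<^bsub>PU21\<^esub> \<and> h \<otimes>\<^bsub>PU21\<^esub> h = \<one>\<^bsub>PU21\<^esub> \<and> (\<forall>z\<in>C. PU21_act h z = z)"
    then obtain A where "A \<in> carrier SU21" "h = PU21_class A" by (auto simp: carrier_PU21)
    then show "h = ?g" using complex_reflection_unique[OF C n] h by blast
  qed
  show "complex_reflection C \<in> carrier PU21" "complex_reflection C \<noteq> \<one>\<^bsub>PU21\<^esub>"
    "complex_reflection C \<otimes>\<^bsub>PU21\<^esub> complex_reflection C = \<one>\<^bsub>PU21\<^esub>"
    "\<forall>z\<in>C. PU21_act (complex_reflection C) z = z"
    unfolding * using g gg g1 fixC by blast+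
qed


subsection \<open>The representations\<close>

lemma norm_beta: "(cmod (beta s))\<^sup>2 = 1 / 2"
proof -
  have "cmod (of_real s + \<i>) = sqrt (s\<^sup>2 + 1)" by (simp add: cmod_def)
  moreover have "1 + s\<^sup>2 > 0" by (simp add: add_pos_nonneg)
  ultimately show ?thesis
    unfolding beta_def norm_divide by (simp add: power_divide field_simps)
qed

lemma Im_beta: "Im (beta s) \<noteq> 0"
proof -
  have "1 + s\<^sup>2 > 0" by (simp add: add_pos_nonneg)
  then show ?thesis unfolding beta_def by (simp add: Im_divide_of_real) 
qed

lemma ideal_vertex_S3: "ideal_vertex s k \<in> S3"
  by (simp add: ideal_vertex_def norm_vec_def L2_set_def sum_2 norm_beta)

lemma ideal_vertex_distinct: "ideal_vertex s k \<noteq> ideal_vertex s (k + 1)"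
proof -
  have "beta s \<noteq> cnj (beta s)" using Im_beta[of s] by (auto simp: complex_eq_iff)
  then show ?thesis
    using exhaust_3[of k] by (auto simp: ideal_vertex_def vec_eq_iff forall_2)
qed

lemma triangle_reflection:
  "triangle_reflection s k \<in> carrier PU21"
  "triangle_reflection s k \<otimes>\<^bsub>PU21\<^esub> triangle_reflection s k = \<one>\<^bsub>PU21\<^esub>"
proof -
  let ?C = "C_circle_through (ideal_vertex s k) (ideal_vertex s (k + 1))"
  have C: "C_circle ?C"
    by (intro C_circle_through ideal_vertex_S3 ideal_vertex_distinct)
  obtain n where "Re (herm n n) > 0" "\<forall>z\<in>?C. herm (lift z) n = 0"
    using polar_vector[OF C] .
  then show "triangle_reflection s k \<in> carrier PU21"
    "triangle_reflection s k \<otimes>\<^bsub>PU21\<^esub> triangle_reflection s k = \<one>\<^bsub>PU21\<^esub>"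
    unfolding triangle_reflection_def using complex_reflection_properties[OF C] by blast+
qed

lemma rho_closed: "rho s w \<in> carrier PU21"
  unfolding rho_def by (induction w) (auto intro: triangle_reflection)

lemma rho_gen: "rho s (Gamma_Z2_gen k) = triangle_reflection s k"
  by (simp add: rho_def Gamma_Z2_gen_def triangle_reflection)

lemma rho_hom: "rho s \<in> hom Gamma_Z2 PU21"
proof (rule homI)
  fix v w assume "v \<in> carrier Gamma_Z2" "w \<in> carrier Gamma_Z2"
  let ?f = "\<lambda>k g. triangle_reflection s k \<otimes>\<^bsub>PU21\<^esub> g"
  have "?f x (?f x a) = a" if "a \<in> carrier PU21" for x a
    using that by (simp add: triangle_reflection flip: PU21.m_assoc)
  then have "rho s (foldr reduced_Cons v w) = foldr ?f v (rho s w)"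
    unfolding rho_def
    by (intro foldr_reduced_Cons_action[of "carrier PU21"]) (auto intro: triangle_reflection)
  also have "\<dots> = rho s v \<otimes>\<^bsub>PU21\<^esub> rho s w"
  proof (induction v)
    case Nil
    then show ?case using rho_closed[of s w] by (simp add: rho_def[of s "[]"])
  next
    case (Cons k v)
    then show ?case
      using PU21.m_assoc[OF triangle_reflection(1) rho_closed rho_closed]
      by (simp add: rho_def[of s "k # v"] flip: rho_def[of s v])
  qed
  finally show "rho s (v \<otimes>\<^bsub>Gamma_Z2\<^esub> w) = rho s v \<otimes>\<^bsub>PU21\<^esub> rho s w"
    by (simp add: Gamma_Z2_def)
qed (rule rho_closed)

end

theory Submission
  imports Defs "HOL-Computational_Algebra.Polynomial_Factorial"
    "HOL-Computational_Algebra.Fundamental_Theorem_Algebra"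
begin

text \<open>
  Let \<open>W\<^sub>1, W\<^sub>2, W\<^sub>3\<close> be lifts of the ideal vertices, scaled so that
  \<open>\<langle>W\<^sub>k, W\<^sub>k\<^sub>+\<^sub>1\<rangle> = - \<xi>\<close> with \<open>|\<xi>| = 1\<close>. In the coordinates \<open>a\<^sub>k = \<langle>v, W\<^sub>k\<rangle>\<close> the reflection in the side
  through \<open>W\<^sub>k\<close> and \<open>W\<^sub>k\<^sub>+\<^sub>1\<close> changes only \<open>a\<^sub>k\<^sub>+\<^sub>2\<close>: up to an overall sign it reflects that coordinate in
  the point \<open>\<xi>\<^sup>2 a\<^sub>k + \<xi>\<^sup>-\<^sup>2 a\<^sub>k\<^sub>+\<^sub>1\<close>.

  If \<open>g\<^sub>s\<close> is not elliptic then \<open>s\<^sup>2 \<le> 125/3\<close>, since otherwise \<open>g\<^sub>s\<close> has an explicit negative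
  eigenvector \<open>(1, \<lambda>, \<lambda>\<^sup>2)\<close>. For \<open>s\<^sup>2 \<le> 125/3\<close> ping-pong is played on \<open>S\<^sup>3\<close> with the sets \<open>{F\<^sub>k > 0}\<close>, where
  \<open>F\<^sub>k = Re ((a\<^sub>k\<^sub>+\<^sub>2 - \<xi>\<^sup>2 a\<^sub>k - \<xi>\<^sup>-\<^sup>2 a\<^sub>k\<^sub>+\<^sub>1) cnj Q(a\<^sub>k, a\<^sub>k\<^sub>+\<^sub>1))\<close> for a suitable cubic form \<open>Q\<close>. The \<open>k\<close>-th
  reflection changes the sign of \<open>F\<^sub>k\<close>, and \<open>F\<^sub>j + F\<^sub>k \<le> 0\<close> on null vectors for \<open>j \<noteq> k\<close>, by a sum of
  squares certificate. A null vector with all \<open>F\<^sub>k < 0\<close> then gives both faithfulness and discreteness.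

  If \<open>g\<^sub>s\<close> is elliptic, its powers accumulate at the identity, so in a discrete group it would have
  finite order and its eigenvalues would be roots of unity. The eigenvalues are, up to sign, cubes of
  the roots \<open>l\<^sub>1, l\<^sub>2, l\<^sub>3\<close> of \<open>x\<^sup>3 - 2 \<xi>\<^sup>-\<^sup>2 x\<^sup>2 - 2 \<xi>\<^sup>2 x + 1\<close>, or their inverses. The sum \<open>e\<close> of the roots
  has modulus 2, as have all its conjugates, and \<open>16 + 2 Re (e\<^sup>3)\<close> and its conjugates lie in \<open>[0, 1)\<close>.
  An algebraic integer with this property is zero, but \<open>\<xi>\<^sup>6 \<noteq> - 1\<close>.
\<close>

section \<open>Sum of squares certificate\<close>

text \<open>The squares fall into two triangular families, in the monomials that are even and odd
  under \<open>(x, t) -> (- x, - t)\<close>, as completing squares in a Gram matrix produces them.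
  The next three certificates have the same shape.\<close>

lemma bernstein_coeff0_nonneg:
  fixes x y t :: real
  shows "0 \<le> 14*x^6 + 510*x^4*y^2 + 790*x^4 + 240*x^3*y*t + 5850*x^2*y^4 + 17940*x^2*y^2
    + 90*x^2*t^2 + 3210*x^2 + 3600*x*y^3*t + 5760*x*y*t + 20250*y^6 + 91350*y^4 + 3150*y^2*t^2
    + 22350*y^2 + 510*t^2 + 850"
proof -
  have "14*x^6 + 510*x^4*y^2 + 790*x^4 + 240*x^3*y*t + 5850*x^2*y^4 + 17940*x^2*y^2 + 90*x^2*t^2
    + 3210*x^2 + 3600*x*y^3*t + 5760*x*y*t + 20250*y^6 + 91350*y^4 + 3150*y^2*t^2 + 22350*y^2
    + 510*t^2 + 850 =
    850 * ( - 19/170*x^2 - 123/34*y^2 + 1)\<^sup>2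
    + 28500 * ( - 1/75*x^2*y + 1/75*x*t - 13/76*y^3 + y)\<^sup>2
    + 3059175/34 * ( - 11659/203945*x^2 + y^2)\<^sup>2
    + 1475625/76 * ( - 46208/295125*x^2*y - 684/98375*x*t + y^3)\<^sup>2
    + 24282992/40789 * (x^2)\<^sup>2
    + 10210492/19675 * (x^2*y + 1533611/7657869*x*t)\<^sup>2
    + 1451498090/22973607 * (x*t)\<^sup>2
    + 3400 * ( - 11/680*x^3 + 5/34*x*y^2 + x + 4/17*y*t)\<^sup>2
    + 27300 * (x*y + 17/273*t)\<^sup>2
    + 199350/17 * ( - 179/8860*x^3 + x*y^2 + 640/3987*y*t)\<^sup>2
    + 7375/886 * (x^3 + 9032/1475*y*t)\<^sup>2
    + 110330/273 * (t)\<^sup>2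
    + 6232594/2655 * (y*t)\<^sup>2"
    by algebra
  then show ?thesis by simp
qed

lemma bernstein_coeff1_nonneg:
  fixes x y t :: real
  shows "0 \<le> 42*x^6 + 1530*x^4*y^2 + 300*x^4*y + 2370*x^4 + 720*x^3*y*t - 440*x^3*t
    + 17550*x^2*y^4 + 9000*x^2*y^3 + 53820*x^2*y^2 + 6360*x^2*y + 270*x^2*t^2 + 9630*x^2
    + 10800*x*y^3*t - 6600*x*y^2*t + 17280*x*y*t - 7080*x*t + 60750*y^6 + 67500*y^5 + 274050*y^4
    + 95400*y^3 + 9450*y^2*t^2 + 67050*y^2 - 2100*y*t^2 - 8100*y + 1530*t^2 + 2550"
proof -
  have "42*x^6 + 1530*x^4*y^2 + 300*x^4*y + 2370*x^4 + 720*x^3*y*t - 440*x^3*t + 17550*x^2*y^4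
    + 9000*x^2*y^3 + 53820*x^2*y^2 + 6360*x^2*y + 270*x^2*t^2 + 9630*x^2 + 10800*x*y^3*t
    - 6600*x*y^2*t + 17280*x*y*t - 7080*x*t + 60750*y^6 + 67500*y^5 + 274050*y^4 + 95400*y^3
    + 9450*y^2*t^2 + 67050*y^2 - 2100*y*t^2 - 8100*y + 1530*t^2 + 2550 =
    2550 * ( - 4/85*x^2*y - 49/170*x^2 - 8/85*x*t - 115/34*y^2 - 27/17*y + 1)\<^sup>2
    + 1323750/17 * ( - 414/44125*x^2*y + 1737/88250*x^2 + 24/1765*x*t - 2159/17650*y^3
      + 7707/17650*y^2 + y)\<^sup>2
    + 87925317/353 * ( - 757106/146542195*x^2*y - 7857351/146542195*x^2 + 132480/29308439*x*t
      + 8921289/58616878*y^3 + y^2)\<^sup>2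
    + 6308961427275/117233756 * ( - 67749474576/420597428485*x^2*y - 3750662736/420597428485*x^2
      - 534333584/84119485697*x*t + y^3)\<^sup>2
    + 146167139975736/84119485697 * ( - 231455235723/24361189995956*x^2*y + x^2
      - 483107455789/3321980453994*x*t)\<^sup>2
    + 19298648076404685/12180594997978 * (x^2*y + 249290643305946/1286576538426979*x*t)\<^sup>2
    + 499914449721288910/3859729615280937 * (x*t)\<^sup>2
    + 11100 * ( - 11/740*x^3 + 5/37*x*y^2 + 2/37*x*y + x + 12/37*y*t - 11/37*t)\<^sup>2
    + 2673900/37 * (11/89130*x^3 + 342/2971*x*y^2 + x*y - 727/8913*y*t + 466/8913*t)\<^sup>2
    + 100834800/2971 * ( - 70683/3361160*x^3 + x*y^2 + 58351/336116*y*t + 109/336116*t)\<^sup>2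
    + 2061814/84029 * (x^3 + 29939045/4123628*y*t - 8283395/4123628*t)\<^sup>2
    + 2081276955/8247256 * (125432175/46250599*y*t + t)\<^sup>2
    + 167853916500/46250599 * (y*t)\<^sup>2"
    by algebra
  then show ?thesis by simp
qed

lemma bernstein_coeff2_nonneg:
  fixes x y t :: real
  shows "0 \<le> 42*x^6 + 1530*x^4*y^2 + 600*x^4*y + 2370*x^4 + 720*x^3*y*t - 880*x^3*t
    + 17550*x^2*y^4 + 18000*x^2*y^3 + 53820*x^2*y^2 + 12720*x^2*y + 270*x^2*t^2 + 21030*x^2
    + 10800*x*y^3*t - 13200*x*y^2*t + 17280*x*y*t - 14160*x*t + 60750*y^6 + 135000*y^5
    + 274050*y^4 + 190800*y^3 + 9450*y^2*t^2 + 154050*y^2 - 4200*y*t^2 - 16200*y + 1530*t^2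
    + 25550"
proof -
  have "42*x^6 + 1530*x^4*y^2 + 600*x^4*y + 2370*x^4 + 720*x^3*y*t - 880*x^3*t + 17550*x^2*y^4
    + 18000*x^2*y^3 + 53820*x^2*y^2 + 12720*x^2*y + 270*x^2*t^2 + 21030*x^2 + 10800*x*y^3*t
    - 13200*x*y^2*t + 17280*x*y*t - 14160*x*t + 60750*y^6 + 135000*y^5 + 274050*y^4 + 190800*y^3
    + 9450*y^2*t^2 + 154050*y^2 - 4200*y*t^2 - 16200*y + 1530*t^2 + 25550 =
    25550 * ( - 36/365*x^2*y - 117/1022*x^2 - 18/365*x*t - 66/2555*y^3 - 747/730*y^2 - 162/511*y
      + 1)\<^sup>2
    + 104127540/511 * ( - 78505/3470918*x^2*y + 59833/3470918*x^2 - 77/157769*x*t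
      - 559519/6941836*y^3 + 1495039/3470918*y^2 + y)\<^sup>2
    + 839684886681/3470918 * ( - 1797331278/279894962227*x^2*y - 13474280205/279894962227*x^2
      + 2237000656/279894962227*x*t + 85499228711/279894962227*y^3 + y^2)\<^sup>2
    + 41240015858368005/1119579848908 * ( - 396856645152434/2749334390557867*x^2*y
      - 5276869407732/392762055793981*x^2 - 11284362630076/2749334390557867*x*t + y^3)\<^sup>2
    + 776603748597947460/392762055793981 * (272174906385385/4314465269988597*x^2*y + x^2
      - 9651813949557865/38830187429897373*x*t)\<^sup>2
    + 4234444544016615700/3355695209991131 * (x^2*y
      + 203970432228457546/1905500044807477065*x*t)\<^sup>2
    + 63014787245655906742/1143300026884486239 * (x*t)\<^sup>2
    + 26880 * ( - 19/1792*x^3 + 19/112*x*y^2 + 37/224*x*y + x + 123/448*y*t - 97/448*t)\<^sup>2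
    + 1844265/28 * ( - 1985/983608*x^3 + 25138/122951*x*y^2 + x*y - 38375/245902*y*t
      + 7173/245902*t)\<^sup>2
    + 3040955820/122951 * ( - 5893037/405460776*x^3 + x*y^2 + 7882029/33788398*y*t
      - 514373/101365194*t)\<^sup>2
    + 9051321803/270307184 * (x^3 + 70647696900/9051321803*y*t
      - 16124988580/9051321803*t)\<^sup>2
    + 967666702470/9051321803 * (88291431784/32255556749*y*t + t)\<^sup>2
    + 52665327783150/32255556749 * (y*t)\<^sup>2"
    by algebra
  then show ?thesis by simp
qed

lemma bernstein_coeff3_nonneg:
  fixes x y t :: real
  shows "0 \<le> 14*x^6 + 510*x^4*y^2 - 240*x^4*y + 240*x^3*y*t - 320*x^3*t + 5850*x^2*y^4
    - 7200*x^2*y^3 + 3840*x^2*y^2 + 90*x^2*t^2 + 3600*x*y^3*t - 4800*x*y^2*t - 3840*x*y*t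
    + 20250*y^6 - 54000*y^5 + 57600*y^4 + 3150*y^2*t^2 - 8400*y*t^2 + 5760*t^2"
proof -
  have "14*x^6 + 510*x^4*y^2 - 240*x^4*y + 240*x^3*y*t - 320*x^3*t + 5850*x^2*y^4 - 7200*x^2*y^3
    + 3840*x^2*y^2 + 90*x^2*t^2 + 3600*x*y^3*t - 4800*x*y^2*t - 3840*x*y*t + 20250*y^6
    - 54000*y^5 + 57600*y^4 + 3150*y^2*t^2 - 8400*y*t^2 + 5760*t^2 =
    57600 * ( - 139/3840*x^2*y - 287/11520*x*t - 15/32*y^3 + y^2)\<^sup>2
    + 30375/4 * (689/48600*x^2*y - 2449/48600*x*t + y^3)\<^sup>2
    + 3032683/38880 * (x^2*y - 2003063/3032683*x*t)\<^sup>2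
    + 51268939/54588294 * (x*t)\<^sup>2
    + 5760 * ( - 1/36*x^3 - 19/48*x*y^2 - 1/3*x*y - 35/48*y*t + t)\<^sup>2
    + 3200 * ( - 13/240*x^3 - 91/128*x*y^2 + x*y - 17/640*y*t)\<^sup>2
    + 10911/128 * (1432/32733*x^3 - 9085/3637*x*y^2 + y*t)\<^sup>2
    + 2284880/3637 * (1103/2741856*x^3 + x*y^2)\<^sup>2
    + 168877/49353408 * (x^3)\<^sup>2"
    by algebra
  then show ?thesis by simp
qed

text \<open>This is \<open>- 5 * h\<close> times the sum of two heights on null vectors, where
  \<open>x\<close> and \<open>y\<close> are the real and imaginary parts of \<open>z\<close> and
  \<open>t\<close> is a shifted \<open>Im B\<close>; see \<open>affine_height_sum\<close>.\<close>

definition gap :: "real \<Rightarrow> real \<Rightarrow> real \<Rightarrow> real \<Rightarrow> real" where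
  "gap x y t s = 70*x^6 + 170*x^4*y^2 + 60*x^4*y * s + 3950*x^4 + 80*x^3*y*t - 88*x^3*t * s
    + 130*x^2*y^4 + 120*x^2*y^3 * s + 5980*x^2*y^2 + 1272*x^2*y * s + 30*x^2*t^2 + 1368*x^2 * s^2
    + 16050*x^2 + 80*x*y^3*t - 88*x*y^2*t * s + 1920*x*y*t - 1416*x*t * s + 30*y^6 + 60*y^5 * s
    + 2030*y^4 + 1272*y^3 * s + 70*y^2*t^2 + 696*y^2 * s^2 + 7450*y^2 - 28*y*t^2 * s + 432*y * s^3
    - 1620*y * s + 170*t^2 + 2760 * s^2 + 4250"

text \<open>After rescaling by \<open>\<surd>15\<close> the polynomial \<open>gap\<close> is a cubic in \<open>S \<in> [0, 5/3]\<close>, and each of its Bernstein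
  coefficients is a sum of squares. At the end point \<open>S = 5/3\<close> the polynomial vanishes at
  \<open>x = 0, Y = - 1, T = 0\<close>, so the last coefficient is expanded about this point.\<close>

lemma gap_nonneg_aux:
  assumes "0 \<le> s" "s\<^sup>2 \<le> 125/3"
  shows "0 \<le> gap x y t s"
proof -
  define r :: real where "r = sqrt 15"
  have r: "r * r = 15" "0 < r" by (simp_all add: r_def)
  define Y T S where "Y = y / r" and "T = t / r" and "S = s / r"
  have y: "y = r * Y" and t: "t = r * T" and s: "s = r * S"
    using r(2) by (simp_all add: Y_def T_def S_def)
  have "s\<^sup>2 = 15 * S\<^sup>2" using r(1) by (simp add: s power2_eq_square)
  then have "S\<^sup>2 \<le> (5/3)\<^sup>2" using assms(2) by (simp add: power2_eq_square)
  then have S1: "S \<le> 5/3" by (rule power2_le_imp_le) simp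
  have S0: "0 \<le> S" using assms(1) r(2) by (simp add: S_def)
  \<comment> \<open>Every monomial has even total degree in \<open>y\<close>, \<open>t\<close>,
    \<open>s\<close>, so \<open>r\<close> enters only through \<open>r * r\<close> and the rescaled
    coefficients are rational.\<close>
  have "gap x y t s = 70*x^6 + 170*x^4*Y^2*(r*r) + 60*x^4*Y*S*(r*r) + 3950*x^4
    + 80*x^3*Y*T*(r*r) - 88*x^3*T*S*(r*r) + 130*x^2*Y^4*(r*r)^2 + 120*x^2*Y^3*S*(r*r)^2
    + 5980*x^2*Y^2*(r*r) + 1272*x^2*Y*S*(r*r) + 30*x^2*T^2*(r*r) + 1368*x^2*S^2*(r*r)
    + 16050*x^2 + 80*x*Y^3*T*(r*r)^2 - 88*x*Y^2*T*S*(r*r)^2 + 1920*x*Y*T*(r*r)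
    - 1416*x*T*S*(r*r) + 30*Y^6*(r*r)^3 + 60*Y^5*S*(r*r)^3 + 2030*Y^4*(r*r)^2
    + 1272*Y^3*S*(r*r)^2 + 70*Y^2*T^2*(r*r)^2 + 696*Y^2*S^2*(r*r)^2 + 7450*Y^2*(r*r)
    - 28*Y*T^2*S*(r*r)^2 + 432*Y*S^3*(r*r)^2 - 1620*Y*S*(r*r) + 170*T^2*(r*r) + 2760*S^2*(r*r)
    + 4250"
    unfolding y t s gap_def by algebra
  then have "75 * gap x y t s =
     3 * (5 - 3*S)^3 * (14*x^6 + 510*x^4*Y^2 + 790*x^4 + 240*x^3*Y*T + 5850*x^2*Y^4
       + 17940*x^2*Y^2 + 90*x^2*T^2 + 3210*x^2 + 3600*x*Y^3*T + 5760*x*Y*T + 20250*Y^6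
       + 91350*Y^4 + 3150*Y^2*T^2 + 22350*Y^2 + 510*T^2 + 850)
     + 9 * S * (5 - 3*S)\<^sup>2 * (42*x^6 + 1530*x^4*Y^2 + 300*x^4*Y + 2370*x^4 + 720*x^3*Y*T
       - 440*x^3*T + 17550*x^2*Y^4 + 9000*x^2*Y^3 + 53820*x^2*Y^2 + 6360*x^2*Y + 270*x^2*T^2
       + 9630*x^2 + 10800*x*Y^3*T - 6600*x*Y^2*T + 17280*x*Y*T - 7080*x*T + 60750*Y^6
       + 67500*Y^5 + 274050*Y^4 + 95400*Y^3 + 9450*Y^2*T^2 + 67050*Y^2 - 2100*Y*T^2 - 8100*Y
       + 1530*T^2 + 2550)
     + 27 * S\<^sup>2 * (5 - 3*S) * (42*x^6 + 1530*x^4*Y^2 + 600*x^4*Y + 2370*x^4 + 720*x^3*Y*T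
       - 880*x^3*T + 17550*x^2*Y^4 + 18000*x^2*Y^3 + 53820*x^2*Y^2 + 12720*x^2*Y + 270*x^2*T^2
       + 21030*x^2 + 10800*x*Y^3*T - 13200*x*Y^2*T + 17280*x*Y*T - 14160*x*T + 60750*Y^6
       + 135000*Y^5 + 274050*Y^4 + 190800*Y^3 + 9450*Y^2*T^2 + 154050*Y^2 - 4200*Y*T^2 - 16200*Y
       + 1530*T^2 + 25550)
     + 81 * S^3 * (14*x^6 + 510*x^4*(Y + 1)^2 - 240*x^4*(Y + 1) + 240*x^3*(Y + 1)*(T - 2*x)
       - 320*x^3*(T - 2*x) + 5850*x^2*(Y + 1)^4 - 7200*x^2*(Y + 1)^3 + 3840*x^2*(Y + 1)^2
       + 90*x^2*(T - 2*x)^2 + 3600*x*(Y + 1)^3*(T - 2*x) - 4800*x*(Y + 1)^2*(T - 2*x)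
       - 3840*x*(Y + 1)*(T - 2*x) + 20250*(Y + 1)^6 - 54000*(Y + 1)^5 + 57600*(Y + 1)^4
       + 3150*(Y + 1)^2*(T - 2*x)^2 - 8400*(Y + 1)*(T - 2*x)^2 + 5760*(T - 2*x)^2)"
    unfolding r(1) by algebra
  also have "\<dots> \<ge> 0"
  proof -
    have c: "0 \<le> 3 * (5 - 3*S)^3" "0 \<le> 9 * S * (5 - 3*S)\<^sup>2"
      "0 \<le> 27 * S\<^sup>2 * (5 - 3*S)" "0 \<le> 81 * S^3"
      using S0 S1 by simp_all
    note b = bernstein_coeff0_nonneg[of x Y T] bernstein_coeff1_nonneg[of x Y T]
      bernstein_coeff2_nonneg[of x Y T] bernstein_coeff3_nonneg[of x "Y + 1" "T - 2*x"]
    show ?thesis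
      by (rule add_nonneg_nonneg[OF add_nonneg_nonneg[OF add_nonneg_nonneg]];
          rule mult_nonneg_nonneg[OF c(1) b(1)] mult_nonneg_nonneg[OF c(2) b(2)]
            mult_nonneg_nonneg[OF c(3) b(3)] mult_nonneg_nonneg[OF c(4) b(4)])
  qed
  finally show ?thesis by simp
qed

lemma gap_nonneg:
  assumes "s\<^sup>2 \<le> 125/3"
  shows "0 \<le> gap x y t s"
proof (cases "0 \<le> s")
  case True
  then show ?thesis using gap_nonneg_aux assms by blast
next
  case False
  have "gap x y t s = gap x (- y) (- t) (- s)" by (simp add: gap_def)
  then show ?thesis using gap_nonneg_aux[of "- s"] False assms by simp
qed

section \<open>Coordinates and ping-pong\<close>

text \<open>The coefficients of \<open>Q\<close> are chosen so that the sum of two heights stays nonpositive up to the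
  critical value \<open>s\<^sup>2 = 125/3\<close>, where it has an additional double zero.\<close>

definition side_coeff1 :: "real \<Rightarrow> complex" where "side_coeff1 s = Complex 28 (- 12/5 * s)"
definition side_coeff2 :: "real \<Rightarrow> complex" where "side_coeff2 s = Complex 44 (- 28/5 * s)"
definition side_mu :: "real \<Rightarrow> complex" where "side_mu s = Complex 4 (- 4 * s)"

text \<open>Homogeneous of degree two in the variables and of degree one in their conjugates. This
  makes \<open>height\<close> scale by \<open>(cmod e) ^ 4\<close>, so that its sign is well defined
  on projective points.\<close>

definition side_form :: "complex \<Rightarrow> complex \<Rightarrow> complex \<Rightarrow> complex \<Rightarrow> complex \<Rightarrow> complex" where
  "side_form D E \<mu> B b = B\<^sup>2 * cnj B + D * B\<^sup>2 * cnj b + \<mu> * cnj D * b\<^sup>2 * cnj B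
     + E * B * cnj B * b + \<mu> * cnj E * B * b * cnj b + \<mu>\<^sup>2 * cnj \<mu> * b\<^sup>2 * cnj b"

abbreviation side :: "real \<Rightarrow> complex \<Rightarrow> complex \<Rightarrow> complex" where
  "side s \<equiv> side_form (side_coeff1 s) (side_coeff2 s) (side_mu s)"

text \<open>The two terms are the heights of two sides, multiplied by \<open>h\<close>; the
  arguments of \<open>side\<close> are the values of \<open>B\<close> and \<open>cnj A\<close> that
  the light cone forces in \<open>affine_height_sum\<close>.\<close>

lemma side_gap:
  "Re ((Complex x y - 1) * cnj (side s (Complex ((x - 1)\<^sup>2 + y\<^sup>2) (t - 2*y + 2 * s)) 1))
   - Re ((Complex x y + 1) * side s (Complex ((x + 1)\<^sup>2 + y\<^sup>2) (- (t + 2*y - 2 * s))) 1)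
   = - (gap x y t s / 5)"
  unfolding side_form_def side_coeff1_def side_coeff2_def side_mu_def gap_def
  by (simp add: power2_eq_square) algebra

text \<open>The vertices with parameter \<open>- s\<close> have lifts whose consecutive products are \<open>- xi\<close>
  (\<open>herm_vertex\<close>); therefore the representation attached to this locale is \<open>rho (- s)\<close>.\<close>

locale ideal_triangle =
  fixes s :: real and xi :: complex
  assumes xi_cube: "of_real (sqrt (1 + s\<^sup>2)) * xi ^ 3 = Complex 1 s"
begin

definition h :: real where "h = sqrt (1 + s\<^sup>2)"

lemma h_pos: "0 < h" and h_sq: "h\<^sup>2 = 1 + s\<^sup>2"
proof -
  have "0 < 1 + s\<^sup>2" by (simp add: add_pos_nonneg)
  then show "0 < h" "h\<^sup>2 = 1 + s\<^sup>2" by (simp_all add: h_def)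
qed

lemma h_xi: "of_real h * xi ^ 3 = Complex 1 s"
  using xi_cube by (simp add: h_def)

lemma norm_xi: "cmod xi = 1"
proof -
  have "h * cmod xi ^ 3 = cmod (Complex 1 s)"
    using arg_cong[OF h_xi, of cmod] h_pos by (simp add: norm_mult norm_power)
  also have "\<dots> = h" by (simp add: cmod_def h_def)
  finally have "cmod xi ^ 3 = 1 ^ 3" using h_pos by simp
  then show ?thesis using power_eq_imp_eq_base[of "cmod xi" 3 1] by simp
qed

lemma xi_cnj: "xi * cnj xi = 1"
  using norm_xi by (simp add: complex_mult_cnj cmod_def)

lemma h_cnj_xi: "of_real h * cnj xi ^ 3 = Complex 1 (- s)"
proof -
  have "of_real h * cnj xi ^ 3 = cnj (of_real h * xi ^ 3)" by simp
  also have "\<dots> = Complex 1 (- s)" unfolding h_xi by (simp add: complex_eq_iff)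
  finally show ?thesis .
qed

lemma side_mu_xi: "side_mu s = 4 * of_real h * cnj xi ^ 3"
proof -
  have "side_mu s = 4 * Complex 1 (- s)" by (simp add: side_mu_def complex_eq_iff)
  then show ?thesis using h_cnj_xi by simp
qed

definition centre :: "complex \<Rightarrow> complex \<Rightarrow> complex" where
  "centre a b = xi\<^sup>2 * a + cnj xi ^ 2 * b"

text \<open>The Hermitian form in the coordinates \<open>herm v (vertex k)\<close>, up to the factor
  \<open>h / 2\<close>; see \<open>herm_from_coords\<close>.\<close>

definition norm_form :: "complex \<Rightarrow> complex \<Rightarrow> complex \<Rightarrow> real" where
  "norm_form a b c = Re (a * cnj a + b * cnj b + c * cnj c
     - 2 * (a * cnj (xi\<^sup>2 * b) + b * cnj (xi\<^sup>2 * c) + c * cnj (xi\<^sup>2 * a)))"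

definition height :: "complex \<Rightarrow> complex \<Rightarrow> complex \<Rightarrow> real" where
  "height a b c = Re ((a - centre b c) * cnj (xi * side s (4 * of_real h * xi * b) c))"

lemma of_real_norm_form:
  "complex_of_real (norm_form a b c) = a * cnj a + b * cnj b + c * cnj c
     - (a * cnj (xi\<^sup>2 * b) + b * cnj (xi\<^sup>2 * c) + c * cnj (xi\<^sup>2 * a))
     - (cnj a * (xi\<^sup>2 * b) + cnj b * (xi\<^sup>2 * c) + cnj c * (xi\<^sup>2 * a))"
proof -
  have "complex_of_real (Re z) = (z + cnj z) / 2" for z
    unfolding complex_add_cnj by simp
  then show ?thesis unfolding norm_form_def by (simp only:) (simp add: field_simps)
qed

lemma height_scale: "height (e * a) (e * b) (e * c) = (cmod e) ^ 4 * height a b c"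
proof -
  have "(e * a - centre (e * b) (e * c)) * cnj (xi * side s (4 * of_real h * xi * (e * b)) (e * c))
      = (e * cnj e)\<^sup>2 * ((a - centre b c) * cnj (xi * side s (4 * of_real h * xi * b) c))"
    unfolding centre_def side_form_def by simp algebra
  also have "(e * cnj e)\<^sup>2 = of_real ((cmod e) ^ 4)"
    by (simp add: complex_norm_square[symmetric] flip: power_mult)
  finally show ?thesis unfolding height_def by (simp only: Re_complex_of_real times_complex.sel Im_complex_of_real mult_zero_left diff_zero)
qed

lemma norm_form_scale: "norm_form (e * a) (e * b) (e * c) = (cmod e)\<^sup>2 * norm_form a b c"
proof -
  have "complex_of_real (norm_form (e * a) (e * b) (e * c)) = of_real ((cmod e)\<^sup>2 * norm_form a b c)"
    unfolding of_real_mult of_real_norm_form complex_norm_square by (simp add: algebra_simps)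
  then show ?thesis by (simp only: of_real_eq_iff)
qed

text \<open>The coefficients of \<open>side_form\<close> come in pairs \<open>D\<close>, \<open>\<mu> * cnj D\<close> exactly for this symmetry.\<close>

lemma side_swap:
  "xi * side s (4 * of_real h * xi) (xi * b) = cnj xi * cnj (side s (cnj (4 * of_real h * b)) 1)"
  unfolding side_form_def side_mu_xi using xi_cnj by simp algebra

section \<open>Affine parametrisation of the light cone\<close>

lemma xi_sum: "of_real h * (xi ^ 3 + cnj xi ^ 3) = 2"
  using h_xi h_cnj_xi by (simp add: distrib_left complex_eq_iff)

lemma Re_of_real_mult: "Re (of_real r * z) = r * Re z"
  by simp

text \<open>On null vectors with \<open>a\<^sub>3 = 1\<close>, the equation of the light cone determines \<open>Re B\<close> from \<open>z\<close>, so that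
  \<open>z\<close> and \<open>Im B\<close> parametrise them.\<close>

context
  fixes a b z A B :: complex
  assumes z: "z = of_real h * cnj xi * (a - xi\<^sup>2 * b - cnj xi ^ 2) + 1"
    and A: "A = 4 * of_real h * (cnj xi * a)" and B: "B = 4 * of_real h * xi * b"
begin

lemma affine_shift: "A = B + 4 * (z - 1 + Complex 1 (- s))"
  unfolding A B z h_cnj_xi[symmetric] using xi_cnj by algebra

lemma affine_norm_form: "h\<^sup>2 * norm_form a b 1 = (cmod (z - 1))\<^sup>2 - Re B"
proof -
  have "of_real (2 * (h\<^sup>2 * norm_form a b 1)) = 2 * ((z - 1) * cnj (z - 1)) - (B + cnj B)"
    unfolding of_real_mult of_real_norm_form B z using xi_cnj xi_sum by simp algebra
  also have "\<dots> = of_real (2 * ((cmod (z - 1))\<^sup>2 - Re B))"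
    unfolding complex_add_cnj complex_norm_square[symmetric] by simp
  finally show ?thesis unfolding of_real_eq_iff by simp
qed

lemma affine_height: "h * height a b 1 = Re ((z - 1) * cnj (side s B 1))"
proof -
  have "of_real h * ((a - centre b 1) * cnj (xi * side s B 1)) = (z - 1) * cnj (side s B 1)"
    unfolding centre_def z using xi_cnj by simp
  then show ?thesis unfolding height_def B by (metis Re_of_real_mult)
qed

text \<open>Here \<open>1\<close> stands in the first slot of \<open>side\<close>. The symmetry
  \<open>side_swap\<close> exchanges the slots at the price of a conjugation, which is why
  \<open>cnj A\<close> appears and \<open>side\<close> itself is not conjugated.\<close>

lemma affine_height': "h * height b 1 a = - Re ((z + 1) * side s (cnj A) 1)"
proof -
  have "a = xi * (cnj xi * a)" using xi_cnj by (simp add: mult.assoc[symmetric])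
  then have "xi * side s (4 * of_real h * xi) a = xi * side s (4 * of_real h * xi) (xi * (cnj xi * a))"
    by (rule arg_cong)
  then have "xi * side s (4 * of_real h * xi * 1) a = cnj xi * cnj (side s (cnj A) 1)"
    using side_swap[of "cnj xi * a"] unfolding A by simp
  moreover have "of_real h * ((b - centre 1 a) * cnj (cnj xi * cnj (side s (cnj A) 1)))
     = - ((z + 1) * side s (cnj A) 1)"
    unfolding centre_def z using xi_cnj xi_sum by simp algebra
  ultimately show ?thesis
    unfolding height_def by (metis Re_of_real_mult uminus_complex.sel(1))
qed

lemma affine_height_sum:
  assumes "norm_form a b 1 = 0"
  shows "h * (height a b 1 + height b 1 a) = - gap (Re z) (Im z) (Im B + 2 * Im z - 2 * s) s / 5"
proof -
  define x y t where "x = Re z" and "y = Im z" and "t = Im B + 2 * Im z - 2 * s"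
  have "(cmod (z - 1))\<^sup>2 = (x - 1)\<^sup>2 + y\<^sup>2" by (simp add: cmod_power2 x_def y_def)
  then have B': "B = Complex ((x - 1)\<^sup>2 + y\<^sup>2) (t - 2*y + 2 * s)"
    using affine_norm_form assms by (simp add: complex_eq_iff t_def y_def)
  then have A': "cnj A = Complex ((x + 1)\<^sup>2 + y\<^sup>2) (- (t + 2*y - 2 * s))"
    unfolding affine_shift by (simp add: complex_eq_iff x_def y_def power2_eq_square algebra_simps)
  have "z = Complex x y" by (simp add: x_def y_def)
  then have "h * (height a b 1 + height b 1 a) = - gap x y t s / 5"
    using side_gap[of x y s t] affine_height affine_height' unfolding A' B'
    by (simp add: distrib_left del: minus_divide_left)
  then show ?thesis by (simp add: x_def y_def t_def)
qed

end

lemma height_sum_affine: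
  assumes "s\<^sup>2 \<le> 125/3" "norm_form a b 1 = 0"
  shows "height a b 1 + height b 1 a \<le> 0"
proof -
  have "h * (height a b 1 + height b 1 a) \<le> 0"
    using affine_height_sum[OF refl refl refl assms(2)] gap_nonneg[OF assms(1)] by simp
  then show ?thesis using h_pos by (simp add: mult_le_0_iff)
qed

lemma height_sum:
  assumes s: "s\<^sup>2 \<le> 125/3" and n: "norm_form a b c = 0"
  shows "height a b c + height b c a \<le> 0"
proof (cases "c = 0")
  case True
  \<comment> \<open>At \<open>c = 0\<close> the norm form degenerates to a single square, and on its
    zero set both flipped coordinates sit at their centres, so both heights vanish.\<close>
  have "of_real (norm_form a b 0) = (a - xi\<^sup>2 * b) * cnj (a - xi\<^sup>2 * b)"
    unfolding of_real_norm_form using xi_cnj by simp algebra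
  then have "(a - xi\<^sup>2 * b) * cnj (a - xi\<^sup>2 * b) = 0" using n True by simp
  then have "a = xi\<^sup>2 * b" unfolding mult_eq_0_iff complex_cnj_zero_iff by simp
  moreover from this have "cnj xi ^ 2 * a = b" using xi_cnj by algebra
  ultimately have "a - centre b 0 = 0" "b - centre 0 a = 0" by (simp_all add: centre_def)
  then show ?thesis unfolding True height_def by simp
next
  case False
  have "norm_form (a / c) (b / c) 1 = 0"
    using norm_form_scale[of c "a / c" "b / c" 1] False n by simp
  from height_sum_affine[OF s this]
  have "(cmod c) ^ 4 * (height (a / c) (b / c) 1 + height (b / c) 1 (a / c)) \<le> 0"
    by (simp add: mult_le_0_iff)
  then show ?thesis
    using height_scale[of c "a / c" "b / c" 1] height_scale[of c "b / c" 1 "a / c"] False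
    by (simp add: distrib_left)
qed

section \<open>Flips and ping-pong\<close>

lemma norm_form_rotate: "norm_form b c a = norm_form a b c"
  unfolding norm_form_def by (simp add: algebra_simps)

lemma norm_form_flip: "norm_form (2 * centre b c - a) b c = norm_form a b c"
proof -
  have "complex_of_real (norm_form (2 * centre b c - a) b c) = norm_form a b c"
    unfolding of_real_norm_form centre_def by simp algebra
  then show ?thesis by (simp only: of_real_eq_iff)
qed

lemma height_flip: "height (2 * centre b c - a) b c = - height a b c"
proof -
  have "2 * centre b c - a - centre b c = - (a - centre b c)" by simp
  then show ?thesis unfolding height_def by (simp only: mult_minus_left uminus_complex.sel)
qed

text \<open>The \<open>k\<close>-th reflection in coordinates without its overall sign
  (\<open>coords_reflection\<close>); \<open>ht\<close> does not see that sign.\<close>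

definition flip :: "3 \<Rightarrow> complex^3 \<Rightarrow> complex^3" where
  "flip k a = (\<chi> i. if i = k + 2 then 2 * centre (a$k) (a$(k + 1)) - a$i else a$i)"

definition null_form :: "complex^3 \<Rightarrow> real" where
  "null_form a = norm_form (a$1) (a$2) (a$3)"

definition ht :: "3 \<Rightarrow> complex^3 \<Rightarrow> real" where
  "ht k a = height (a$(k + 2)) (a$k) (a$(k + 1))"

lemma index3_wrap: "(4::3) = 1" "(5::3) = 2" "(6::3) = 3"
  by simp_all

lemma null_form_index: "null_form a = norm_form (a$(k + 2)) (a$k) (a$(k + 1))"
  using exhaust_3[of k] norm_form_rotate[of "a$1" "a$2" "a$3"] norm_form_rotate[of "a$2" "a$3" "a$1"]
  by (auto simp: null_form_def index3_wrap)

lemma index3_neq: "(k::3) \<noteq> k + 1" "k \<noteq> k + 2" "k + 1 \<noteq> k + 2" "k + 1 \<noteq> k" "k + 2 \<noteq> k" "k + 2 \<noteq> k + 1"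
  using exhaust_3[of k] by auto

lemma null_form_flip: "null_form (flip k a) = null_form a"
  unfolding null_form_index[of _ k] flip_def by (simp add: index3_neq norm_form_flip)

lemma ht_flip: "ht k (flip k a) = - ht k a"
  unfolding ht_def flip_def by (simp add: index3_neq height_flip)

lemma ht_sum:
  assumes "s\<^sup>2 \<le> 125/3" "null_form a = 0" "j \<noteq> k"
  shows "ht j a + ht k a \<le> 0"
proof -
  have 1: "ht i a + ht (i + 1) a \<le> 0" for i
  proof -
    have "ht (i + 1) a = height (a$i) (a$(i + 1)) (a$(i + 2))"
      unfolding ht_def using exhaust_3[of i] by (auto simp: index3_wrap)
    then show ?thesis
      using height_sum[OF assms(1), of "a$(i + 2)" "a$i" "a$(i + 1)"] assms(2)
      unfolding null_form_index[of _ i] ht_def by simp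
  qed
  have "k = j + 1 \<or> j = k + 1" using assms(3) exhaust_3[of j] exhaust_3[of k] by auto
  then show ?thesis using 1[of j] 1[of k] by (auto simp: add.commute)
qed

text \<open>By induction the shorter word brings the point to where the height of its first letter
  \<open>j\<close> is positive. Then \<open>ht_sum\<close> makes the height of
  \<open>k \<noteq> j\<close> negative, and the flip \<open>k\<close> reverses its sign.\<close>

lemma ping_pong:
  assumes s: "s\<^sup>2 \<le> 125/3" and n: "null_form a = 0" and neg: "\<And>k. ht k a < 0"
    and w: "distinct_adj (k # w)"
  shows "ht k (foldr flip (k # w) a) > 0"
  using w
proof (induction w arbitrary: k)
  case Nil
  then show ?case using neg[of k] by (simp add: ht_flip)
next
  case (Cons j w)
  have n': "null_form (foldr flip v a) = 0" for v
    by (induction v) (simp_all add: n null_form_flip)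
  have "ht j (foldr flip (j # w) a) > 0" using Cons by (auto simp: distinct_adj_Cons)
  moreover have "j \<noteq> k" using Cons.prems by auto
  ultimately have "ht k (foldr flip (j # w) a) < 0"
    using ht_sum[OF s n', of j k "j # w"] by linarith
  then show ?case using ht_flip[of k "foldr flip (j # w) a"] by simp
qed

section \<open>The representation in coordinates\<close>

text \<open>With the parameter \<open>- s\<close>, \<open>beta\<close> is a multiple of
  \<open>xi ^ 3\<close> and not of its conjugate.\<close>

lemma beta_xi: "beta (- s) = \<i> * xi ^ 3 / of_real (sqrt 2)"
proof -
  have "sqrt (2 + 2 * s\<^sup>2) = sqrt 2 * h" by (simp add: h_def flip: real_sqrt_mult)
  moreover have "complex_of_real (- s) + \<i> = \<i> * (of_real h * xi ^ 3)"
    unfolding h_xi by (simp add: complex_eq_iff)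
  ultimately show ?thesis using h_pos by (simp add: beta_def)
qed

section \<open>Hermitian products of normalised vertices\<close>

lemma beta_sq: "beta (- s) * beta (- s) = - (xi ^ 6) / 2" "beta (- s) * cnj (beta (- s)) = 1 / 2"
  "cnj (beta (- s)) * cnj (beta (- s)) = - (cnj xi ^ 6) / 2"
proof -
  have 2: "complex_of_real (sqrt 2) * complex_of_real (sqrt 2) = 2"
    by (simp flip: of_real_mult)
  show 1: "beta (- s) * beta (- s) = - (xi ^ 6) / 2"
    using 2 unfolding beta_xi by (simp add: field_simps)
  show "cnj (beta (- s)) * cnj (beta (- s)) = - (cnj xi ^ 6) / 2"
    using arg_cong[OF 1, of cnj] by simp
  show "beta (- s) * cnj (beta (- s)) = 1 / 2"
    using complex_norm_square[of "beta (- s)"] norm_beta[of "- s"] by simp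
qed

text \<open>Chosen so that all three cyclic products equal \<open>- xi\<close>. Minus the triple
  product is then \<open>xi ^ 3\<close>, whose argument \<open>arctan s\<close> is the Cartan
  invariant.\<close>

definition vertex_scale :: "3 \<Rightarrow> complex" where
  "vertex_scale k = (if k = 1 then of_real h * cnj xi ^ 2 / of_real (sqrt (2 * h))
     else if k = 2 then of_real (sqrt (2 * h)) else of_real h * xi\<^sup>2 / of_real (sqrt (2 * h)))"

definition vertex :: "3 \<Rightarrow> complex^3" where
  "vertex k = vertex_scale k *s lift (ideal_vertex (- s) k)"

lemma vertex_scale_nz: "vertex_scale k \<noteq> 0"
  using h_pos norm_xi by (auto simp: vertex_scale_def)

lemma herm_vertex_self: "herm (vertex k) (vertex k) = 0"
  using herm_S3[OF ideal_vertex_S3[of "- s" k]] by (simp add: vertex_def herm_simps)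

lemma herm_vertex: "herm (vertex k) (vertex (k + 1)) = - xi"
proof -
  define q where "q = complex_of_real (sqrt (2 * h))"
  have q: "q * q = 2 * of_real h" "q \<noteq> 0" "cnj q = q"
    using h_pos unfolding q_def by (simp_all flip: of_real_mult) simp
  have 12: "herm (lift (ideal_vertex (- s) 1)) (lift (ideal_vertex (- s) 2)) = - (1 + xi ^ 6) / 2"
    by (simp add: herm_def ideal_vertex_def beta_sq field_simps)
  have 23: "herm (lift (ideal_vertex (- s) 2)) (lift (ideal_vertex (- s) 3)) = - (1 + xi ^ 6) / 2"
    by (simp add: herm_def ideal_vertex_def beta_sq field_simps)
  have 31: "herm (lift (ideal_vertex (- s) 3)) (lift (ideal_vertex (- s) 1)) = - (1 + cnj xi ^ 6)"
    by (simp add: herm_def ideal_vertex_def beta_sq field_simps)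
  \<comment> \<open>This identity and the next are \<open>xi_sum\<close> multiplied by powers of
    \<open>xi\<close>.\<close>
  have 4: "of_real h * cnj xi ^ 2 * ((1 + xi ^ 6) / 2) = xi"
    using xi_cnj xi_sum by algebra
  have 5: "of_real h * xi ^ 4 * ((1 + cnj xi ^ 6) / 2) = xi"
    using xi_cnj xi_sum by algebra
  consider "k = 1" | "k = 2" | "k = 3" using exhaust_3[of k] by auto
  then show ?thesis
  proof cases
    case 1
    have "herm (vertex 1) (vertex 2) = of_real h * cnj xi ^ 2 / q * q * (- (1 + xi ^ 6) / 2)"
      by (simp add: vertex_def herm_simps 12 vertex_scale_def q_def)
    also have "\<dots> = - (of_real h * cnj xi ^ 2 * ((1 + xi ^ 6) / 2))" using q(2) by (simp add: field_simps)
    finally show ?thesis using 4 1 by simp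
  next
    case 2
    have "herm (vertex 2) (vertex 3) = q * (of_real h * cnj xi ^ 2 / q) * (- (1 + xi ^ 6) / 2)"
      by (simp add: vertex_def herm_simps 23 vertex_scale_def q_def)
    also have "\<dots> = - (of_real h * cnj xi ^ 2 * ((1 + xi ^ 6) / 2))" using q(2) by (simp add: field_simps)
    finally show ?thesis using 4 2 by simp
  next
    case 3
    have "herm (vertex 3) (vertex 1) = (of_real h * xi\<^sup>2 / q) * (of_real h * xi\<^sup>2 / q) * (- (1 + cnj xi ^ 6))"
      by (simp add: vertex_def herm_simps 31 vertex_scale_def q_def)
    also have "\<dots> = - (of_real h * xi ^ 4 * ((1 + cnj xi ^ 6) / 2))"
      using q h_pos by (simp add: field_simps power2_eq_square power4_eq_xxxx)
    finally show ?thesis using 5 3 by (simp add: index3_wrap)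
  qed
qed

lemma herm_vertex': "herm (vertex (k + 1)) (vertex k) = - cnj xi"
  using cnj_herm[of "vertex k" "vertex (k + 1)"] herm_vertex[of k] by simp

lemma herm_vertex2: "herm (vertex (k + 2)) (vertex k) = - xi" "herm (vertex k) (vertex (k + 2)) = - cnj xi"
  "herm (vertex (k + 1)) (vertex (k + 2)) = - xi" "herm (vertex (k + 2)) (vertex (k + 1)) = - cnj xi"
proof -
  have 1: "k + 2 + 1 = k" and 2: "k + 1 + 1 = k + 2" using exhaust_3[of k] by auto
  show "herm (vertex (k + 2)) (vertex k) = - xi" "herm (vertex k) (vertex (k + 2)) = - cnj xi"
    "herm (vertex (k + 1)) (vertex (k + 2)) = - xi" "herm (vertex (k + 2)) (vertex (k + 1)) = - cnj xi"
    using herm_vertex[of "k + 2"] herm_vertex'[of "k + 2"] herm_vertex[of "k + 1"] herm_vertex'[of "k + 1"]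
    unfolding 1 2 .
qed

section \<open>Polar vectors and reflections\<close>

definition polar :: "3 \<Rightarrow> complex^3" where
  "polar k = vertex (k + 2) - cnj xi ^ 2 *s vertex k - xi\<^sup>2 *s vertex (k + 1)"

text \<open>Up to the factor \<open>2 / h\<close> the polar vectors are the basis dual to the
  vertices; \<open>from_coords\<close> is built from them.\<close>

lemma herm_polar:
  "herm (vertex k) (polar k) = 0" "herm (vertex (k + 1)) (polar k) = 0"
  "herm (vertex (k + 2)) (polar k) = of_real (2 / h)"
proof -
  have "xi * xi\<^sup>2 + cnj xi * cnj xi ^ 2 = of_real (2 / h)"
    using xi_sum h_pos by (simp add: field_simps power2_eq_square power3_eq_cube)
  then show "herm (vertex (k + 2)) (polar k) = of_real (2 / h)"
    unfolding polar_def
    by (simp add: herm_simps herm_vertex_self herm_vertex2 mult.commute)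
  show "herm (vertex k) (polar k) = 0" "herm (vertex (k + 1)) (polar k) = 0"
    unfolding polar_def using xi_cnj mult.commute[of "cnj xi" xi]
    by (simp_all add: herm_simps herm_vertex_self herm_vertex herm_vertex' herm_vertex2 power2_eq_square)
qed

lemma herm_polar_self: "herm (polar k) (polar k) = of_real (2 / h)"
proof -
  have "herm (polar k) (polar k) = herm (vertex (k + 2)) (polar k)
      - cnj xi ^ 2 * herm (vertex k) (polar k) - xi\<^sup>2 * herm (vertex (k + 1)) (polar k)"
    by (subst polar_def) (simp only: herm_simps)
  then show ?thesis by (simp add: herm_polar)
qed

lemma herm_polar':
  "herm (polar k) (vertex k) = 0" "herm (polar k) (vertex (k + 1)) = 0"
  "herm (polar k) (vertex (k + 2)) = of_real (2 / h)"
  using herm_polar[of k] cnj_herm[of _ "polar k"] by (metis complex_cnj_zero complex_cnj_complex_of_real)+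

definition reflection :: "3 \<Rightarrow> complex^3^3" where
  "reflection k = reflection_matrix (polar k)"

lemma reflection_SU21: "reflection k \<in> carrier SU21"
  unfolding reflection_def using herm_polar_self[of k] h_pos by (intro reflection_matrix_SU21) simp

lemma triangle_reflection_eq: "triangle_reflection (- s) k = PU21_class (reflection k)"
proof -
  let ?p = "ideal_vertex (- s) k" and ?q = "ideal_vertex (- s) (k + 1)"
  let ?C = "C_circle_through ?p ?q"
  note C = C_circle_through[OF ideal_vertex_S3 ideal_vertex_S3 ideal_vertex_distinct, of "- s" k]
  have p: "herm (lift ?p) (polar k) = 0" and q: "herm (lift ?q) (polar k) = 0"
    using herm_polar(1,2)[of k] vertex_scale_nz by (simp_all add: vertex_def herm_simps)
  have "herm (lift z) (polar k) = 0" if "z \<in> ?C" for z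
  proof -
    obtain t where "z = ?p + t *s (?q - ?p)" using \<open>z \<in> ?C\<close> C(1) by auto
    then show ?thesis by (simp only: lift_line herm_simps p q) simp
  qed
  moreover have "Re (herm (polar k) (polar k)) > 0" using h_pos by (simp add: herm_polar_self)
  ultimately show ?thesis
    unfolding triangle_reflection_def reflection_def
    by (intro complex_reflection_properties(1) C(2)) auto
qed

section \<open>Words in coordinates\<close>

definition coords :: "complex^3 \<Rightarrow> complex^3" where
  "coords v = (\<chi> k. herm v (vertex k))"

text \<open>Only \<open>vertex (k + 2)\<close> has a nonzero product with \<open>polar k\<close>, so
  every other coordinate is merely negated.\<close>

lemma coords_reflection: "coords (reflection k *v v) = - flip k (coords v)"
proof -
  have "herm (reflection k *v v) (vertex i) = - (flip k (coords v) $ i)" for i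
  proof -
    have "i = k \<or> i = k + 1 \<or> i = k + 2" using exhaust_3[of i] exhaust_3[of k] by auto
    moreover have "herm v (polar k) = herm v (vertex (k + 2)) - centre (herm v (vertex k)) (herm v (vertex (k + 1)))"
      by (simp add: polar_def herm_simps centre_def)
    ultimately show ?thesis
      using h_pos
      by (auto simp: reflection_def reflection_matrix_mult herm_simps herm_polar' herm_polar_self
          flip_def coords_def index3_neq)
  qed
  then show ?thesis by (simp add: coords_def vec_eq_iff)
qed

definition word_matrix :: "3 list \<Rightarrow> complex^3^3" where
  "word_matrix w = foldr (\<lambda>k A. reflection k ** A) w (mat 1)"

lemma word_matrix_SU21: "word_matrix w \<in> carrier SU21"
proof (induction w)
  case Nil
  then show ?case by (simp add: word_matrix_def SU21_mat_1)
next
  case (Cons k w)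
  then show ?case
    using SU21.m_closed[OF reflection_SU21[of k], of "word_matrix w"]
    by (simp add: word_matrix_def SU21_def)
qed

lemma rho_eq: "rho (- s) w = PU21_class (word_matrix w)"
proof (induction w)
  case Nil
  then show ?case by (simp add: rho_def word_matrix_def PU21_one)
next
  case (Cons k w)
  then have "rho (- s) (k # w) = PU21_class (reflection k) \<otimes>\<^bsub>PU21\<^esub> PU21_class (word_matrix w)"
    by (simp add: rho_def triangle_reflection_eq)
  also have "\<dots> = PU21_class (reflection k ** word_matrix w)"
    by (rule PU21_class_mult[OF reflection_SU21 word_matrix_SU21])
  finally show ?case by (simp add: word_matrix_def)
qed

lemma flip_minus: "flip k (- a) = - flip k a"
  by (simp add: flip_def vec_eq_iff centre_def algebra_simps)

lemma coords_word: "coords (word_matrix w *v v) = (- 1) ^ length w *s foldr flip w (coords v)"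
proof (induction w)
  case Nil
  then show ?case by (simp add: word_matrix_def)
next
  case (Cons k w)
  have "coords (word_matrix (k # w) *v v) = - flip k (coords (word_matrix w *v v))"
    by (simp add: word_matrix_def coords_reflection flip: matrix_vector_mul_assoc)
  also have "\<dots> = - flip k ((- 1) ^ length w *s foldr flip w (coords v))" by (simp only: Cons)
  also have "\<dots> = (- 1) ^ length (k # w) *s foldr flip (k # w) (coords v)"
    by (cases "even (length w)") (simp_all add: flip_minus vec_eq_iff)
  finally show ?case .
qed

definition from_coords :: "complex^3 \<Rightarrow> complex^3" where
  "from_coords a = of_real (h / 2) *s (a$3 *s polar 1 + a$1 *s polar 2 + a$2 *s polar 3)"

lemma coords_from_coords: "coords (from_coords a) = a"
  using herm_polar'[of 1] herm_polar'[of 2] herm_polar'[of 3] h_pos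
  by (simp add: coords_def from_coords_def vec_eq_iff forall_3 herm_simps index3_wrap)

end


section \<open>Discreteness and faithfulness\<close>

text \<open>The quantity is \<open>W\<close> in the proof of \<open>base_point\<close>, written with
  \<open>s = e * u\<close> and \<open>y = - 2 * e\<close>; as a polynomial in \<open>u\<close> it
  has positive coefficients.\<close>

lemma base_point_poly:
  fixes e u :: real
  assumes e: "e = 1 \<or> e = - 1" and u: "0 \<le> u"
  defines "B \<equiv> Complex (1 + (- 2 * e)\<^sup>2) (2 * (e * u - - 2 * e))"
  shows "0 < Re (4 * of_real (1 + (e * u)\<^sup>2) * (Complex 1 (- (e * u)) * B) * (B * cnj B)
    + cnj (side_coeff1 (e * u)) * (Complex 1 (- (e * u)))\<^sup>2 * B ^ 3
    + of_real (1 + (e * u)\<^sup>2) * (B * cnj B) * (side_coeff2 (e * u) * B))"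
proof -
  have "Re (4 * of_real (1 + (e * u)\<^sup>2) * (Complex 1 (- (e * u)) * B) * (B * cnj B)
    + cnj (side_coeff1 (e * u)) * (Complex 1 (- (e * u)))\<^sup>2 * B ^ 3
    + of_real (1 + (e * u)\<^sup>2) * (B * cnj B) * (side_coeff2 (e * u) * B))
    = 288/5*u^6 + 1728/5*u^5 + 17656/5*u^4 + 47184/5*u^3 + 16084*u^2 + 11344*u + 6620"
    unfolding B_def side_coeff1_def side_coeff2_def
    by (rule disjE[OF e]) (simp_all add: power2_eq_square power3_eq_cube eval_nat_numeral field_simps)
  also have "\<dots> > 0" by (intro add_nonneg_pos add_nonneg_nonneg) (simp_all add: u)
  finally show ?thesis .
qed

context ideal_triangle
begin

lemma base_point_gap:
  assumes "s\<^sup>2 \<le> 125/3" "y = - 2 \<and> 0 \<le> s \<or> y = 2 \<and> s \<le> 0"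
  shows "0 < gap 0 y 0 s"
proof -
  define u where "u = \<bar>s\<bar>"
  have u: "u\<^sup>2 \<le> 125/3" "0 \<le> u" using assms(1) by (simp_all add: u_def)
  \<comment> \<open>The value 13/2 is a rational upper bound for the square root of 125/3.\<close>
  then have "u\<^sup>2 \<le> (13/2)\<^sup>2" by (simp add: power2_eq_square)
  then have u1: "u \<le> 13/2" by (rule power2_le_imp_le) simp
  have "gap 0 y 0 s = 68450 - 8856 * u + 5544 * u\<^sup>2 - 864 * u ^ 3"
    using assms(2) by (auto simp: gap_def u_def)
  moreover have "864 * u ^ 3 \<le> 5616 * u\<^sup>2"
    using mult_right_mono[OF u1, of "864 * u\<^sup>2"] by (simp add: power2_eq_square power3_eq_cube)
  ultimately show ?thesis using u u1 by linarith
qed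

text \<open>The point lies on the symmetry locus \<open>Re z = 0\<close> of the first two heights, hence they agree there
  and are negative by \<open>base_point_gap\<close>.\<close>

lemma base_point:
  assumes s: "s\<^sup>2 \<le> 125/3"
  shows "\<exists>a. null_form a = 0 \<and> (\<forall>k. ht k a < 0)"
proof -
  \<comment> \<open>This sign gives \<open>s * y \<le> 0\<close>, which makes
    \<open>1 - y\<^sup>2 + 2 * (s * y)\<close> negative for the third height.\<close>
  define y where "y = (if 0 \<le> s then - 2 else 2 :: real)"
  have y: "y = - 2 \<and> 0 \<le> s \<or> y = 2 \<and> s \<le> 0" by (simp add: y_def)
  obtain e u where eu: "s = e * u" "y = - 2 * e" "e = 1 \<or> e = - 1" "0 \<le> u"
    using y by (metis mult_1 mult_minus1 minus_mult_minus mult.right_neutral neg_0_le_iff_le)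
  define B where "B = Complex (1 + y\<^sup>2) (2 * (s - y))"
  define q where "q = complex_of_real (4 * h)"
  have q: "q \<noteq> 0" "cnj q = q" "q = 4 * of_real h" using h_pos by (simp_all add: q_def)
  define b where "b = cnj xi * B / q"
  define a where "a = cnj b"
  have B: "B = 4 * of_real h * xi * b" using q xi_cnj by (simp add: b_def)
  have A: "cnj B = 4 * of_real h * (cnj xi * a)" using arg_cong[OF B, of cnj] by (simp add: a_def)
  define z where "z = Complex 0 y"
  have "cnj B = B + 4 * (z - 1 + Complex 1 (- s))"
    by (simp add: B_def z_def complex_eq_iff)
  then have z: "z = of_real h * cnj xi * (a - xi\<^sup>2 * b - cnj xi ^ 2) + 1"
    unfolding A h_cnj_xi[symmetric] unfolding B using xi_cnj by algebra
  note aff = z A B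
  have "(cmod (z - 1))\<^sup>2 = Re B" by (simp add: cmod_power2 z_def B_def)
  then have n: "norm_form a b 1 = 0"
    using affine_norm_form[OF aff] h_pos by simp
  have "height a b 1 = height b 1 a"
  proof -
    have "z + 1 = - cnj (z - 1)" by (simp add: z_def complex_eq_iff)
    then have "(z + 1) * side s (cnj (cnj B)) 1 = - cnj ((z - 1) * cnj (side s B 1))"
      unfolding complex_cnj_mult complex_cnj_cnj by (simp only: mult_minus_left)
    then have "h * height a b 1 = h * height b 1 a"
      using affine_height[OF aff] affine_height'[OF aff] by simp
    then show ?thesis using h_pos by simp
  qed
  moreover have "h * (height a b 1 + height b 1 a) < 0"
    using affine_height_sum[OF aff n] base_point_gap[OF s y] by (simp add: z_def B_def)
  ultimately have 12: "height a b 1 < 0" "height b 1 a < 0" using h_pos by (simp_all add: mult_less_0_iff)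
  \<comment> \<open>Since \<open>a = cnj b\<close>, both \<open>1 - centre a b\<close> and the value
    of the side form are real; the first is negative, the second positive.\<close>
  have 3: "height 1 a b < 0"
  proof -
    define W where "W = 4 * of_real (h\<^sup>2) * (Complex 1 (- s) * B) * (B * cnj B)
      + cnj (side_coeff1 s) * (Complex 1 (- s))\<^sup>2 * B ^ 3 + of_real (h\<^sup>2) * (B * cnj B) * (side_coeff2 s * B)"
    have W: "0 < Re W"
      using base_point_poly[OF eu(3,4)] unfolding W_def B_def h_sq eu(1,2)[symmetric] .
    have ab: "cnj a = b" "cnj b = a" by (simp_all add: a_def)
    have "4 * of_real h ^ 3 * (xi * side s (4 * of_real h * xi * a) b) = W + cnj W"
      unfolding W_def h_cnj_xi[symmetric] A side_form_def side_mu_xi unfolding B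
      using xi_cnj by (simp add: ab) algebra
    then have Q: "4 * of_real h ^ 3 * (xi * side s (4 * of_real h * xi * a) b) = of_real (2 * Re W)"
      unfolding complex_add_cnj .
    have "4 * of_real h ^ 2 * (1 - centre a b) = 4 * of_real h ^ 2 - (cnj (Complex 1 (- s) * B) + Complex 1 (- s) * B)"
      unfolding centre_def h_cnj_xi[symmetric] complex_cnj_mult A unfolding B
      using xi_cnj by simp algebra
    also have "\<dots> = of_real (4 * h\<^sup>2 - 2 * Re (Complex 1 (- s) * B))"
      by (simp add: complex_eq_iff)
    also have "4 * h\<^sup>2 - 2 * Re (Complex 1 (- s) * B) = 2 * (1 - y\<^sup>2 + 2 * (s * y))"
      using h_sq by (simp add: B_def power2_eq_square algebra_simps)
    finally have c: "4 * of_real h ^ 2 * (1 - centre a b) = of_real (2 * (1 - y\<^sup>2 + 2 * (s * y)))" .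
    have "16 * of_real h ^ 5 * ((1 - centre a b) * cnj (xi * side s (4 * of_real h * xi * a) b))
      = (4 * of_real h ^ 2 * (1 - centre a b)) * cnj (4 * of_real h ^ 3 * (xi * side s (4 * of_real h * xi * a) b))"
      by (simp add: eval_nat_numeral)
    also have "\<dots> = of_real (2 * (1 - y\<^sup>2 + 2 * (s * y)) * (2 * Re W))"
      unfolding c Q by simp
    finally have "of_real (16 * h ^ 5) * ((1 - centre a b) * cnj (xi * side s (4 * of_real h * xi * a) b))
      = of_real (2 * (1 - y\<^sup>2 + 2 * (s * y)) * (2 * Re W))" by simp
    then have "16 * h ^ 5 * height 1 a b = 2 * (1 - y\<^sup>2 + 2 * (s * y)) * (2 * Re W)"
      unfolding height_def by (metis Re_of_real_mult Re_complex_of_real)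
    moreover have "1 - y\<^sup>2 + 2 * (s * y) < 0" using y by auto
    ultimately have "16 * h ^ 5 * height 1 a b < 0" using W mult_neg_pos[of "2 * (1 - y\<^sup>2 + 2 * (s * y))" "2 * Re W"] by simp
    moreover have "0 < 16 * h ^ 5" using h_pos by simp
    ultimately show ?thesis by (metis mult_less_0_iff order_less_asym)
  qed
  have "ht k (vector [b, 1, a]) < 0" for k
    using 12 3 exhaust_3[of k] by (auto simp: ht_def index3_wrap)
  moreover have "null_form (vector [b, 1, a]) = 0"
    using n norm_form_rotate[of b 1 a] by (simp add: null_form_def)
  ultimately show ?thesis by blast
qed

section \<open>Open sets cut out by the heights\<close>

lemma coords_scale: "coords (c *s v) = c *s coords v"
  by (simp add: coords_def vec_eq_iff herm_simps)

lemma ht_scale: "ht k (c *s a) = (cmod c) ^ 4 * ht k a"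
  by (simp add: ht_def height_scale)

lemma continuous_on_height:
  assumes "continuous_on X f" "continuous_on X g" "continuous_on X f'"
  shows "continuous_on X (\<lambda>x. height (f x) (g x) (f' x))"
  unfolding height_def centre_def side_form_def by (intro continuous_intros assms)

lemma continuous_ht_coords:
  fixes B :: "complex^3^3" and v :: "complex^3"
  shows "continuous_on UNIV (\<lambda>A. ht k (coords (B ** A *v v)))"
proof -
  have "continuous_on UNIV (\<lambda>A :: complex^3^3. A *v v)"
    unfolding matrix_vector_mult_def
    by (intro continuous_on_vec_lambda continuous_on_sum continuous_on_mult continuous_on_const
        continuous_on_component continuous_on_id)
  then have "continuous_on UNIV (\<lambda>A :: complex^3^3. B *v (A *v v))"
    unfolding matrix_vector_mult_def[of B]
    by (intro continuous_on_vec_lambda continuous_on_sum continuous_on_mult continuous_on_const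
        continuous_on_component)
  then have "continuous_on UNIV (\<lambda>A. coords (B ** A *v v) $ i)" for i
    unfolding coords_def herm_def vec_lambda_beta matrix_vector_mul_assoc
    by (intro continuous_on_add continuous_on_diff continuous_on_mult continuous_on_const continuous_on_component)
  then show ?thesis unfolding ht_def by (intro continuous_on_height)
qed

text \<open>The elements that move \<open>v\<close> into the region of negative heights. Since
  scalars multiply heights by positive factors, any representative decides membership
  (\<open>class_in_ping_domain\<close>).\<close>

definition ping_domain :: "complex^3 \<Rightarrow> (complex^3^3) set set" where
  "ping_domain v = PU21_class ` {A \<in> carrier SU21. \<forall>k. ht k (coords (A *v v)) < 0}"

lemma class_in_ping_domain:
  assumes "A \<in> carrier SU21"
  shows "PU21_class A \<in> ping_domain v \<longleftrightarrow> (\<forall>k. ht k (coords (A *v v)) < 0)"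
proof
  assume "PU21_class A \<in> ping_domain v"
  then obtain A' where A': "A' \<in> carrier SU21" "PU21_class A = PU21_class A'"
    "\<forall>k. ht k (coords (A' *v v)) < 0"
    by (auto simp: ping_domain_def)
  then have "A \<in> PU21_class A'" using class_in_PU21[OF assms] by simp
  then obtain c where c: "c \<noteq> 0" "A = mat c ** A'" using PU21_classD[OF A'(1)] by blast
  then show "\<forall>k. ht k (coords (A *v v)) < 0"
    using A'(3) by (simp add: c(2) mat_mult_vec coords_scale ht_scale mult_less_0_iff flip: matrix_vector_mul_assoc)
qed (use assms in \<open>auto simp: ping_domain_def\<close>)

lemma openin_ping_domain:
  assumes "B \<in> carrier SU21"
  shows "openin PU21_topology {X \<in> carrier PU21. PU21_class B \<otimes>\<^bsub>PU21\<^esub> X \<in> ping_domain v}"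
    (is "openin _ ?U")
proof -
  have "{A \<in> carrier SU21. PU21_class A \<in> ?U} = carrier SU21 \<inter> (\<Inter>k. {A. ht k (coords (B ** A *v v)) < 0})"
  proof -
    have "PU21_class A \<in> ?U \<longleftrightarrow> (\<forall>k. ht k (coords (B ** A *v v)) < 0)" if A: "A \<in> carrier SU21" for A
      using class_in_ping_domain[of "B ** A"] SU21.m_closed[OF assms A] A
      by (auto simp: PU21_class_mult[OF assms A] carrier_PU21 SU21_def)
    then show ?thesis by auto
  qed
  moreover have "open (\<Inter>k. {A. ht k (coords (B ** A *v v)) < 0})"
    using open_Collect_less[OF continuous_ht_coords continuous_on_const] by (intro open_INT) auto
  ultimately show ?thesis
    unfolding openin_PU21_topology by (auto simp: openin_open)
qed

lemma discrete_faithful: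
  assumes s: "s\<^sup>2 \<le> 125/3"
  shows "inj_on (rho (- s)) (carrier Gamma_Z2)" (is "inj_on ?r ?G")
    and "discrete_in_PU21 (rho (- s) ` carrier Gamma_Z2)"
proof -
  obtain a where a: "null_form a = 0" "\<And>k. ht k a < 0" using base_point[OF s] by auto
  define v where "v = from_coords a"
  note G = group_Gamma_Z2
  have mult: "?r (w \<otimes>\<^bsub>Gamma_Z2\<^esub> w') = ?r w \<otimes>\<^bsub>PU21\<^esub> ?r w'" if "w \<in> ?G" "w' \<in> ?G" for w w'
    using rho_hom that by (rule hom_mult)
  have one: "\<one>\<^bsub>Gamma_Z2\<^esub> = []" by (simp add: Gamma_Z2_def)
  \<comment> \<open>For a nonempty word ping-pong makes the height of its first letter
    positive.\<close>
  have Nil: "w = []" if "w \<in> ?G" "?r w \<in> ping_domain v" for w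
  proof (cases w)
    case (Cons k u)
    then have "distinct_adj (k # u)" using that(1) by (simp add: Gamma_Z2_def)
    from ping_pong[OF s a this]
    have "0 < ht k (coords (word_matrix w *v v))"
      unfolding coords_word ht_scale v_def coords_from_coords Cons by (simp add: norm_power)
    moreover have "ht k (coords (word_matrix w *v v)) < 0"
      using that(2) class_in_ping_domain[OF word_matrix_SU21] by (simp add: rho_eq)
    ultimately show ?thesis by simp
  qed simp
  \<comment> \<open>The translate of the ping domain by \<open>w\<close> is an open set that
    contains the image of \<open>w\<close> and of no other element, which yields injectivity and
    discreteness at once.\<close>
  define U where "U w = {X \<in> carrier PU21. ?r (inv\<^bsub>Gamma_Z2\<^esub> w) \<otimes>\<^bsub>PU21\<^esub> X \<in> ping_domain v}" for w
  have U: "openin PU21_topology (U w)" for w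
    unfolding U_def rho_eq by (rule openin_ping_domain[OF word_matrix_SU21])
  have U1: "?r w \<in> U w" if w: "w \<in> ?G" for w
  proof -
    have "?r (inv\<^bsub>Gamma_Z2\<^esub> w) \<otimes>\<^bsub>PU21\<^esub> ?r w = ?r []"
      using mult[OF group.inv_closed[OF G w] w] group.l_inv[OF G w] one by simp
    also have "\<dots> = PU21_class (mat 1)" by (simp add: rho_eq word_matrix_def)
    also have "\<dots> \<in> ping_domain v"
      using a(2) by (simp add: class_in_ping_domain SU21_mat_1 v_def coords_from_coords)
    finally show ?thesis by (simp add: U_def rho_closed)
  qed
  have U2: "w' = w" if w: "w \<in> ?G" "w' \<in> ?G" and r: "?r w' \<in> U w" for w w'
  proof -
    note iw = group.inv_closed[OF G w(1)]
    have "?r (inv\<^bsub>Gamma_Z2\<^esub> w \<otimes>\<^bsub>Gamma_Z2\<^esub> w') \<in> ping_domain v"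
      using r by (simp add: U_def mult[OF iw w(2)])
    then have "inv\<^bsub>Gamma_Z2\<^esub> w \<otimes>\<^bsub>Gamma_Z2\<^esub> w' = \<one>\<^bsub>Gamma_Z2\<^esub>"
      using Nil monoid.m_closed[OF group.is_monoid[OF G] iw w(2)] one by simp
    from group.inv_equality[OF G this w(2) iw]
    have "w' = inv\<^bsub>Gamma_Z2\<^esub> (inv\<^bsub>Gamma_Z2\<^esub> w)" using group.inv_inv[OF G w(2)] by argo
    then show ?thesis using group.inv_inv[OF G w(1)] by argo
  qed
  show "inj_on ?r ?G"
    by (rule inj_onI) (metis U1 U2)
  show "discrete_in_PU21 (?r ` ?G)"
    unfolding discrete_in_PU21_def
  proof (subst eq_commute, subst discrete_topology_unique, intro conjI ballI)
    show "topspace (subtopology PU21_topology (?r ` ?G)) = ?r ` ?G"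
      using rho_closed by (auto simp: topspace_PU21_topology)
  next
    fix x assume "x \<in> ?r ` ?G"
    then obtain w where w: "w \<in> ?G" "x = ?r w" by blast
    have "{x} = U w \<inter> ?r ` ?G" using U1[OF w(1)] U2[OF w(1)] w by auto
    then show "openin (subtopology PU21_topology (?r ` ?G)) {x}"
      using U unfolding openin_subtopology by blast
  qed
qed

section \<open>Ellipticity for large parameters\<close>

text \<open>Both maps are linear, and a one-sided inverse of a square matrix is two-sided.\<close>

lemma from_coords_coords: "from_coords (coords v) = v"
proof -
  define C :: "complex^3^3" where
    "C = (\<chi> k j. if j = 3 then - cnj (vertex k $ j) else cnj (vertex k $ j))"
  define D :: "complex^3^3" where "D = (\<chi> i j. of_real (h / 2) * polar (j + 1) $ i)"
  have C: "coords v = C *v v" for v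
    by (simp add: coords_def C_def matrix_vector_mult_def sum_3 herm_def vec_eq_iff mult.commute)
  have D: "from_coords a = D *v a" for a
    by (simp add: from_coords_def D_def matrix_vector_mult_def sum_3 vec_eq_iff index3_wrap algebra_simps)
  have "C ** D = mat 1"
    by (simp add: matrix_eq coords_from_coords flip: matrix_vector_mul_assoc C D)
  then have "D ** C = mat 1" by (simp add: matrix_left_right_inverse)
  then show ?thesis by (simp add: C D matrix_vector_mul_assoc)
qed

lemma herm_from_coords:
  "herm (from_coords a) (from_coords a) = of_real (h / 2 * null_form a)"
proof -
  define v where "v = from_coords a"
  have a: "herm v (vertex k) = a $ k" for k
    using arg_cong[OF coords_from_coords[of a], of "\<lambda>u. u $ k"] by (simp add: coords_def v_def)
  have p: "herm v (polar k) = a$(k + 2) - centre (a$k) (a$(k + 1))" for k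
    by (simp add: polar_def herm_simps a centre_def)
  have "herm v v = of_real (h / 2) * (cnj (a$3) * herm v (polar 1) + cnj (a$1) * herm v (polar 2)
      + cnj (a$2) * herm v (polar 3))"
    by (subst (2) v_def) (simp add: from_coords_def herm_simps algebra_simps)
  also have "\<dots> = of_real (h / 2 * null_form a)"
    unfolding p null_form_def of_real_mult of_real_norm_form centre_def
    by (simp add: index3_wrap algebra_simps)
  finally show ?thesis by (simp add: v_def)
qed

section \<open>Eigenvectors of the product of the three flips\<close>

lemma flip_scale: "flip k (c *s a) = c *s flip k a"
  by (simp add: flip_def centre_def vec_eq_iff algebra_simps)

lemma flip_flip: "flip k (flip k a) = a"
  by (simp add: flip_def vec_eq_iff index3_neq)

text \<open>For a root \<open>l\<close> of the cubic below, the flip \<open>k\<close> maps \<open>geometric l k\<close> to a multiple of its cyclic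
  shift, so these vectors are eigenvectors of the product of the three reflections.\<close>

definition geometric :: "complex \<Rightarrow> 3 \<Rightarrow> complex^3" where
  "geometric l k = (\<chi> i. if i = k then l else if i = k + 1 then l\<^sup>2 else 1)"

lemma flip_geometric:
  assumes "l ^ 3 - 2 * cnj xi ^ 2 * l\<^sup>2 - 2 * xi\<^sup>2 * l + 1 = 0"
  shows "flip k (geometric l k) = l *s geometric l (k + 1)"
proof -
  have "2 * (xi\<^sup>2 * l + cnj xi ^ 2 * l\<^sup>2) - 1 = l ^ 3" using assms by algebra
  then have "flip k (geometric l k) $ i = (l *s geometric l (k + 1)) $ i" for i
    using exhaust_3[of i] exhaust_3[of k]
    by (auto simp: flip_def geometric_def centre_def index3_wrap power2_eq_square power3_eq_cube)
  then show ?thesis by (simp add: vec_eq_iff)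
qed

text \<open>Three distinct letters run cyclically forwards or backwards. One direction shifts
  \<open>geometric l\<close> three times with total factor \<open>l ^ 3\<close>, the other undoes
  this.\<close>

lemma flips_geometric:
  assumes l: "l ^ 3 - 2 * cnj xi ^ 2 * l\<^sup>2 - 2 * xi\<^sup>2 * l + 1 = 0" and d: "distinct [i, j, k]"
  obtains m c where "c = l ^ 3 \<or> c * l ^ 3 = 1"
    "foldr flip [i, j, k] (geometric l m) = c *s geometric l m"
proof -
  have l0: "l \<noteq> 0" using l by auto
  have "j = k + 1 \<and> i = k + 2 \<or> k = j + 1 \<and> j = i + 1"
    using d exhaust_3[of i] exhaust_3[of j] exhaust_3[of k] by auto
  then show ?thesis
  proof
    assume jk: "j = k + 1 \<and> i = k + 2"
    then have k: "j + 1 = i" "i + 1 = k" using exhaust_3[of k] by auto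
    have "foldr flip [i, j, k] (geometric l k) = l ^ 3 *s geometric l k"
      using flip_geometric[OF l, of k] flip_geometric[OF l, of j] flip_geometric[OF l, of i] jk
      unfolding k by (simp add: flip_scale power3_eq_cube)
    then show ?thesis using that by blast
  next
    assume jk: "k = j + 1 \<and> j = i + 1"
    then have i: "k + 1 = i" using exhaust_3[of i] by auto
    have inv: "flip m (geometric l (m + 1)) = inverse l *s geometric l m" for m
    proof -
      have "geometric l m = flip m (l *s geometric l (m + 1))"
        using flip_geometric[OF l, of m] flip_flip[of m "geometric l m"] by simp
      then show ?thesis using l0 by (simp add: flip_scale)
    qed
    have "foldr flip [i, j, k] (geometric l i) = inverse l ^ 3 *s geometric l i"
      using inv[of k] inv[of j] inv[of i] jk unfolding i by (simp add: flip_scale power3_eq_cube)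
    moreover have "inverse l ^ 3 * l ^ 3 = 1" using l0 by (simp add: field_simps)
    ultimately show ?thesis using that by blast
  qed
qed

lemma rho_product:
  "rho (- s) (Gamma_Z2_gen i) \<otimes>\<^bsub>PU21\<^esub> rho (- s) (Gamma_Z2_gen j) \<otimes>\<^bsub>PU21\<^esub> rho (- s) (Gamma_Z2_gen k)
   = PU21_class (word_matrix [i, j, k])"
  unfolding rho_eq[symmetric] rho_gen using triangle_reflection(1)
  by (simp add: rho_def PU21.m_assoc)

lemma word_matrix_eigenvector:
  assumes "foldr flip w a = c *s a"
  shows "word_matrix w *v from_coords a = ((- 1) ^ length w * c) *s from_coords a"
proof -
  have "coords (word_matrix w *v from_coords a) = coords (((- 1) ^ length w * c) *s from_coords a)"
    by (simp add: coords_word coords_from_coords assms coords_scale)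
  then show ?thesis by (metis from_coords_coords)
qed

end

section \<open>Elliptic elements from negative eigenvectors\<close>

lemma Re_herm: "Re (herm v v) = (cmod (v$1))\<^sup>2 + (cmod (v$2))\<^sup>2 - (cmod (v$3))\<^sup>2"
  unfolding herm_def cmod_power2 by (simp add: power2_eq_square)

lemma elliptic_if_eigenvector:
  assumes A: "A \<in> carrier SU21" "A *v v = c *s v" and v: "Re (herm v v) < 0"
  shows "elliptic (PU21_class A)"
proof -
  have v3: "v$3 \<noteq> 0"
  proof
    assume "v$3 = 0"
    then show False using v by (simp add: Re_herm not_le[symmetric])
  qed
  have "c \<noteq> 0"
  proof
    assume "c = 0"
    then have "herm (A *v v) (A *v v) = 0" using A by (simp add: herm_def)
    moreover have "herm (A *v v) (A *v v) = herm v v" using A(1) by (simp add: SU21_def)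
    ultimately show False using v by simp
  qed
  define z where "z = Theta v"
  have lz: "v = v$3 *s lift z" using v3 by (simp add: z_def Theta_def vec_eq_iff forall_3)
  have "herm v v = of_real ((cmod (v$3))\<^sup>2) * herm (lift z) (lift z)"
    by (subst (1 2) lz) (simp add: herm_simps complex_norm_square del: of_real_power)
  then have "(cmod (v$3))\<^sup>2 * Re (herm (lift z) (lift z)) < 0" using v by simp
  then have "z \<in> CH2" unfolding CH2_iff_herm using v3 by (simp add: mult_less_0_iff)
  moreover have "PU21_act (PU21_class A) z = z"
  proof -
    have "v$3 *s (A *v lift z) = A *v v" by (subst (2) lz) (simp add: matrix_vector_scalar)
    also have "\<dots> = v$3 *s (c *s lift z)" unfolding A(2) by (subst (1) lz) (simp add: vec_eq_iff)
    finally have "A *v lift z = c *s lift z" using v3 vec.scale_cancel_left by blast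
    then show ?thesis
      unfolding PU21_act_class[OF A(1)] using \<open>c \<noteq> 0\<close> by (simp add: Theta_def vec_eq_iff forall_2)
  qed
  ultimately show ?thesis unfolding elliptic_def by blast
qed

text \<open>The equation is a cubic in \<open>T\<close>, solved by the intermediate value theorem
  between the square roots of 1/3 and 5/3. The value at the right end is
  \<open>4 * (5 * b - s)\<close>, which is negative precisely because
  \<open>125/3 < s\<^sup>2\<close>.\<close>

lemma elliptic_parameter_aux:
  fixes s :: real
  assumes "125/3 < s\<^sup>2" "0 < s"
  obtains T where "s * (3 * T\<^sup>2 - 1) = T * (5 + 9 * T\<^sup>2)" "1/3 < T\<^sup>2" "T\<^sup>2 < 5/3"
proof -
  define f where "f T = 9 * T ^ 3 - 3 * s * T\<^sup>2 + 5 * T + s" for T :: real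
  define a b :: real where "a = sqrt (1/3)" and "b = sqrt (5/3)"
  have a: "a\<^sup>2 = 1/3" "0 < a" and b: "b\<^sup>2 = 5/3" "0 < b" by (simp_all add: a_def b_def)
  have ab: "a \<le> b" by (simp add: a_def b_def)
  have "f a = 8 * a" using a by (simp add: f_def power3_eq_cube power2_eq_square field_simps)
  have "f b = 4 * (5 * b - s)" using b by (simp add: f_def power3_eq_cube power2_eq_square field_simps)
  moreover have "5 * b < s"
  proof (rule power2_less_imp_less)
    show "(5 * b)\<^sup>2 < s\<^sup>2" using assms(1) by (simp add: power_mult_distrib b)
  qed (use assms in simp)
  ultimately have fb: "f b < 0" by simp
  have fa: "0 < f a" using \<open>f a = 8 * a\<close> a by simp
  have "\<exists>T. a \<le> T \<and> T \<le> b \<and> f T = 0"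
    by (rule IVT2') (use fa fb ab in \<open>auto simp: f_def intro!: continuous_intros\<close>)
  then obtain T where T: "a \<le> T" "T \<le> b" "f T = 0" by blast
  then have T': "a < T" "T < b" using fa fb by (auto simp: less_le)
  have "a\<^sup>2 < T\<^sup>2" using T' a by (intro power_strict_mono) auto
  moreover have "T\<^sup>2 < b\<^sup>2" using T' a by (intro power_strict_mono) auto
  moreover have "s * (3 * T\<^sup>2 - 1) = T * (5 + 9 * T\<^sup>2)"
    using T(3) by (simp add: f_def power3_eq_cube power2_eq_square algebra_simps)
  ultimately show ?thesis using that a b by simp
qed

lemma elliptic_parameter:
  fixes s :: real
  assumes "125/3 < s\<^sup>2"
  obtains T where "s * (3 * T\<^sup>2 - 1) = T * (5 + 9 * T\<^sup>2)" "1/3 < T\<^sup>2" "T\<^sup>2 < 5/3"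
proof (cases "0 < s")
  case True
  then show ?thesis using elliptic_parameter_aux[OF assms] that by blast
next
  case False
  then have "0 < - s" using assms by (cases "s = 0") auto
  then obtain T where "- s * (3 * T\<^sup>2 - 1) = T * (5 + 9 * T\<^sup>2)" "1/3 < T\<^sup>2" "T\<^sup>2 < 5/3"
    using elliptic_parameter_aux[of "- s"] assms by auto
  then show ?thesis using that[of "- T"] by (simp add: algebra_simps)
qed

context ideal_triangle
begin

lemma elliptic_if_large:
  assumes s: "125/3 < s\<^sup>2" and d: "distinct [i, j, k]"
  shows "elliptic (PU21_class (word_matrix [i, j, k]))"
proof -
  obtain T where T: "s * (3 * T\<^sup>2 - 1) = T * (5 + 9 * T\<^sup>2)" and T2: "1/3 < T\<^sup>2" "T\<^sup>2 < 5/3"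
    using elliptic_parameter[OF s] .
  define n where "n = sqrt (1 + T\<^sup>2)"
  \<comment> \<open>Multiplication by \<open>d\<close> clears the denominators of \<open>s\<close>
    and \<open>h\<close> as functions of \<open>T\<close>.\<close>
  define d where "d = 3 * T\<^sup>2 - 1"
  have n: "0 < n" "n\<^sup>2 = 1 + T\<^sup>2" by (simp_all add: n_def add_pos_nonneg)
  have d: "0 < d" using T2 by (simp add: d_def)
  have sd: "s * d = T * (5 + 9 * T\<^sup>2)" using T by (simp add: d_def)
  have hd: "h * d = (1 + 9 * T\<^sup>2) * n"
  proof (rule power2_eq_imp_eq)
    have "(h * d)\<^sup>2 = d\<^sup>2 + (s * d)\<^sup>2" by (simp add: power_mult_distrib h_sq distrib_right)
    also have "\<dots> = (1 + 9 * T\<^sup>2)\<^sup>2 * n\<^sup>2" unfolding n(2) sd unfolding d_def by algebra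
    also have "\<dots> = ((1 + 9 * T\<^sup>2) * n)\<^sup>2" by (simp only: power_mult_distrib)
    finally show "(h * d)\<^sup>2 = ((1 + 9 * T\<^sup>2) * n)\<^sup>2" .
  qed (use h_pos d n in auto)
  \<comment> \<open>With this \<open>t\<close> on the unit circle, \<open>l = xi * t\<close> will be
    a unimodular root of the cubic.\<close>
  define t where "t = Complex 1 (- T) / of_real n"
  define l where "l = xi * t"
  have nt: "of_real n * t = Complex 1 (- T)" using n by (simp add: t_def)
  have dO: "of_real (h * d) * xi ^ 3 = Complex d (s * d)"
  proof -
    have "of_real (h * d) * xi ^ 3 = of_real d * (of_real h * xi ^ 3)" by simp
    also have "\<dots> = Complex d (s * d)" unfolding h_xi by (simp add: complex_eq_iff)
    finally show ?thesis .
  qed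
  have "of_real (h * d) * of_real n ^ 3 * (xi ^ 3 * t ^ 3 - 2 * t\<^sup>2 - 2 * xi ^ 3 * t + 1) = 0"
  proof -
    have "of_real (h * d) * of_real n ^ 3 * (xi ^ 3 * t ^ 3 - 2 * t\<^sup>2 - 2 * xi ^ 3 * t + 1)
      = (of_real (h * d) * xi ^ 3) * (of_real n * t) * ((of_real n * t)\<^sup>2 - 2 * of_real (n\<^sup>2))
        + of_real (h * d) * of_real n * (of_real (n\<^sup>2) - 2 * (of_real n * t)\<^sup>2)"
      by (simp add: power2_eq_square power3_eq_cube algebra_simps)
    also have "of_real (h * d) * of_real n = complex_of_real ((1 + 9 * T\<^sup>2) * n\<^sup>2)"
      unfolding hd by (simp add: power2_eq_square)
    also have "(of_real (h * d) * xi ^ 3) * (of_real n * t) * ((of_real n * t)\<^sup>2 - 2 * of_real (n\<^sup>2))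
        + complex_of_real ((1 + 9 * T\<^sup>2) * n\<^sup>2) * (of_real (n\<^sup>2) - 2 * (of_real n * t)\<^sup>2) = 0"
      unfolding dO nt n(2) sd unfolding d_def
      by (simp add: complex_eq_iff power2_eq_square power3_eq_cube algebra_simps)
    finally show ?thesis .
  qed
  then have t3: "xi ^ 3 * t ^ 3 - 2 * t\<^sup>2 - 2 * xi ^ 3 * t + 1 = 0" using h_pos d n by simp
  have l: "l ^ 3 - 2 * cnj xi ^ 2 * l\<^sup>2 - 2 * xi\<^sup>2 * l + 1 = 0"
    using t3 xi_cnj unfolding l_def by algebra
  have "n * cmod t = cmod (Complex 1 (- T))"
    using arg_cong[OF nt, of cmod] n(1) by (simp add: norm_mult)
  also have "\<dots> = n" by (simp add: cmod_def n_def)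
  finally have "cmod t = 1" using n(1) by simp
  then have tt: "t * cnj t = 1" by (simp add: complex_mult_cnj cmod_def)
  have 1: "Re (xi ^ 3 * t) = (9 * T\<^sup>2 - 1) / (9 * T\<^sup>2 + 1)"
  proof -
    have "of_real (h * d * n) * (xi ^ 3 * t) = (of_real (h * d) * xi ^ 3) * (of_real n * t)"
      by simp
    then have "h * d * n * Re (xi ^ 3 * t) = Re (Complex d (s * d) * Complex 1 (- T))"
      unfolding dO nt by (metis Re_of_real_mult)
    then have "(1 + 9 * T\<^sup>2) * (n * n) * Re (xi ^ 3 * t) = d + s * d * T"
      unfolding hd by (simp add: mult.assoc)
    also have "\<dots> = (9 * T\<^sup>2 - 1) * (n * n)"
      unfolding sd n(2)[unfolded power2_eq_square] unfolding d_def by algebra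
    finally have "(1 + 9 * T\<^sup>2) * Re (xi ^ 3 * t) = 9 * T\<^sup>2 - 1" using n(1) by simp
    moreover have "9 * T\<^sup>2 + 1 \<noteq> 0" using T2 by linarith
    ultimately show ?thesis by (simp add: nonzero_eq_divide_eq mult.commute add.commute del: times_complex.sel)
  qed
  have 2: "Re (t\<^sup>2) = (1 - T\<^sup>2) / (1 + T\<^sup>2)"
  proof -
    have "of_real (n\<^sup>2) * t\<^sup>2 = (of_real n * t)\<^sup>2" by (simp add: power_mult_distrib)
    then have "n\<^sup>2 * Re (t\<^sup>2) = Re ((Complex 1 (- T))\<^sup>2)"
      unfolding nt by (metis Re_of_real_mult)
    also have "\<dots> = 1 - T\<^sup>2" by (simp add: power2_eq_square)
    finally have "(1 + T\<^sup>2) * Re (t\<^sup>2) = 1 - T\<^sup>2" unfolding n(2) .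
    moreover have "1 + T\<^sup>2 \<noteq> 0" using T2 by linarith
    ultimately show ?thesis using nonzero_eq_divide_eq mult.commute by metis
  qed
  have N: "norm_form 1 l (l\<^sup>2) = 3 - 4 * Re (xi ^ 3 * t) - 2 * Re (t\<^sup>2)"
  proof -
    have "complex_of_real (norm_form 1 l (l\<^sup>2)) = 3 - 2 * (xi ^ 3 * t + cnj (xi ^ 3 * t)) - (t\<^sup>2 + cnj (t\<^sup>2))"
      unfolding of_real_norm_form l_def using xi_cnj tt by simp algebra
    then show ?thesis unfolding complex_add_cnj by (simp add: complex_eq_iff)
  qed
  \<comment> \<open>The factors change sign at \<open>T\<^sup>2 = 1/3\<close> and
    \<open>T\<^sup>2 = 5/3\<close>, which is the reason for the range of \<open>T\<close>.\<close>
  also have "\<dots> = (3 * T\<^sup>2 - 1) * (3 * T\<^sup>2 - 5) / ((9 * T\<^sup>2 + 1) * (1 + T\<^sup>2))"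
  proof -
    have "9 * T\<^sup>2 + 1 \<noteq> 0" "1 + T\<^sup>2 \<noteq> 0" using T2 by linarith+
    then show ?thesis unfolding 1 2 by (simp add: field_simps)
  qed
  also have "\<dots> < 0" using T2 by (intro divide_neg_pos mult_pos_neg mult_pos_pos) auto
  finally have neg: "norm_form 1 l (l\<^sup>2) < 0" .
  obtain m c where "foldr flip [i, j, k] (geometric l m) = c *s geometric l m"
    using flips_geometric[OF l \<open>distinct [i, j, k]\<close>] by blast
  then have "word_matrix [i, j, k] *v from_coords (geometric l m) = ((- 1) ^ 3 * c) *s from_coords (geometric l m)"
    using word_matrix_eigenvector[of "[i, j, k]"] by (simp add: numeral_3_eq_3)
  moreover have "null_form (geometric l m) = norm_form 1 l (l\<^sup>2)"
    by (simp add: null_form_index[of _ m] geometric_def index3_neq)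
  then have "Re (herm (from_coords (geometric l m)) (from_coords (geometric l m))) < 0"
    unfolding herm_from_coords using neg h_pos by (simp add: mult_less_0_iff)
  ultimately show ?thesis
    using elliptic_if_eigenvector[OF word_matrix_SU21] by blast
qed

end


section \<open>Roots of unity and their conjugates\<close>

abbreviation cpoly :: "int poly \<Rightarrow> complex poly" where "cpoly \<equiv> map_poly of_int"

lemma cpoly_add: "cpoly (p + q) = cpoly p + cpoly q"
  by (simp add: poly_eq_iff coeff_map_poly)

lemma cpoly_mult: "cpoly (p * q) = cpoly p * cpoly q"
  by (simp add: poly_eq_iff coeff_map_poly coeff_mult)

lemma cpoly_one: "cpoly 1 = 1"
  by (simp add: poly_eq_iff coeff_map_poly)

lemma cpoly_diff: "cpoly (p - q) = cpoly p - cpoly q"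
  by (simp add: poly_eq_iff coeff_map_poly)

lemma cpoly_power: "cpoly (p ^ n) = cpoly p ^ n"
  by (induction n) (simp_all add: cpoly_one cpoly_mult)

lemma cpoly_smult: "cpoly (smult c p) = smult (of_int c) (cpoly p)"
  by (simp add: poly_eq_iff coeff_map_poly)

lemma cpoly_monom: "cpoly (monom c n) = monom (of_int c) n"
  by (simp add: poly_eq_iff coeff_map_poly)

lemma cpoly_const: "cpoly [:c:] = [:of_int c:]"
  by (simp add: poly_eq_iff coeff_map_poly coeff_pCons split: nat.split)

lemma degree_cpoly: "degree (cpoly p) = degree p"
  by (rule degree_map_poly) simp

lemmas cpoly_simps = cpoly_add cpoly_mult cpoly_one cpoly_diff cpoly_power
  cpoly_smult cpoly_monom cpoly_const

section \<open>Divisibility among integer polynomials with a common root\<close>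

lemma prime_factor_with_root:
  fixes p :: "int poly"
  assumes "p \<noteq> 0" "poly (cpoly p) z = 0"
  shows "\<exists>f. prime_elem f \<and> f dvd p \<and> poly (cpoly f) z = 0"
  using assms
proof (induction p rule: prime_divisors_induct)
  case (unit p)
  then obtain q where "1 = p * q" by (auto simp: dvd_def)
  then have "poly (cpoly p) z * poly (cpoly q) z = 1"
    by (metis cpoly_mult cpoly_one poly_mult poly_1)
  then show ?case using unit by simp
next
  case (factor f p)
  then have "p \<noteq> 0" "poly (cpoly f) z = 0 \<or> poly (cpoly p) z = 0"
    by (auto simp: cpoly_mult)
  then show ?case using factor by (auto intro: dvd_mult)
qed simp

lemma prime_elem_dvd_if_common_root:
  fixes f p :: "int poly"
  assumes f: "prime_elem f" "poly (cpoly f) z = 0" and p: "poly (cpoly p) z = 0"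
  shows "f dvd p"
proof -
  have f0: "f \<noteq> 0" using f(1) by (simp add: prime_elem_def)
  define S where "S = {q :: int poly. q \<noteq> 0 \<and> poly (cpoly q) z = 0}"
  have "f \<in> S" using f f0 by (simp add: S_def)
  define m where "m = (LEAST n. n \<in> degree ` S)"
  have "m \<in> degree ` S" unfolding m_def by (rule LeastI[of _ "degree f"]) (use \<open>f \<in> S\<close> in simp)
  then obtain q where q: "q \<in> S" "degree q = m" by auto
  have min: "r \<notin> S" if "degree r < degree q" for r
  proof
    assume "r \<in> S"
    then have "degree r \<in> degree ` S" by (rule imageI)
    then have "m \<le> degree r" unfolding m_def by (rule Least_le)
    then show False using that q(2) by simp
  qed
  from q have q0: "q \<noteq> 0" "poly (cpoly q) z = 0" by (auto simp: S_def)
  have dvd: "\<exists>c. c \<noteq> 0 \<and> q dvd smult c r" if r: "poly (cpoly r) z = 0" for r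
  proof -
    obtain c k where c: "c \<noteq> 0" "smult c r = q * k + pseudo_mod r q"
      using pseudo_mod(1)[OF q0(1)] by blast
    have "poly (cpoly (smult c r)) z = poly (cpoly (pseudo_mod r q)) z"
      unfolding c(2) by (simp add: cpoly_add cpoly_mult q0)
    then have "poly (cpoly (pseudo_mod r q)) z = 0" using r by (simp add: cpoly_smult)
    then have "pseudo_mod r q = 0"
      using pseudo_mod(2)[OF q0(1), of r] min[of "pseudo_mod r q"] by (auto simp: S_def)
    then have "q dvd smult c r" using c(2) by simp
    then show ?thesis using c(1) by blast
  qed
  have nconst: "\<not> f dvd [:c:]" if "c \<noteq> 0" for c
  proof
    assume "f dvd [:c:]"
    then obtain g where g: "[:c:] = f * g" by (auto simp: dvd_def)
    have "poly (cpoly [:c:]) z = 0" unfolding g by (simp add: cpoly_mult f)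
    then show False using that by (simp add: cpoly_const)
  qed
  have "f dvd q"
  proof -
    obtain c k where c: "c \<noteq> 0" "smult c f = q * k" using dvd[OF f(2)] by (auto simp: dvd_def)
    have "f dvd q * k" unfolding c(2)[symmetric] by (rule dvd_smult) simp
    then consider "f dvd q" | "f dvd k" using f(1) prime_elem_dvd_mult_iff by blast
    then show ?thesis
    proof cases
      \<comment> \<open>Cancelling \<open>f\<close> would make \<open>q\<close> a divisor of a
        nonzero constant, although \<open>q\<close> vanishes at \<open>z\<close>.\<close>
      case 2
      then obtain l where "k = f * l" by (auto simp: dvd_def)
      then have "f * [:c:] = f * (q * l)" using c(2) by (simp add: algebra_simps)
      then have "[:c:] = q * l" by (rule mult_left_cancel[OF f0, THEN iffD1])
      then have "poly (cpoly [:c:]) z = 0" by (simp add: cpoly_mult q0)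
      then show ?thesis using c(1) by (simp add: cpoly_const)
    qed
  qed
  obtain c where c: "c \<noteq> 0" "q dvd smult c p" using dvd[OF p] by blast
  then have "f dvd [:c:] * p" using \<open>f dvd q\<close> by (simp add: dvd_trans)
  then show ?thesis using nconst[OF c(1)] f(1) prime_elem_dvd_mult_iff by blast
qed

text \<open>The relation ``every integer polynomial vanishing at \<open>z\<close> vanishes at \<open>w\<close>'' plays the role of
  Galois conjugacy.\<close>

definition conjugate_to :: "complex \<Rightarrow> complex \<Rightarrow> bool" where
  "conjugate_to z w \<longleftrightarrow> (\<forall>p. poly (cpoly p) z = 0 \<longrightarrow> poly (cpoly p) w = 0)"

text \<open>A prime factor of \<open>X ^ n - 1\<close> that vanishes at \<open>z\<close>, with its
  sign changed if necessary to make it monic.\<close>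

lemma root_of_unity_min_poly:
  assumes n: "n > 0" and z: "z ^ n = 1"
  obtains f :: "int poly" where "lead_coeff f = 1" "poly (cpoly f) z = 0"
    "card {w. poly (cpoly f) w = 0} = degree f"
    "\<And>w. poly (cpoly f) w = 0 \<Longrightarrow> conjugate_to z w"
proof -
  define u :: "int poly" where "u = monom 1 n - 1"
  have u_root: "poly (cpoly u) w = w ^ n - 1" for w
    by (simp add: u_def cpoly_simps poly_monom)
  have deg: "degree u = n"
    using n degree_add_eq_left[of "- 1 :: int poly" "monom 1 n"] by (simp add: u_def degree_monom_eq)
  then have "u \<noteq> 0" using n by auto
  then obtain g where g: "prime_elem g" "g dvd u" "poly (cpoly g) z = 0"
    using prime_factor_with_root[of u z] u_root z by auto
  have "lead_coeff u = 1" using n unfolding deg by (simp add: u_def)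
  then have "lead_coeff g dvd 1" using g(2) lead_coeff_mult by (metis dvdE dvd_triv_left)
  then have "lead_coeff g = 1 \<or> lead_coeff g = - 1" unfolding zdvd1_eq by arith
  define f where "f = smult (lead_coeff g) g"
  have f: "lead_coeff f = 1" "poly (cpoly f) w = 0 \<longleftrightarrow> poly (cpoly g) w = 0" for w
    using \<open>lead_coeff g = 1 \<or> lead_coeff g = - 1\<close> by (auto simp: f_def cpoly_smult)
  have "f dvd u"
    using \<open>lead_coeff g = 1 \<or> lead_coeff g = - 1\<close> g(2) by (auto simp: f_def)
  then obtain k where k: "u = f * k" by (auto simp: dvd_def)
  \<comment> \<open>A double root would be one of \<open>X ^ n - 1\<close>, but the derivative of
    that polynomial vanishes only at zero.\<close>
  have "rsquarefree (cpoly f)"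
    unfolding rsquarefree_roots
  proof (intro allI notI, elim conjE)
    fix w assume w: "poly (cpoly f) w = 0" "poly (pderiv (cpoly f)) w = 0"
    have "poly (pderiv (cpoly u)) w = 0"
      unfolding k cpoly_mult pderiv_mult using w by simp
    moreover have "pderiv (cpoly u) = monom (of_nat n) (n - 1)"
      by (simp add: u_def cpoly_simps pderiv_diff pderiv_monom)
    ultimately have "w = 0" using n by (simp add: poly_monom)
    moreover have "w ^ n = 1" using u_root[of w] w(1) unfolding k cpoly_mult by simp
    ultimately show False using n by (simp add: zero_power)
  qed
  from complex_poly_decompose_rsquarefree[OF this]
  have "degree (cpoly f) = degree (smult (lead_coeff (cpoly f)) (\<Prod>w | poly (cpoly f) w = 0. [:- w, 1:]))"
    by simp
  also have "\<dots> = card {w. poly (cpoly f) w = 0}"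
  proof -
    have "cpoly f \<noteq> 0" using f(1) degree_cpoly by (metis \<open>rsquarefree (cpoly f)\<close> rsquarefree_def)
    then show ?thesis by (simp add: degree_prod_eq_sum_degree)
  qed
  finally have card: "card {w. poly (cpoly f) w = 0} = degree f" by (simp add: degree_cpoly)
  show thesis
  proof (rule that[OF f(1) _ card])
    show "poly (cpoly f) z = 0" using f(2) g(3) by simp
    show "conjugate_to z w" if w: "poly (cpoly f) w = 0" for w
      unfolding conjugate_to_def
    proof (intro allI impI)
      fix p assume "poly (cpoly p) z = 0"
      then have "g dvd p" by (rule prime_elem_dvd_if_common_root[OF g(1,3)])
      then obtain l where "p = g * l" by (auto simp: dvd_def)
      then show "poly (cpoly p) w = 0" using w f(2) by (simp add: cpoly_mult)
    qed
  qed
qed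

section \<open>Interpolation and integrality\<close>

lemma Lagrange_interpolation_unique:
  fixes p :: "complex poly"
  assumes Z: "finite Z" "degree p < card Z"
  shows "p = (\<Sum>w\<in>Z. smult (poly p w) (\<Prod>v\<in>Z - {w}. smult (inverse (w - v)) [:- v, 1:]))" (is "p = ?q")
proof -
  let ?L = "\<lambda>w. \<Prod>v\<in>Z - {w}. smult (inverse (w - v)) [:- v, 1:]"
  have L: "poly (?L w) x = (if x = w then 1 else 0)" if w: "w \<in> Z" "x \<in> Z" for w x
  proof -
    have "poly (?L w) x = (\<Prod>v\<in>Z - {w}. (x - v) / (w - v))"
    proof -
      have "poly [:- v, 1:] x = x - v" for v by simp
      then show ?thesis by (simp only: poly_prod poly_smult divide_inverse mult.commute)
    qed
    also have "\<dots> = (if x = w then 1 else 0)"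
    proof (cases "x = w")
      case True
      have "(\<Prod>v\<in>Z - {w}. (w - v) / (w - v)) = 1" by (rule prod.neutral) auto
      then show ?thesis using True by simp
    next
      case False
      then show ?thesis using w Z(1) by (auto simp: prod_zero_iff)
    qed
    finally show ?thesis .
  qed
  have root: "poly (p - ?q) x = 0" if "x \<in> Z" for x
  proof -
    have "poly ?q x = (\<Sum>w\<in>Z. if x = w then poly p w else 0)"
      unfolding poly_sum poly_smult using L that by (intro sum.cong) auto
    then show ?thesis using that Z(1) by simp
  qed
  have "degree (?L w) \<le> card Z - 1" if "w \<in> Z" for w
  proof -
    have "degree (?L w) \<le> (\<Sum>v\<in>Z - {w}. degree (smult (inverse (w - v)) [:- v, 1:]))"
      using degree_prod_sum_le[of "Z - {w}" "\<lambda>v. smult (inverse (w - v)) [:- v, 1:]"] Z by (simp add: o_def)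
    also have "\<dots> \<le> (\<Sum>v\<in>Z - {w}. 1)" by (intro sum_mono) (simp add: degree_smult_le[THEN order_trans])
    finally show ?thesis using that Z by simp
  qed
  then have "degree ?q \<le> card Z - 1"
    by (intro degree_sum_le[OF Z(1)]) (meson degree_smult_le order_trans)
  then have "degree (p - ?q) < card Z" using Z(2) by (intro degree_diff_less) auto
  have "p - ?q = 0"
  proof (rule ccontr)
    assume nz: "p - ?q \<noteq> 0"
    have "card Z \<le> card {x. poly (p - ?q) x = 0}"
      using root poly_roots_finite[OF nz] by (intro card_mono) auto
    also have "\<dots> \<le> degree (p - ?q)" by (rule card_poly_roots_bound[OF nz])
    finally show False using \<open>degree (p - ?q) < card Z\<close> by simp
  qed
  then show ?thesis by simp
qed

text \<open>The powers \<open>p ^ j\<close> reduced modulo the minimal polynomial have integer coefficients, which tend to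
  zero because they are interpolated from the values at the conjugates.\<close>

lemma vanishes_if_conjugates_small:
  assumes n: "n > 0" and z: "z ^ n = 1"
    and small: "\<And>w. conjugate_to z w \<Longrightarrow> cmod (poly (cpoly p) w) < 1"
  shows "poly (cpoly p) z = 0"
proof -
  obtain f :: "int poly" where f: "lead_coeff f = 1" "poly (cpoly f) z = 0"
    and card: "card {w. poly (cpoly f) w = 0} = degree f"
    and conj: "\<And>w. poly (cpoly f) w = 0 \<Longrightarrow> conjugate_to z w"
    using root_of_unity_min_poly[OF n z] by blast
  define Z where "Z = {w. poly (cpoly f) w = 0}"
  have f0: "f \<noteq> 0" using f by auto
  then have "cpoly f \<noteq> 0" by (metis degree_cpoly degree_eq_zeroE f cpoly_const degree_0 lead_coeff_pCons(2) of_int_1 pCons_eq_0_iff one_neq_zero coeff_pCons_0)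
  then have Z: "finite Z" unfolding Z_def by (rule poly_roots_finite)
  define r where "r j = pseudo_mod (p ^ j) f" for j
  have rval: "poly (cpoly (r j)) w = poly (cpoly p) w ^ j" if "w \<in> Z" for w j
  proof -
    \<comment> \<open>The multiplier of the pseudo-division is a power of the leading coefficient 1,
      so this is an honest division.\<close>
    obtain k where "smult (lead_coeff f ^ (Suc (degree (p ^ j)) - degree f)) (p ^ j) = f * k + r j"
      using pseudo_divmod(1)[OF f0, of "p ^ j"] unfolding r_def pseudo_mod_def
      by (metis prod.collapse)
    then have "p ^ j = f * k + r j" by (simp add: f)
    then have "cpoly p ^ j = cpoly f * cpoly k + cpoly (r j)"
      by (metis cpoly_power cpoly_add cpoly_mult)
    then have "poly (cpoly p ^ j) w = poly (cpoly f * cpoly k + cpoly (r j)) w" by simp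
    then show ?thesis using that by (simp add: Z_def poly_power)
  qed
  have "degree f \<noteq> 0"
    using f by (metis degree_eq_zeroE lead_coeff_pCons(2) coeff_pCons_0 cpoly_const of_int_1 poly_const_conv one_neq_zero degree_pCons_0)
  then have rdeg: "degree (r j) < card Z" for j
    using pseudo_mod(2)[OF f0, of "p ^ j"] unfolding r_def card[folded Z_def] by auto
  define L where "L w = (\<Prod>v\<in>Z - {w}. smult (inverse (w - v)) [:- v, 1:])" for w
  have coeff: "of_int (coeff (r j) i) = (\<Sum>w\<in>Z. poly (cpoly p) w ^ j * coeff (L w) i)" for i j
  proof -
    have "cpoly (r j) = (\<Sum>w\<in>Z. smult (poly (cpoly p) w ^ j) (L w))"
      using Lagrange_interpolation_unique[OF Z, of "cpoly (r j)"] rdeg[of j] rval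
      unfolding L_def by (simp add: degree_cpoly cong: sum.cong)
    then have "coeff (cpoly (r j)) i = coeff (\<Sum>w\<in>Z. smult (poly (cpoly p) w ^ j) (L w)) i" by simp
    then show ?thesis by (simp add: coeff_map_poly coeff_sum)
  qed
  have ev: "\<forall>\<^sub>F j in sequentially. coeff (r j) i = 0" for i
  proof -
    have "(\<lambda>j. poly (cpoly p) w ^ j) \<longlonglongrightarrow> 0" if "w \<in> Z" for w
      using small[OF conj] that by (intro LIMSEQ_power_zero) (simp add: Z_def)
    then have "(\<lambda>j. \<Sum>w\<in>Z. poly (cpoly p) w ^ j * coeff (L w) i) \<longlonglongrightarrow> (\<Sum>w\<in>Z. 0 * coeff (L w) i)"
      by (intro tendsto_sum tendsto_mult_right) 
    then have "(\<lambda>j. of_int (coeff (r j) i) :: complex) \<longlonglongrightarrow> 0" by (simp add: coeff)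
    \<comment> \<open>An integer of absolute value less than 1 is zero.\<close>
    from tendstoD[OF this, of 1]
    have "\<forall>\<^sub>F j in sequentially. real_of_int \<bar>coeff (r j) i\<bar> < 1"
      by simp
    then show ?thesis by (rule eventually_mono) (simp only: of_int_less_1_iff zabs_less_one_iff)
  qed
  have "\<forall>\<^sub>F j in sequentially. \<forall>i\<in>{..<card Z}. coeff (r j) i = 0"
    using ev by (simp add: eventually_ball_finite_distrib)
  then obtain j where j: "\<forall>i\<in>{..<card Z}. coeff (r j) i = 0"
    using eventually_happens'[OF sequentially_bot] by blast
  have "r j = 0"
  proof (rule poly_eqI)
    show "coeff (r j) i = coeff 0 i" for i
      using j rdeg[of j] coeff_eq_0[of "r j" i] by (cases "i < card Z") auto
  qed
  moreover have "z \<in> Z" using f by (simp add: Z_def)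
  ultimately have "poly (cpoly p) z ^ j = 0" using rval[of z j] by simp
  then show ?thesis by simp
qed

text \<open>The upper bound rests on \<open>16 + e\<^sup>3 + cnj e\<^sup>3 = 1 - |d|\<^sup>2\<close> with \<open>d = 1 - l1\<^sup>3 - cnj l2\<^sup>3\<close>, the lower bound
  on \<open>|e| = 2\<close>.\<close>

lemma unit_triple_bound:
  assumes u: "l1 * cnj l1 = 1" "l2 * cnj l2 = 1" "l3 * cnj l3 = 1" and p: "l1 * l2 * l3 = - 1"
    and e: "e = l1 + l2 + l3" "e * cnj e = 4"
  shows "cmod (16 + e ^ 3 + cnj e ^ 3) < 1"
proof -
  define d where "d = 1 - l1 ^ 3 - cnj l2 ^ 3"
  have "l1 * l2 + l1 * l3 + l2 * l3 = - cnj e"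
    using u p unfolding e(1) by simp algebra
  have cube: "l1 ^ 3 + l2 ^ 3 + l3 ^ 3 = e ^ 3 + 9"
    using \<open>l1 * l2 + l1 * l3 + l2 * l3 = - cnj e\<close> p e by algebra
  define x y where "x = l1 ^ 3" and "y = l2 ^ 3"
  have xy: "x * cnj x = 1" "y * cnj y = 1"
    using u by (simp_all add: x_def y_def flip: power_mult_distrib)
  have "l3 = - (cnj l1 * cnj l2)" using u p by algebra
  then have l3: "l3 ^ 3 = - (cnj x * cnj y)" by (simp add: x_def y_def power3_eq_cube algebra_simps)
  have e3: "e ^ 3 = x + y - cnj x * cnj y - 9" using cube l3 by (simp add: x_def y_def)
  have "cnj e ^ 3 = cnj (e ^ 3)" by simp
  then have e3': "cnj e ^ 3 = cnj x + cnj y - x * y - 9" unfolding e3 by simp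
  have d': "d = 1 - x - cnj y" by (simp add: d_def x_def y_def)
  have d: "16 + e ^ 3 + cnj e ^ 3 = 1 - d * cnj d"
    unfolding e3 e3' d' using xy by simp algebra
  have "(cmod e)\<^sup>2 = 2\<^sup>2"
    using e(2) unfolding complex_norm_square[symmetric]
    by (metis of_real_eq_iff of_real_numeral four_x_squared mult.right_neutral power_one numeral_Bit0_eq_double mult_2 power2_eq_square)
  then have "cmod e = 2" by (rule power2_eq_imp_eq) simp_all
  then have e8: "cmod (e ^ 3) = 8" by (simp add: norm_power)
  then have "- 8 \<le> Re (e ^ 3)" using abs_Re_le_cmod[of "e ^ 3"] by simp
  then have ge: "0 \<le> 16 + 2 * Re (e ^ 3)" by simp
  have "e ^ 3 + cnj e ^ 3 = of_real (2 * Re (e ^ 3))"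
    using complex_add_cnj[of "e ^ 3"] by simp
  then have eq: "16 + e ^ 3 + cnj e ^ 3 = of_real (16 + 2 * Re (e ^ 3))"
    by (simp add: add.assoc)
  have "16 + 2 * Re (e ^ 3) = 1 - (cmod d)\<^sup>2"
    using d unfolding eq complex_norm_square[symmetric] by (metis of_real_1 of_real_diff of_real_eq_iff)
  \<comment> \<open>If \<open>d\<close> were zero, \<open>e ^ 3 = 3 * x - 9\<close> with
    \<open>x + cnj x = 1\<close> would have squared modulus 63 instead of 64.\<close>
  moreover have "d \<noteq> 0"
  proof
    assume "d = 0"
    then have 1: "x + cnj y = 1" by (simp add: d_def x_def y_def algebra_simps)
    then have 2: "cnj x + y = 1" by (metis complex_cnj_add complex_cnj_cnj complex_cnj_one)
    have "e ^ 3 * cnj (e ^ 3) = 63"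
    proof -
      have y: "y = 1 - cnj x" "cnj y = 1 - x" using 1 2 by algebra+
      have r: "x + cnj x = 1" using xy unfolding y by (simp add: algebra_simps)
      have "e ^ 3 = 3 * x - 9" unfolding e3 y complex_cnj_diff complex_cnj_one complex_cnj_cnj using r xy(1) by algebra
      then have "cnj (e ^ 3) = 3 * cnj x - 9" by simp
      with \<open>e ^ 3 = 3 * x - 9\<close> show ?thesis using r xy(1) by algebra
    qed
    then show False
      unfolding complex_norm_square[symmetric] e8 by simp
  qed
  ultimately have "16 + 2 * Re (e ^ 3) < 1" by simp
  then show ?thesis unfolding eq norm_of_real using ge by simp
qed

text \<open>All three numbers are powers of one root of unity \<open>z\<close>, and conjugation of
  an \<open>n\<close>-th root of unity is the power \<open>n - 1\<close>. Hence the hypotheses are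
  integer polynomial relations at \<open>z\<close>; they pass to every conjugate, where
  \<open>unit_triple_bound\<close> supplies the smallness.\<close>

lemma roots_of_unity_triple:
  assumes n: "n > 0" and l: "l1 ^ n = 1" "l2 ^ n = 1" "l3 ^ n = 1" and p: "l1 * l2 * l3 = - 1"
    and e: "e = l1 + l2 + l3" "e * cnj e = 4"
  shows "16 + e ^ 3 + cnj e ^ 3 = 0"
proof -
  define z where "z = cis (2 * pi / real n)"
  have zn: "z ^ n = 1" unfolding z_def Complex.DeMoivre using n by simp
  have ex: "\<exists>a. x = z ^ a" if "x ^ n = 1" for x
  proof -
    have "x \<in> (\<lambda>k. cis (2 * pi * real k / real n)) ` {..<n}"
      using bij_betw_imp_surj_on[OF Complex.bij_betw_roots_unity[OF n]] that by blast
    then obtain k where "x = cis (2 * pi * real k / real n)" by blast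
    then have "x = z ^ k" by (simp add: z_def Complex.DeMoivre mult.commute)
    then show ?thesis by blast
  qed
  obtain a b c where abc: "l1 = z ^ a" "l2 = z ^ b" "l3 = z ^ c" using ex l by metis
  define S S' :: "int poly" where "S = monom 1 a + monom 1 b + monom 1 c"
    and "S' = monom 1 (a * (n - 1)) + monom 1 (b * (n - 1)) + monom 1 (c * (n - 1))"
  define R where "R = [:16:] + S ^ 3 + S' ^ 3"
  have unit: "x * cnj x = 1" "x ^ (k * (n - 1)) = cnj x ^ k" if "x ^ n = 1" for x :: complex and k
  proof -
    have "cmod x ^ n = 1 ^ n" using that by (metis norm_power norm_one power_one)
    then have "cmod x = 1" using power_eq_imp_eq_base[of "cmod x" n 1] n by simp
    then show x: "x * cnj x = 1" by (simp add: complex_norm_square[symmetric])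
    have "x * x ^ (n - 1) = x * cnj x" using that n x by (metis power_eq_if not_gr_zero)
    then have "x ^ (n - 1) = cnj x" using x by (metis mult_cancel_left mult_zero_left zero_neq_one)
    then show "x ^ (k * (n - 1)) = cnj x ^ k" by (metis power_mult mult.commute)
  qed
  have S: "poly (cpoly S) x = x ^ a + x ^ b + x ^ c"
    and S': "x ^ n = 1 \<Longrightarrow> poly (cpoly S') x = cnj (x ^ a + x ^ b + x ^ c)" for x
    by (simp_all add: S_def S'_def cpoly_simps poly_monom unit(2) del: One_nat_def)
  have R: "poly (cpoly R) x = 16 + (x ^ a + x ^ b + x ^ c) ^ 3 + cnj (x ^ a + x ^ b + x ^ c) ^ 3"
    if "x ^ n = 1" for x
    using S S'[OF that] by (simp add: R_def cpoly_simps)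
  have "poly (cpoly R) z = 0"
  proof (rule vanishes_if_conjugates_small[OF n zn])
    fix w assume w: "conjugate_to z w"
    have "poly (cpoly (monom 1 n - 1)) z = 0" by (simp add: cpoly_simps poly_monom zn)
    then have "poly (cpoly (monom 1 n - 1)) w = 0" using w unfolding conjugate_to_def by blast
    then have wn: "w ^ n = 1" by (simp add: cpoly_simps poly_monom)
    have "poly (cpoly (monom 1 (a + b + c) + 1)) z = 0"
      using p abc by (simp add: cpoly_simps poly_monom power_add)
    then have "poly (cpoly (monom 1 (a + b + c) + 1)) w = 0" using w unfolding conjugate_to_def by blast
    then have "w ^ a * w ^ b * w ^ c + 1 = 0"
      by (simp add: cpoly_simps poly_monom power_add)
    then have wp: "w ^ a * w ^ b * w ^ c = - 1" by (simp only: eq_neg_iff_add_eq_0)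
    have "poly (cpoly (S * S' - [:4:])) z = 0"
      using e abc S[of z] S'[OF zn] by (simp add: cpoly_simps)
    then have "poly (cpoly (S * S' - [:4:])) w = 0" using w unfolding conjugate_to_def by blast
    then have we: "(w ^ a + w ^ b + w ^ c) * cnj (w ^ a + w ^ b + w ^ c) = 4"
      using S[of w] S'[OF wn] by (simp add: cpoly_simps)
    have "w ^ k * cnj (w ^ k) = 1" for k
      using unit(1)[OF wn] by (simp flip: power_mult_distrib)
    from unit_triple_bound[OF this this this wp refl we]
    show "cmod (poly (cpoly R) w) < 1" by (simp add: R[OF wn])
  qed
  then show ?thesis using R[OF zn] e(1) abc by simp
qed


section \<open>Elliptic elements of discrete groups\<close>

definition matrix_power :: "complex^3^3 \<Rightarrow> nat \<Rightarrow> complex^3^3" where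
  "matrix_power A m = ((**) A ^^ m) (mat 1)"

lemma matrix_power_simps: "matrix_power A 0 = mat 1" "matrix_power A (Suc m) = A ** matrix_power A m"
  by (simp_all add: matrix_power_def)

lemma matrix_power_add: "matrix_power A (m + n) = matrix_power A m ** matrix_power A n"
  by (induction m) (simp_all add: matrix_power_simps matrix_mul_assoc)

lemma matrix_power_SU21: "A \<in> carrier SU21 \<Longrightarrow> matrix_power A m \<in> carrier SU21"
proof (induction m)
  case 0
  then show ?case by (simp add: matrix_power_simps SU21_mat_1)
next
  case (Suc m)
  then show ?case using SU21.m_closed[of A "matrix_power A m"]
    by (simp add: matrix_power_simps SU21_def)
qed

lemma matrix_power_eigenvector:
  assumes "A *v u = c *s u"
  shows "matrix_power A m *v u = c ^ m *s u"
proof (induction m)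
  case (Suc m)
  have "matrix_power A (Suc m) *v u = A *v (matrix_power A m *v u)"
    by (simp add: matrix_power_simps matrix_vector_mul_assoc)
  then show ?case unfolding Suc matrix_vector_scalar assms by (simp add: vec_eq_iff)
qed (simp add: matrix_power_simps)

section \<open>Positive definite forms invariant under elliptic elements\<close>

lemma norm_vec3: "(norm v)\<^sup>2 = (cmod (v$1))\<^sup>2 + (cmod (v$2))\<^sup>2 + (cmod (v$3))\<^sup>2" for v :: "complex^3"
  by (simp add: norm_vec_def L2_set_def sum_3)

text \<open>For a negative vector \<open>u\<close>, changing the sign of the form on the line spanned by \<open>u\<close> gives a
  positive definite form, which is invariant under every isometry that fixes this line.\<close>

definition positive_form :: "complex^3 \<Rightarrow> complex^3 \<Rightarrow> real" where
  "positive_form u v = Re (herm v v) - 2 * (cmod (herm v u))\<^sup>2 / Re (herm u u)"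

lemma positive_form_invariant:
  assumes B: "B \<in> carrier SU21" "B *v u = c *s u" and u: "Re (herm u u) \<noteq> 0"
  shows "positive_form u (B *v v) = positive_form u v"
proof -
  have pres: "herm (B *v x) (B *v y) = herm x y" for x y using B(1) by (simp add: SU21_def)
  have "herm u u = c * cnj c * herm u u"
    using pres[of u u] unfolding B(2) by (simp only: herm_simps mult_ac)
  moreover have "herm u u \<noteq> 0" using u by auto
  ultimately have "c * cnj c = 1" by simp
  then have "(cmod c)\<^sup>2 = 1" by (metis complex_norm_square of_real_eq_1_iff)
  have "cnj c * herm (B *v v) u = herm v u"
    using pres[of v u] unfolding B(2) by (simp add: herm_simps)
  then have "(cmod (herm v u))\<^sup>2 = (cmod c)\<^sup>2 * (cmod (herm (B *v v) u))\<^sup>2"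
    by (metis norm_mult complex_mod_cnj power_mult_distrib)
  then show ?thesis unfolding positive_form_def using \<open>(cmod c)\<^sup>2 = 1\<close> by (simp add: pres)
qed

text \<open>By Cauchy-Schwarz the third coordinate of \<open>w\<close> is dominated by the other
  two, so the form is positive on the complement of \<open>u\<close>, with an explicit lower
  bound.\<close>

lemma herm_orthogonal_negative:
  assumes u: "Re (herm u u) < 0" and w: "herm w u = 0"
  shows "- Re (herm u u) * (norm w)\<^sup>2 \<le> 2 * (cmod (u$3))\<^sup>2 * Re (herm w w)"
proof -
  define a b c d where "a = (cmod (u$1))\<^sup>2 + (cmod (u$2))\<^sup>2" and "b = (cmod (u$3))\<^sup>2"
    and "c = (cmod (w$1))\<^sup>2 + (cmod (w$2))\<^sup>2" and "d = (cmod (w$3))\<^sup>2"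
  have nn: "0 \<le> a" "0 \<le> c" "0 \<le> d" by (simp_all add: a_def c_def d_def)
  have ab: "a < b" using u by (simp add: Re_herm a_def b_def)
  have "w$3 * cnj (u$3) = w$1 * cnj (u$1) + w$2 * cnj (u$2)" using w by (simp add: herm_def)
  then have "cmod (w$3) * cmod (u$3) \<le> cmod (w$1) * cmod (u$1) + cmod (w$2) * cmod (u$2)"
    by (metis norm_mult complex_mod_cnj norm_triangle_ineq)
  then have "(cmod (w$3) * cmod (u$3))\<^sup>2 \<le> (cmod (w$1) * cmod (u$1) + cmod (w$2) * cmod (u$2))\<^sup>2"
    by (intro power_mono) auto
  also have "\<dots> \<le> c * a"
  proof -
    have "c * a - (cmod (w$1) * cmod (u$1) + cmod (w$2) * cmod (u$2))\<^sup>2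
      = (cmod (w$1) * cmod (u$2) - cmod (w$2) * cmod (u$1))\<^sup>2"
      unfolding a_def c_def by algebra
    then show ?thesis by (metis diff_ge_0_iff_ge zero_le_power2)
  qed
  finally have db: "d * b \<le> c * a" by (simp add: d_def b_def power_mult_distrib)
  have b: "0 < b" using ab nn by linarith
  have "d * b \<le> c * b" using db mult_left_mono[of a b c] ab nn by linarith
  then have "d \<le> c" using b by simp
  have "(b - a) * (c + d) \<le> (b - a) * (2 * c)" using \<open>d \<le> c\<close> ab by (intro mult_left_mono) auto
  also have "\<dots> = 2 * (b * c - c * a)" by (simp add: algebra_simps)
  also have "\<dots> \<le> 2 * (b * c - d * b)" using db by simp
  finally show ?thesis
    unfolding Re_herm norm_vec3 using a_def b_def c_def d_def by (simp add: algebra_simps)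
qed

text \<open>Split \<open>v\<close> orthogonally into a multiple of \<open>u\<close> and a vector
  \<open>w\<close>; the two summands of the form bound these parts separately.\<close>

lemma positive_form_bound:
  assumes u: "Re (herm u u) < 0"
  obtains K where "\<And>v. (norm v)\<^sup>2 \<le> K * positive_form u v"
proof -
  define r where "r = - Re (herm u u)"
  have r: "0 < r" using u by (simp add: r_def)
  have huu: "herm u u = of_real (- r)" using cnj_herm[of u u] by (simp add: complex_eq_iff r_def)
  define K where "K = 2 * (norm u)\<^sup>2 / r + 4 * (cmod (u$3))\<^sup>2 / r"
  have "(norm v)\<^sup>2 \<le> K * positive_form u v" for v
  proof -
    define al where "al = - herm v u / of_real r"
    define w where "w = v - al *s u"
    have wu: "herm w u = 0" using r by (simp add: w_def herm_simps huu al_def)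
    then have uw: "herm u w = 0" using cnj_herm[of w u] by (metis complex_cnj_zero)
    have v: "v = al *s u + w" by (simp add: w_def)
    have hvu: "herm v u = - of_real r * al" using r by (simp add: al_def)
    have "herm v v = - of_real r * (al * cnj al) + herm w w"
      by (subst (1 2) v) (simp add: herm_simps wu uw huu)
    then have "Re (herm v v) = - r * (cmod al)\<^sup>2 + Re (herm w w)"
      unfolding complex_norm_square[symmetric] by simp
    moreover have "(cmod (herm v u))\<^sup>2 = r * r * (cmod al)\<^sup>2"
      unfolding hvu by (simp add: norm_mult power_mult_distrib power2_eq_square)
    ultimately have pf: "positive_form u v = r * (cmod al)\<^sup>2 + Re (herm w w)"
      unfolding positive_form_def r_def[symmetric] using r by (simp add: r_def[symmetric] huu)
    have "r * (norm w)\<^sup>2 \<le> 2 * (cmod (u$3))\<^sup>2 * Re (herm w w)"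
      using herm_orthogonal_negative[OF u wu] by (simp add: r_def)
    then have w2: "(norm w)\<^sup>2 \<le> 2 * (cmod (u$3))\<^sup>2 / r * Re (herm w w)"
      using r by (simp add: field_simps)
    have hw: "0 \<le> Re (herm w w)"
    proof -
      have "0 \<le> (cmod (u$1))\<^sup>2 + (cmod (u$2))\<^sup>2" by simp
      then have "u$3 \<noteq> 0" using u unfolding Re_herm by (metis diff_zero norm_zero not_less zero_power2)
      then have "0 < 2 * (cmod (u$3))\<^sup>2" by simp
      moreover have "0 \<le> 2 * (cmod (u$3))\<^sup>2 * Re (herm w w)"
        using \<open>r * (norm w)\<^sup>2 \<le> 2 * (cmod (u$3))\<^sup>2 * Re (herm w w)\<close> r
        by (meson less_imp_le mult_nonneg_nonneg order_trans zero_le_power2)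
      ultimately show ?thesis by (simp add: zero_le_mult_iff)
    qed
    have "norm v \<le> cmod al * norm u + norm w"
    proof -
      have "norm (al *s u) = cmod al * norm u"
      proof (rule power2_eq_imp_eq)
        show "(norm (al *s u))\<^sup>2 = (cmod al * norm u)\<^sup>2"
          by (simp add: norm_vec3 norm_mult power_mult_distrib algebra_simps)
      qed auto
      then show ?thesis using norm_triangle_ineq[of "al *s u" w] v by simp
    qed
    then have "(norm v)\<^sup>2 \<le> (cmod al * norm u + norm w)\<^sup>2" by (intro power_mono) auto
    also have "\<dots> \<le> 2 * (cmod al * norm u)\<^sup>2 + 2 * (norm w)\<^sup>2"
      using sum_squares_bound[of "cmod al * norm u" "norm w"] by (simp add: power2_sum)
    also have "\<dots> \<le> 2 * (norm u)\<^sup>2 / r * (r * (cmod al)\<^sup>2) + 4 * (cmod (u$3))\<^sup>2 / r * Re (herm w w)"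
      using w2 r by (simp add: power_mult_distrib)
    also have "\<dots> \<le> K * (r * (cmod al)\<^sup>2) + K * Re (herm w w)"
      unfolding K_def using r hw by (intro add_mono mult_right_mono) auto
    also have "\<dots> = K * positive_form u v" unfolding pf by (simp add: distrib_left)
    finally show ?thesis .
  qed
  then show ?thesis using that by blast
qed

lemma positive_form_tendsto:
  assumes "X \<longlonglongrightarrow> 0"
  shows "(\<lambda>n. positive_form u (X n)) \<longlonglongrightarrow> 0"
proof -
  have comp: "(\<lambda>n. X n $ i) \<longlonglongrightarrow> 0 $ i" for i
    by (rule tendsto_vec_nth[OF assms])
  have herm: "(\<lambda>n. herm (X n) (Y n)) \<longlonglongrightarrow> herm 0 w" if "\<And>i. (\<lambda>n. Y n $ i) \<longlonglongrightarrow> w $ i" for Y w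
    unfolding herm_def by (intro tendsto_diff tendsto_add tendsto_mult tendsto_cnj comp that)
  have "(\<lambda>n. positive_form u (X n)) \<longlonglongrightarrow> positive_form u 0"
    unfolding positive_form_def divide_inverse
    by (intro tendsto_diff tendsto_mult tendsto_Re tendsto_power tendsto_norm tendsto_const herm comp)
  then show ?thesis by (simp add: positive_form_def herm_def)
qed

lemma norm_vec_le_sum: "norm x \<le> (\<Sum>i\<in>UNIV. norm (x $ i))"
  by (simp add: norm_vec_def L2_set_le_sum)

text \<open>An elliptic element has powers arbitrarily close to the identity, because all its powers are
  isometries of a positive definite form.\<close>

lemma elliptic_powers_recurrent:
  assumes A: "A \<in> carrier SU21" and u: "A *v u = c *s u" "Re (herm u u) < 0"
  obtains d :: "nat \<Rightarrow> nat" where "\<And>p. d p > 0" "(\<lambda>p. matrix_power A (d p)) \<longlonglongrightarrow> mat 1"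
proof -
  define X where "X = matrix_power A"
  have X: "X m \<in> carrier SU21" "X m *v u = c ^ m *s u" for m
    unfolding X_def by (rule matrix_power_SU21[OF A], rule matrix_power_eigenvector[OF u(1)])
  have inv: "positive_form u (X m *v v) = positive_form u v" for m v
    by (rule positive_form_invariant[OF X]) (use u in simp)
  obtain K where K: "\<And>v. (norm v)\<^sup>2 \<le> K * positive_form u v"
    using positive_form_bound[OF u(2)] by blast
  have entry: "X m $ i $ j = (X m *v axis j 1) $ i" for m i j
    by (simp add: matrix_vector_mult_def axis_def if_distrib[of "\<lambda>x. _ * x"] cong: if_cong)
  define b where "b = (\<Sum>j\<in>UNIV. sqrt (K * positive_form u (axis j 1)))"
  have nn: "0 \<le> K * positive_form u v" for v using K[of v] zero_le_power2 order_trans by blast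
  have "norm (X m $ i $ j) \<le> b" for m i j
  proof -
    have "norm (X m $ i $ j) \<le> norm (X m *v axis j 1)"
      unfolding entry by (rule Finite_Cartesian_Product.norm_nth_le)
    also have "\<dots> \<le> sqrt (K * positive_form u (axis j 1))"
      using K[of "X m *v axis j 1"] unfolding inv by (rule real_le_rsqrt)
    also have "\<dots> \<le> b" unfolding b_def by (intro member_le_sum) (use nn in auto)
    finally show ?thesis .
  qed
  then have "norm (X m) \<le> (\<Sum>i\<in>(UNIV :: 3 set). \<Sum>j\<in>(UNIV :: 3 set). b)" for m
    by (intro order_trans[OF norm_vec_le_sum] sum_mono)
  then have "bounded (range X)" by (auto simp: bounded_iff)
  then obtain l r where r: "strict_mono (r :: nat \<Rightarrow> nat)" "(X \<circ> r) \<longlonglongrightarrow> l"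
    using bounded_imp_convergent_subsequence by blast
  \<comment> \<open>Consecutive members of a convergent subsequence differ by \<open>X (r p)\<close>
    applied to \<open>X (d p) *v e - e\<close>, and \<open>X (r p)\<close> preserves the positive
    form. So \<open>X (d p)\<close> tends to the identity.\<close>
  define d where "d p = r (Suc p) - r p" for p
  have rd: "r (Suc p) = r p + d p" "d p > 0" for p
    using strict_monoD[OF r(1), of p "Suc p"] by (simp_all add: d_def)
  have "(\<lambda>p. X (d p) *v e) \<longlonglongrightarrow> e" for e
  proof -
    have mv: "(\<lambda>p. Y p *v e) \<longlonglongrightarrow> L *v e" if "Y \<longlonglongrightarrow> L" for Y and L :: "complex^3^3"
      unfolding matrix_vector_mult_def
      by (intro tendsto_vec_lambda tendsto_sum tendsto_mult tendsto_vec_nth that tendsto_const)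
    have 1: "(\<lambda>p. X (r p) *v e) \<longlonglongrightarrow> l *v e" using mv[OF r(2)] by simp
    then have "(\<lambda>p. X (r (Suc p)) *v e) \<longlonglongrightarrow> l *v e" by (rule LIMSEQ_Suc)
    then have "(\<lambda>p. X (r (Suc p)) *v e - X (r p) *v e) \<longlonglongrightarrow> l *v e - l *v e" using 1 by (rule tendsto_diff)
    then have "(\<lambda>p. X (r (Suc p)) *v e - X (r p) *v e) \<longlonglongrightarrow> 0" by simp
    then have "(\<lambda>p. positive_form u (X (r (Suc p)) *v e - X (r p) *v e)) \<longlonglongrightarrow> 0"
      by (rule positive_form_tendsto)
    moreover have "positive_form u (X (r (Suc p)) *v e - X (r p) *v e) = positive_form u (X (d p) *v e - e)" for p
    proof -
      have "X (r (Suc p)) *v e - X (r p) *v e = X (r p) *v (X (d p) *v e - e)"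
        unfolding rd(1) X_def matrix_power_add
        by (simp add: matrix_vector_mult_diff_distrib matrix_vector_mul_assoc)
      then show ?thesis by (simp add: inv)
    qed
    ultimately have "(\<lambda>p. K * positive_form u (X (d p) *v e - e)) \<longlonglongrightarrow> K * 0"
      by (intro tendsto_mult_left) simp
    then have lim: "(\<lambda>p. K * positive_form u (X (d p) *v e - e)) \<longlonglongrightarrow> 0" by simp
    have "norm ((norm (X (d p) *v e - e))\<^sup>2) \<le> K * positive_form u (X (d p) *v e - e)" for p
      using K by simp
    then have "(\<lambda>p. (norm (X (d p) *v e - e))\<^sup>2) \<longlonglongrightarrow> 0"
      by (intro Lim_null_comparison[OF always_eventually lim]) simp
    then have "(\<lambda>p. sqrt ((norm (X (d p) *v e - e))\<^sup>2)) \<longlonglongrightarrow> sqrt 0"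
      by (rule tendsto_real_sqrt)
    then have "(\<lambda>p. norm (X (d p) *v e - e)) \<longlonglongrightarrow> 0"
      unfolding real_sqrt_abs abs_norm_cancel real_sqrt_zero .
    then show ?thesis by (rule tendsto_norm_zero_cancel[THEN LIM_zero_cancel])
  qed
  then have "(\<lambda>p. (X (d p) *v axis j 1) $ i) \<longlonglongrightarrow> axis j 1 $ i" for i j
    by (rule tendsto_vec_nth)
  moreover have "axis j 1 $ i = (mat 1 :: complex^3^3) $ i $ j" for i j
    by (simp add: axis_def mat_def)
  ultimately have "(\<lambda>p. X (d p) $ i $ j) \<longlonglongrightarrow> mat 1 $ i $ j" for i j
    unfolding entry by simp
  then have "(\<lambda>p. X (d p)) \<longlonglongrightarrow> mat 1"
    by (intro vec_tendstoI)
  then show ?thesis using that[of d] rd(2) unfolding X_def by blast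
qed

text \<open>The recurrent powers enter a neighbourhood of the identity that meets \<open>H\<close>
  only in the identity class, so some positive power is scalar.\<close>

lemma elliptic_discrete_finite_order:
  assumes A: "A \<in> carrier SU21" and e: "elliptic (PU21_class A)" and H: "discrete_in_PU21 H"
    and sub: "\<And>m. PU21_class (matrix_power A m) \<in> H"
  shows "\<exists>M>0. \<exists>c. matrix_power A M = mat c"
proof -
  obtain z where z: "z \<in> CH2" "PU21_act (PU21_class A) z = z" using e by (auto simp: elliptic_def)
  have neg: "Re (herm (lift z) (lift z)) < 0" using z(1) CH2_iff_herm by blast
  have Theta: "Theta (A *v lift z) = z" using z(2) PU21_act_class[OF A] by simp
  define x where "x = A *v lift z"
  have "herm x x = herm (lift z) (lift z)" using A by (simp add: x_def SU21_def)
  then have "Re (herm x x) < 0" using neg by simp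
  then have x3: "x$3 \<noteq> 0"
    unfolding Re_herm by (metis diff_zero norm_zero not_less zero_power2 add_nonneg_nonneg zero_le_power2)
  have "x = x$3 *s lift z"
    using Theta x3 by (auto simp: x_def[symmetric] Theta_def vec_eq_iff forall_2 forall_3 divide_eq_eq)
  then obtain d :: "nat \<Rightarrow> nat" where d: "\<And>p. d p > 0" "(\<lambda>p. matrix_power A (d p)) \<longlonglongrightarrow> mat 1"
    using elliptic_powers_recurrent[OF A _ neg, of "x$3"] unfolding x_def by metis
  have one: "PU21_class (mat 1) \<in> H" using sub[of 0] by (simp add: matrix_power_simps)
  have "openin (subtopology PU21_topology H) {PU21_class (mat 1)}"
    using H one by (simp add: discrete_in_PU21_def openin_discrete_topology)
  then obtain U where U: "openin PU21_topology U" "{PU21_class (mat 1)} = U \<inter> H"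
    by (auto simp: openin_subtopology)
  then obtain T where T: "open T" "{B \<in> carrier SU21. PU21_class B \<in> U} = carrier SU21 \<inter> T"
    by (auto simp: openin_PU21_topology openin_open)
  have "mat 1 \<in> T" using U(2) T(2) SU21_mat_1 by blast
  then have "\<forall>\<^sub>F p in sequentially. matrix_power A (d p) \<in> T"
    using topological_tendstoD[OF d(2) T(1)] by blast
  then obtain p where p: "matrix_power A (d p) \<in> T"
    using eventually_happens'[OF sequentially_bot] by blast
  have S: "matrix_power A (d p) \<in> carrier SU21" by (rule matrix_power_SU21[OF A])
  then have "PU21_class (matrix_power A (d p)) \<in> U \<inter> H" using p T(2) sub by blast
  then have "PU21_class (matrix_power A (d p)) = PU21_class (mat 1)" using U(2) by blast
  then obtain k where "matrix_power A (d p) = mat k"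
    using PU21_class_eq_iff[OF S SU21_mat_1] by auto
  then show ?thesis using d(1) by blast
qed


section \<open>The main theorem\<close>

lemma monic_cubic_roots:
  fixes a b c :: complex
  obtains l1 l2 l3 where "l1 + l2 + l3 = - a" "l1 * l2 * l3 = - c"
    "\<And>l. l \<in> {l1, l2, l3} \<Longrightarrow> l ^ 3 + a * l\<^sup>2 + b * l + c = 0"
proof -
  have "\<not> constant (poly [:c, b, a, 1:])" by (simp add: constant_degree)
  then obtain z where "poly [:c, b, a, 1:] z = 0" using fundamental_theorem_of_algebra by blast
  then have z: "z ^ 3 + a * z\<^sup>2 + b * z + c = 0"
    by (simp add: power2_eq_square power3_eq_cube algebra_simps)
  define p q where "p = a + z" and "q = b + z * p"
  define r where "r = csqrt (p\<^sup>2 - 4 * q)"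
  define l2 l3 where "l2 = (r - p) / 2" and "l3 = (- r - p) / 2"
  have r: "r\<^sup>2 = p\<^sup>2 - 4 * q" by (simp add: r_def)
  have sum: "l2 + l3 = - p" by (simp add: l2_def l3_def field_simps)
  have "4 * (l2 * l3) = p\<^sup>2 - r\<^sup>2" by (simp add: l2_def l3_def power2_eq_square field_simps)
  then have prod: "l2 * l3 = q" unfolding r by simp
  have "l ^ 3 + a * l\<^sup>2 + b * l + c = (l - z) * (l - l2) * (l - l3)" for l
    using z sum prod unfolding q_def p_def by algebra
  then have "l ^ 3 + a * l\<^sup>2 + b * l + c = 0" if "l \<in> {z, l2, l3}" for l using that by auto
  moreover have "z + l2 + l3 = - a" using sum by (simp add: p_def algebra_simps)
  moreover have "z * l2 * l3 = - c" using z prod unfolding q_def p_def by algebra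
  ultimately show ?thesis using that by blast
qed

lemma scalar_cube_eq_1:
  assumes "mat c \<in> carrier SU21"
  shows "c ^ 3 = 1"
  using assms by (simp add: SU21_def det_3 mat_def power3_eq_cube)

context ideal_triangle
begin

text \<open>Finite projective order would make the roots of the cubic roots of unity with product
  \<open>- 1\<close> and sum of modulus 2, and \<open>roots_of_unity_triple\<close> would force
  \<open>xi ^ 3 + cnj xi ^ 3 = 0\<close>.\<close>

lemma word_matrix_infinite_order:
  assumes d: "distinct [i, j, k]" and M: "M > 0" "matrix_power (word_matrix [i, j, k]) M = mat c"
  shows False
proof -
  have c: "c ^ 3 = 1"
    using matrix_power_SU21[OF word_matrix_SU21, of "[i, j, k]" M] M(2) scalar_cube_eq_1 by simp
  \<comment> \<open>The exponent 18 is 6 times 3: the sixth power removes the sign and the cube root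
    of unity \<open>c\<close>, and the eigenvalue is a cube of \<open>l\<close> or of its
    inverse.\<close>
  have unity: "l ^ (18 * M) = 1" if l: "l ^ 3 - 2 * cnj xi ^ 2 * l\<^sup>2 - 2 * xi\<^sup>2 * l + 1 = 0" for l
  proof -
    obtain m e where e: "e = l ^ 3 \<or> e * l ^ 3 = 1"
      and flips: "foldr flip [i, j, k] (geometric l m) = e *s geometric l m"
      using flips_geometric[OF l d] by blast
    define v where "v = from_coords (geometric l m)"
    have "geometric l m $ (m + 2) = 1" by (simp add: geometric_def index3_neq)
    then have "coords v \<noteq> 0" unfolding v_def coords_from_coords by auto
    moreover have "coords 0 = 0" by (simp add: coords_def herm_def vec_eq_iff)
    ultimately have v0: "v \<noteq> 0" by metis
    have "word_matrix [i, j, k] *v v = ((- 1) ^ 3 * e) *s v"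
      using word_matrix_eigenvector[OF flips] by (simp add: v_def numeral_3_eq_3)
    from matrix_power_eigenvector[OF this, of M]
    have "(((- 1) ^ 3 * e) ^ M) *s v = c *s v" unfolding M(2) mat_mult_vec by (rule sym)
    then have "(- e) ^ M = c" using v0 by auto
    then have "((- e) ^ M) ^ 6 = (c ^ 3)\<^sup>2" by (simp flip: power_mult)
    then have "(- e) ^ (M * 6) = 1" unfolding c by (simp flip: power_mult)
    then have eM: "e ^ (6 * M) = 1" by (simp add: mult.commute)
    have l18: "l ^ (18 * M) = (l ^ 3) ^ (6 * M)" by (simp flip: power_mult)
    from e show ?thesis
    proof
      assume "e = l ^ 3"
      then show ?thesis using eM l18 by simp
    next
      assume "e * l ^ 3 = 1"
      then have "e ^ (6 * M) * (l ^ 3) ^ (6 * M) = 1" by (simp flip: power_mult_distrib)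
      then show ?thesis unfolding eM l18 by simp
    qed
  qed
  obtain l1 l2 l3 where l: "l1 + l2 + l3 = - (- 2 * cnj xi ^ 2)" "l1 * l2 * l3 = - 1"
    and root: "\<And>l. l \<in> {l1, l2, l3} \<Longrightarrow> l ^ 3 + (- 2 * cnj xi ^ 2) * l\<^sup>2 + (- 2 * xi\<^sup>2) * l + 1 = 0"
    using monic_cubic_roots[of "- 2 * cnj xi ^ 2" 1 "- 2 * xi\<^sup>2"] by blast
  have "l ^ (18 * M) = 1" if "l \<in> {l1, l2, l3}" for l
    using unity[of l] root[OF that] by simp
  then have u: "l1 ^ (18 * M) = 1" "l2 ^ (18 * M) = 1" "l3 ^ (18 * M) = 1" by simp_all
  have e: "2 * cnj xi ^ 2 = l1 + l2 + l3" using l(1) by simp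
  have "2 * cnj xi ^ 2 * cnj (2 * cnj xi ^ 2) = 4 * (xi * cnj xi)\<^sup>2"
    by (simp add: power2_eq_square)
  then have "2 * cnj xi ^ 2 * cnj (2 * cnj xi ^ 2) = 4" unfolding xi_cnj by simp
  from roots_of_unity_triple[OF _ u l(2) e this] M(1)
  have "16 + (2 * cnj xi ^ 2) ^ 3 + cnj (2 * cnj xi ^ 2) ^ 3 = 0" by simp
  \<comment> \<open>As \<open>xi\<close> is unimodular, the left side of the previous equation is
    eight times this square, which \<open>xi_sum\<close> shows to be nonzero.\<close>
  then have "8 * (xi ^ 3 + cnj xi ^ 3)\<^sup>2 = 0" using xi_cnj by simp algebra
  then show False using xi_sum by simp
qed

lemma word_matrix_power_in_image:
  assumes "w \<in> carrier Gamma_Z2"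
  shows "PU21_class (matrix_power (word_matrix w) m) \<in> rho (- s) ` carrier Gamma_Z2"
proof (induction m)
  case 0
  have "rho (- s) [] = PU21_class (mat 1)" by (simp add: rho_def PU21_one)
  moreover have "[] \<in> carrier Gamma_Z2" by (simp add: Gamma_Z2_def)
  ultimately show ?case unfolding matrix_power_simps by (metis imageI)
next
  case (Suc m)
  then obtain v where v: "v \<in> carrier Gamma_Z2" "PU21_class (matrix_power (word_matrix w) m) = rho (- s) v"
    by blast
  have "PU21_class (matrix_power (word_matrix w) (Suc m))
    = PU21_class (word_matrix w) \<otimes>\<^bsub>PU21\<^esub> PU21_class (matrix_power (word_matrix w) m)"
    unfolding matrix_power_simps
    by (rule PU21_class_mult[symmetric, OF word_matrix_SU21 matrix_power_SU21[OF word_matrix_SU21]])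
  also have "\<dots> = rho (- s) (w \<otimes>\<^bsub>Gamma_Z2\<^esub> v)"
    unfolding v(2) rho_eq[of w, symmetric] by (rule hom_mult[symmetric, OF rho_hom assms v(1)])
  moreover have "w \<otimes>\<^bsub>Gamma_Z2\<^esub> v \<in> carrier Gamma_Z2"
    using group.is_monoid[OF group_Gamma_Z2] assms v(1) by (rule monoid.m_closed)
  ultimately show ?case by (metis imageI)
qed

lemma indiscrete_if_elliptic:
  assumes d: "distinct [i, j, k]" and e: "elliptic (PU21_class (word_matrix [i, j, k]))"
  shows "\<not> discrete_in_PU21 (rho (- s) ` carrier Gamma_Z2)"
proof
  assume "discrete_in_PU21 (rho (- s) ` carrier Gamma_Z2)"
  moreover have "[i, j, k] \<in> carrier Gamma_Z2" using d by (simp add: Gamma_Z2_def)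
  ultimately obtain M c where "M > 0" "matrix_power (word_matrix [i, j, k]) M = mat c"
    using elliptic_discrete_finite_order[OF word_matrix_SU21 e] word_matrix_power_in_image by blast
  then show False by (rule word_matrix_infinite_order[OF d])
qed

end

theorem mainTheorem1:
  fixes s :: real and i j k :: 3 and g :: "(complex^3^3) set"
  assumes order: "distinct [i, j, k]"
  assumes g: "g = rho s (Gamma_Z2_gen i) \<otimes>\<^bsub>PU21\<^esub> rho s (Gamma_Z2_gen j) \<otimes>\<^bsub>PU21\<^esub> rho s (Gamma_Z2_gen k)"
  shows "((inj_on (rho s) (carrier Gamma_Z2) \<and> discrete_in_PU21 (rho s ` carrier Gamma_Z2))
            \<longleftrightarrow> \<not> elliptic g) \<and>
         (elliptic g \<longrightarrow> \<not> discrete_in_PU21 (rho s ` carrier Gamma_Z2))"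
proof -
  \<comment> \<open>The pure cubic serves only to extract a cube root. The parameter is
    \<open>- s\<close> because the locale attaches \<open>rho\<close> to the negative of its own
    parameter.\<close>
  obtain l1 l2 l3 where "l1 * l2 * l3 = - (- (Complex 1 (- s) / of_real (sqrt (1 + (- s)\<^sup>2))))"
    and root: "\<And>l. l \<in> {l1, l2, l3} \<Longrightarrow> l ^ 3 + 0 * l\<^sup>2 + 0 * l + - (Complex 1 (- s) / of_real (sqrt (1 + (- s)\<^sup>2))) = 0"
    using monic_cubic_roots[of 0 "- (Complex 1 (- s) / of_real (sqrt (1 + (- s)\<^sup>2)))" 0] by metis
  have "0 < sqrt (1 + (- s)\<^sup>2)" by (simp add: add_pos_nonneg)
  moreover have "l1 ^ 3 = Complex 1 (- s) / of_real (sqrt (1 + (- s)\<^sup>2))" using root[of l1] by simp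
  ultimately have "of_real (sqrt (1 + (- s)\<^sup>2)) * l1 ^ 3 = Complex 1 (- s)" by simp
  then interpret ideal_triangle "- s" l1 by unfold_locales
  have g': "g = PU21_class (word_matrix [i, j, k])" using g rho_product[of i j k] by simp
  show ?thesis
  proof (cases "elliptic g")
    case True
    then show ?thesis using indiscrete_if_elliptic[OF order] unfolding g' by simp
  next
    case False
    then have "(- s)\<^sup>2 \<le> 125/3" using elliptic_if_large[OF _ order] unfolding g' by fastforce
    then show ?thesis using discrete_faithful False by simp
  qed
qed

end
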